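(* Let $M$ be a compact connected $C^\infty$ Riemannian manifold of dimension $n\ge 3$, let $X$ be a $C^1$ vector field on $M$ with flow $X_t$, and let $\Lambda\subset M$ be a compact invariant set of $X$. Suppose that there exists a continuous $DX_t$-invariant splitting $T_\Lambda M=E\oplus F$ of the tangent bundle over $\Lambda$. Then $T_\Lambda M=E\oplus F$ is a dominated splitting if and only if there exists $\eta<0$ such that $$\liminf_{t\to+\infty}\frac1t\log\|DX_t|_{E_x}\|-\limsup_{t\to+\infty}\frac1t\log m(DX_t|_{F_x})<\eta$$ for all $x$ in a total probability subset of $\Lambda$.
   Context: $M$ may have boundary, in which case $X$ is assumed inwardly transverse to $\partial M$. A set $\Lambda$ is invariant if $X_t(\Lambda)=\Lambda$ for all $t\in\mathbb{R}$. Splittings are nontrivial: $E_x\ne\{0\}$ and $F_x\neq\{0\}$ for every $x\in\Lambda$. A dominated splitting over $\Lambda$ is a continuous $DX_t$-invariant splitting $T_\Lambda M=E\oplus F$ with $E_x\neq\{0\}$, $F_x\ne\{0\}$ for all $x\in\Lambda$, for which there are $K,\lambda>0$ with $\|DX_t|_{E_x}\|\cdot\|DX_{-t}|_{F_{X_t(x)}}\|<Ke^{-\lambda t}$ for all $x\in\Lambda$ and all $t>0$. For a linear isomorphism $A$, $\|A\|$ is the operator norm and $m(A)=\inf_{\|v\|=1}\|Av\|=\|A^{-1}\|^{-1}$ is the minimum norm (co-norm). A subset $Y\subset\Lambda$ is a total probability subset of $\Lambda$ if $\mu(Y)=1$ for every probability measure $\mu$ on $\Lambda$ that is invariant under $X_t$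 for all $t\in\mathbb{R}$. *)

theory Defs
  imports "HOL-Probability.Probability"
begin

section \<open>Functions of class \<open>C^k\<close> on subsets of a Euclidean space\<close>

text \<open>On an open set \<open>U\<close>: all iterated directional derivatives up to order \<open>k\<close> exist (as Frechet
  derivatives) and are continuous.\<close>

fun Ck_on :: "nat \<Rightarrow> 'a::euclidean_space set \<Rightarrow> ('a \<Rightarrow> 'b::euclidean_space) \<Rightarrow> bool" where
  "Ck_on 0 U f \<longleftrightarrow> continuous_on U f"
| "Ck_on (Suc k) U f \<longleftrightarrow>
     (\<forall>x\<in>U. f differentiable at x) \<and> (\<forall>v. Ck_on k U (\<lambda>x. frechet_derivative f (at x) v))"

text \<open>On an arbitrary set \<open>S\<close> (below: a relatively open subset of a half-space): near every point
  of \<open>S\<close> the function extends to a \<open>C^k\<close> function on an open set.  Here \<open>k = \<infinity>\<close> is allowed.\<close>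

definition diff_class_on :: "enat \<Rightarrow> 'a::euclidean_space set \<Rightarrow> ('a \<Rightarrow> 'b::euclidean_space) \<Rightarrow> bool" where
  "diff_class_on k S f \<longleftrightarrow>
     (\<forall>x\<in>S. \<exists>U g. open U \<and> x \<in> U \<and> (\<forall>j::nat. enat j \<le> k \<longrightarrow> Ck_on j U g) \<and> (\<forall>y\<in>S \<inter> U. g y = f y))"


section \<open>Riemannian manifolds with (possibly empty) boundary\<close>

text \<open>The model space is the half-space of vectors whose inner product with \<open>inner_normal\<close>, an
  arbitrary but fixed vector of the standard basis, is nonnegative.\<close>

definition inner_normal :: "'e::euclidean_space" where
  "inner_normal = (SOME b. b \<in> Basis)"

definition half_space :: "'e::euclidean_space set" where
  "half_space = {v. 0 \<le> v \<bullet> inner_normal}"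

text \<open>The underlying set of the manifold is the whole type \<open>'m\<close>.  The smooth structure is given by an
  atlas indexed by the points of the manifold: \<open>chart_map M p\<close>, defined on \<open>chart_dom M p\<close>, is a chart
  around \<open>p\<close>.  (Every smooth structure has such an atlas: choose a chart around each point.)

  The tangent space at \<open>x\<close> is identified with the model vector space \<open>'e\<close> through the chart that the
  atlas associates with \<open>x\<close>.  So a vector field is a map \<open>'m \<Rightarrow> 'e\<close>, its value at \<open>x\<close> being the
  coordinates in the chart \<open>chart_map M x\<close>; \<open>rmetric M x\<close> is the scalar product on the tangent space
  at \<open>x\<close>.  Since the identification jumps from point to point, all regularity conditions are
  expressed after passing to one common chart by means of \<open>coord_change\<close>.\<close>

record ('m, 'e) manifold_data =
  chart_dom :: "'m \<Rightarrow> 'm set"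
  chart_map :: "'m \<Rightarrow> 'm \<Rightarrow> 'e"
  rmetric :: "'m \<Rightarrow> 'e \<Rightarrow> 'e \<Rightarrow> real"

definition chart_image :: "('m, 'e) manifold_data \<Rightarrow> 'm \<Rightarrow> 'e set" where
  "chart_image M p = chart_map M p ` chart_dom M p"

definition chart_inv :: "('m, 'e) manifold_data \<Rightarrow> 'm \<Rightarrow> 'e \<Rightarrow> 'm" where
  "chart_inv M p = inv_into (chart_dom M p) (chart_map M p)"

text \<open>\<open>coord_change M p q x v\<close>: the coordinates in the chart \<open>q\<close> of the vector tangent at \<open>x\<close> whose
  coordinates in the chart \<open>p\<close> are \<open>v\<close>.\<close>

definition coord_change ::
    "('m, 'e::euclidean_space) manifold_data \<Rightarrow> 'm \<Rightarrow> 'm \<Rightarrow> 'm \<Rightarrow> 'e \<Rightarrow> 'e" where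
  "coord_change M p q x =
     frechet_derivative (\<lambda>y. chart_map M q (chart_inv M p y))
       (at (chart_map M p x) within chart_map M p ` (chart_dom M p \<inter> chart_dom M q))"

definition smooth_manifold ::
    "('m::{t2_space,second_countable_topology}, 'e::euclidean_space) manifold_data \<Rightarrow> bool" where
  "smooth_manifold M \<longleftrightarrow>
     (\<forall>p. open (chart_dom M p) \<and> p \<in> chart_dom M p \<and>
          openin (top_of_set half_space) (chart_image M p) \<and>
          homeomorphism (chart_dom M p) (chart_image M p) (chart_map M p) (chart_inv M p)) \<and>
     (\<forall>p q. diff_class_on \<infinity> (chart_map M p ` (chart_dom M p \<inter> chart_dom M q))
          (\<lambda>y. chart_map M q (chart_inv M p y)))"

definition riemannian_manifold ::
    "('m::{t2_space,second_countable_topology}, 'e::euclidean_space) manifold_data \<Rightarrow> bool" where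
  "riemannian_manifold M \<longleftrightarrow>
     smooth_manifold M \<and>
     (\<forall>x. bilinear (rmetric M x) \<and>
          (\<forall>u v. rmetric M x u v = rmetric M x v u) \<and>
          (\<forall>v. v \<noteq> 0 \<longrightarrow> 0 < rmetric M x v v)) \<and>
     (\<forall>p u v. diff_class_on \<infinity> (chart_image M p)
        (\<lambda>y. let x = chart_inv M p y
             in rmetric M x (coord_change M p x x u) (coord_change M p x x v)))"

definition boundary_points :: "('m, 'e::euclidean_space) manifold_data \<Rightarrow> 'm set" where
  "boundary_points M = {x. chart_map M x x \<bullet> inner_normal = 0}"

definition tangent_norm :: "('m, 'e) manifold_data \<Rightarrow> 'm \<Rightarrow> 'e \<Rightarrow> real" where
  "tangent_norm M x v = sqrt (rmetric M x v v)"

text \<open>Operator norm and minimum norm of the restriction to \<open>S\<close> of a linear map \<open>L\<close> from the tangent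
  space at \<open>x\<close> to the tangent space at \<open>y\<close>; \<open>S\<close> is meant to be a nonzero subspace.\<close>

definition op_norm :: "('m, 'e) manifold_data \<Rightarrow> 'm \<Rightarrow> 'm \<Rightarrow> ('e \<Rightarrow> 'e) \<Rightarrow> 'e set \<Rightarrow> real" where
  "op_norm M x y L S = (SUP v\<in>{v\<in>S. tangent_norm M x v = 1}. tangent_norm M y (L v))"

definition min_norm :: "('m, 'e) manifold_data \<Rightarrow> 'm \<Rightarrow> 'm \<Rightarrow> ('e \<Rightarrow> 'e) \<Rightarrow> 'e set \<Rightarrow> real" where
  "min_norm M x y L S = (INF v\<in>{v\<in>S. tangent_norm M x v = 1}. tangent_norm M y (L v))"


section \<open>Vector fields and their flows\<close>

definition C1_vector_field :: "('m, 'e::euclidean_space) manifold_data \<Rightarrow> ('m \<Rightarrow> 'e) \<Rightarrow> bool" where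
  "C1_vector_field M X \<longleftrightarrow>
     (\<forall>p. diff_class_on 1 (chart_image M p)
        (\<lambda>y. let x = chart_inv M p y in coord_change M x p x (X x)))"

definition inwardly_transverse :: "('m, 'e::euclidean_space) manifold_data \<Rightarrow> ('m \<Rightarrow> 'e) \<Rightarrow> bool" where
  "inwardly_transverse M X \<longleftrightarrow> (\<forall>x\<in>boundary_points M. 0 < X x \<bullet> inner_normal)"

definition integral_curve ::
    "('m::topological_space, 'e::euclidean_space) manifold_data \<Rightarrow> ('m \<Rightarrow> 'e) \<Rightarrow> real set \<Rightarrow> (real \<Rightarrow> 'm) \<Rightarrow> bool" where
  "integral_curve M X J \<gamma> \<longleftrightarrow>
     continuous_on J \<gamma> \<and>
     (\<forall>t\<in>J. ((\<lambda>s. chart_map M (\<gamma> t) (\<gamma> s)) has_vector_derivative X (\<gamma> t)) (at t within J))"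

text \<open>Because of the boundary, the flow is only partially defined for negative times:
  \<open>flow M X t x\<close> is meaningful only if \<open>flow_defined M X t x\<close>.\<close>

definition flow_defined ::
    "('m::topological_space, 'e::euclidean_space) manifold_data \<Rightarrow> ('m \<Rightarrow> 'e) \<Rightarrow> real \<Rightarrow> 'm \<Rightarrow> bool" where
  "flow_defined M X t x \<longleftrightarrow> (\<exists>\<gamma>. integral_curve M X (closed_segment 0 t) \<gamma> \<and> \<gamma> 0 = x)"

definition flow ::
    "('m::topological_space, 'e::euclidean_space) manifold_data \<Rightarrow> ('m \<Rightarrow> 'e) \<Rightarrow> real \<Rightarrow> 'm \<Rightarrow> 'm" where
  "flow M X t x = (THE y. \<exists>\<gamma>. integral_curve M X (closed_segment 0 t) \<gamma> \<and> \<gamma> 0 = x \<and> \<gamma> t = y)"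

text \<open>The derivative at \<open>x\<close> of the time-\<open>t\<close> map, from the tangent space at \<open>x\<close> to the one at
  \<open>flow M X t x\<close>, each in the coordinates belonging to its base point.\<close>

definition Dflow ::
    "('m::topological_space, 'e::euclidean_space) manifold_data \<Rightarrow> ('m \<Rightarrow> 'e) \<Rightarrow> real \<Rightarrow> 'm \<Rightarrow> 'e \<Rightarrow> 'e" where
  "Dflow M X t x =
     frechet_derivative (\<lambda>y. chart_map M (flow M X t x) (flow M X t (chart_inv M x y)))
       (at (chart_map M x x) within chart_image M x)"

definition invariant_set ::
    "('m::topological_space, 'e::euclidean_space) manifold_data \<Rightarrow> ('m \<Rightarrow> 'e) \<Rightarrow> 'm set \<Rightarrow> bool" where
  "invariant_set M X \<Lambda> \<longleftrightarrow>
     (\<forall>t. (\<forall>x\<in>\<Lambda>. flow_defined M X t x) \<and> flow M X t ` \<Lambda> = \<Lambda>)"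


section \<open>Splittings over an invariant set\<close>

definition continuous_section ::
    "('m::topological_space, 'e::euclidean_space) manifold_data \<Rightarrow> 'm set \<Rightarrow> ('m \<Rightarrow> 'e) \<Rightarrow> bool" where
  "continuous_section M S s \<longleftrightarrow>
     (\<forall>p. continuous_on (S \<inter> chart_dom M p) (\<lambda>x. coord_change M x p x (s x)))"

text \<open>Continuity of a family of subspaces over \<open>\<Lambda>\<close>: existence of continuous local frames.  The rank is then
  locally constant on \<open>\<Lambda>\<close>.\<close>

definition continuous_subbundle ::
    "('m::topological_space, 'e::euclidean_space) manifold_data \<Rightarrow> 'm set \<Rightarrow> ('m \<Rightarrow> 'e set) \<Rightarrow> bool" where
  "continuous_subbundle M \<Lambda> E \<longleftrightarrow>
     (\<forall>x\<in>\<Lambda>. \<exists>V (k::nat) s. open V \<and> x \<in> V \<and>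
        (\<forall>i<k. continuous_section M (\<Lambda> \<inter> V) (s i)) \<and>
        (\<forall>y\<in>\<Lambda> \<inter> V. inj_on (\<lambda>i. s i y) {..<k} \<and>
           independent ((\<lambda>i. s i y) ` {..<k}) \<and> span ((\<lambda>i. s i y) ` {..<k}) = E y))"

definition continuous_invariant_splitting ::
    "('m::topological_space, 'e::euclidean_space) manifold_data \<Rightarrow> ('m \<Rightarrow> 'e) \<Rightarrow> 'm set \<Rightarrow>
     ('m \<Rightarrow> 'e set) \<Rightarrow> ('m \<Rightarrow> 'e set) \<Rightarrow> bool" where
  "continuous_invariant_splitting M X \<Lambda> E F \<longleftrightarrow>
     (\<forall>x\<in>\<Lambda>. subspace (E x) \<and> subspace (F x) \<and>
        E x \<inter> F x = {0} \<and> {u + v |u v. u \<in> E x \<and> v \<in> F x} = UNIV \<and>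
        E x \<noteq> {0} \<and> F x \<noteq> {0}) \<and>
     continuous_subbundle M \<Lambda> E \<and> continuous_subbundle M \<Lambda> F \<and>
     (\<forall>x\<in>\<Lambda>. \<forall>t. Dflow M X t x ` E x = E (flow M X t x) \<and>
                 Dflow M X t x ` F x = F (flow M X t x))"

definition dominated_splitting ::
    "('m::topological_space, 'e::euclidean_space) manifold_data \<Rightarrow> ('m \<Rightarrow> 'e) \<Rightarrow> 'm set \<Rightarrow>
     ('m \<Rightarrow> 'e set) \<Rightarrow> ('m \<Rightarrow> 'e set) \<Rightarrow> bool" where
  "dominated_splitting M X \<Lambda> E F \<longleftrightarrow>
     continuous_invariant_splitting M X \<Lambda> E F \<and>
     (\<exists>K>0. \<exists>c>0. \<forall>x\<in>\<Lambda>. \<forall>t>0.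
        op_norm M x (flow M X t x) (Dflow M X t x) (E x) *
        op_norm M (flow M X t x) x (Dflow M X (- t) (flow M X t x)) (F (flow M X t x))
          < K * exp (- c * t))"


section \<open>Total probability subsets\<close>

definition invariant_probability ::
    "('m::topological_space, 'e::euclidean_space) manifold_data \<Rightarrow> ('m \<Rightarrow> 'e) \<Rightarrow> 'm set \<Rightarrow> 'm measure \<Rightarrow> bool" where
  "invariant_probability M X \<Lambda> \<mu> \<longleftrightarrow>
     prob_space \<mu> \<and> space \<mu> = \<Lambda> \<and> sets \<mu> = sets (restrict_space borel \<Lambda>) \<and>
     (\<forall>t. \<forall>A\<in>sets \<mu>. measure \<mu> (flow M X t -` A \<inter> \<Lambda>) = measure \<mu> A)"

definition total_probability_subset ::
    "('m::topological_space, 'e::euclidean_space) manifold_data \<Rightarrow> ('m \<Rightarrow> 'e) \<Rightarrow> 'm set \<Rightarrow> 'm set \<Rightarrow> bool" where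
  "total_probability_subset M X \<Lambda> Y \<longleftrightarrow>
     Y \<subseteq> \<Lambda> \<and> (\<forall>\<mu>. invariant_probability M X \<Lambda> \<mu> \<longrightarrow> measure \<mu> Y = 1)"

end

theory Submission
  imports Defs
begin

text \<open>
  The splitting is dominated iff the continuous subadditive cocycle
  $\log\|DX_t|_{E_x}\| + \log\|DX_{-t}|_{F_{X_t(x)}}\|$ decays linearly in $t$, uniformly in
  $x \in \Lambda$. If it does not, then empirical measures along orbit segments on which the decay
  fails accumulate at an invariant probability measure on which all averages of the cocycle are
  nonnegative. The exponent hypothesis holds almost everywhere for this measure, and the
  Katznelson--Weiss covering argument (half of Kingman's theorem) turns it into a negative average,
  a contradiction. Continuity of the cocycle is $C^1$ dependence of the flow on initial conditions,
  obtained in charts and transported along orbits.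
\<close>

section \<open>Ordinary differential equations over short times\<close>

text \<open>The co-norm of DX_t on F_x is the inverse of the norm of DX_{-t} on the fibre over
  X_t(x). So minus the limsup in the hypothesis is a liminf, and the hypothesis bounds the sum of
  the liminfs of two subadditive cocycles, \<open>expo E\<close> and \<open>expo_inv F\<close>. The
  liminf of their sum can be larger than this, so the covering argument is run on each cocycle
  separately, with its own liminf function, and only the two resulting integrals are added. It is
  run for integer times; rounding real times up costs a bounded amount. Three features of the
  setting shape the rest. The flow may be undefined for negative times near the boundary, but points
  of \<Lambda> have a past, and inward transversality then puts \<Lambda> in the interior, where
  two-sided flow boxes exist. The manifold carries no metric space structure here, so arguments use
  sequences, compactness and Hausdorff separation. Tangent vectors are coordinates in a chart that
  jumps with the base point, so limits of vectors are taken only after passage to the chart of the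
  limit point.\<close>

lemma short_time_bound:
  fixes u u' :: "real \<Rightarrow> 'b::real_normed_vector"
  assumes I: "convex I" "compact I" "t0 \<in> I" "\<And>t. t \<in> I \<Longrightarrow> \<bar>t - t0\<bar> \<le> \<delta>"
    and u: "\<And>t. t \<in> I \<Longrightarrow> (u has_vector_derivative u' t) (at t within I)"
    and u': "\<And>t. t \<in> I \<Longrightarrow> norm (u' t) \<le> L * norm (u t) + e"
    and L: "0 \<le> L" "0 \<le> e" "\<delta> * L \<le> 1/2"
    and t: "t \<in> I"
  shows "norm (u t) \<le> 2 * (norm (u t0) + \<delta> * e)"
proof -
  have "continuous_on I u"
    using u by (meson continuous_on_eq_continuous_within has_vector_derivative_continuous)
  then have "continuous_on I (\<lambda>t. norm (u t))"
    by (intro continuous_intros)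
  \<comment> \<open>At the point \<open>m\<close> of largest norm the mean value inequality bounds
    \<open>u m - u t0\<close> by \<delta> times \<open>L * norm (u m) + e\<close>; as
    \<open>\<delta> * L \<le> 1/2\<close>, half of \<open>norm (u m)\<close> is absorbed. This
    serves in place of Gronwall's inequality throughout.\<close>
  then obtain m where m: "m \<in> I" "\<And>s. s \<in> I \<Longrightarrow> norm (u s) \<le> norm (u m)"
    using continuous_attains_sup[of I] I by (metis empty_iff)
  have "norm (u m - u t0) \<le> (L * norm (u m) + e) * norm (m - t0)"
  proof (rule differentiable_bound[of I u "\<lambda>s h. h *\<^sub>R u' s"])
    show "(u has_derivative (\<lambda>h. h *\<^sub>R u' s)) (at s within I)" if "s \<in> I" for s
      using u[OF that] by (simp add: has_vector_derivative_def)
    show "onorm (\<lambda>h. h *\<^sub>R u' s) \<le> L * norm (u m) + e" if "s \<in> I" for s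
    proof (rule onorm_le)
      fix h :: real
      have "norm (u' s) \<le> L * norm (u m) + e"
        using u'[OF that] mult_left_mono[OF m(2)[OF that] L(1)] by linarith
      then show "norm (h *\<^sub>R u' s) \<le> (L * norm (u m) + e) * norm h"
        by (simp add: mult.commute mult_left_mono)
    qed
  qed (use I m in auto)
  also have "\<dots> \<le> (L * norm (u m) + e) * \<delta>"
    using I(4)[OF m(1)] L by (intro mult_left_mono) auto
  also have "\<dots> = (\<delta> * L) * norm (u m) + \<delta> * e"
    by (simp add: algebra_simps)
  also have "\<dots> \<le> 1/2 * norm (u m) + \<delta> * e"
    using L(3) by (intro add_right_mono mult_right_mono) auto
  finally have "norm (u m - u t0) \<le> 1/2 * norm (u m) + \<delta> * e" .
  moreover have "norm (u m) \<le> norm (u t0) + norm (u m - u t0)"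
    by norm
  ultimately have "norm (u m) \<le> 2 * (norm (u t0) + \<delta> * e)" by (simp add: algebra_simps)
  with m(2)[OF t] show ?thesis by linarith
qed

text \<open>One application of the Picard operator to \<open>c\<close>. The antiderivative is
  normalised at time 0, inside the interval, so that past and future are treated together;
  \<open>\<delta> * B \<le> r\<close> keeps the new curve in the ball.\<close>

lemma picard_step:
  fixes g :: "real \<Rightarrow> 'b::banach \<Rightarrow> 'b"
  assumes \<delta>: "0 < \<delta>"
    and cont: "continuous_on ({-\<delta>..\<delta>} \<times> cball y r) (\<lambda>(t, x). g t x)"
    and B: "\<And>t x. t \<in> {-\<delta>..\<delta>} \<Longrightarrow> x \<in> cball y r \<Longrightarrow> norm (g t x) \<le> B" "\<delta> * B \<le> r"
    and c: "continuous_on {-\<delta>..\<delta>} c" "c ` {-\<delta>..\<delta>} \<subseteq> cball y r"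
  shows "\<exists>d. d 0 = y \<and> continuous_on {-\<delta>..\<delta>} d \<and> d ` {-\<delta>..\<delta>} \<subseteq> cball y r \<and>
    (\<forall>t\<in>{-\<delta>..\<delta>}. (d has_vector_derivative g t (c t)) (at t within {-\<delta>..\<delta>}))"
proof -
  have "continuous_on {-\<delta>..\<delta>} ((\<lambda>(t, x). g t x) \<circ> (\<lambda>t. (t, c t)))"
    by (intro continuous_on_compose continuous_intros c continuous_on_subset[OF cont])
       (use c in auto)
  then have "continuous_on {-\<delta>..\<delta>} (\<lambda>t. g t (c t))"
    by (simp add: o_def)
  then obtain G where G: "\<And>t. t \<in> {-\<delta>..\<delta>} \<Longrightarrow>
      (G has_vector_derivative g t (c t)) (at t within {-\<delta>..\<delta>})"
    by (rule antiderivative_continuous) blast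
  define d where "d t = y + (G t - G 0)" for t
  have d: "(d has_vector_derivative g t (c t)) (at t within {-\<delta>..\<delta>})" if "t \<in> {-\<delta>..\<delta>}" for t
    unfolding d_def using G[OF that] by (auto intro!: derivative_eq_intros)
  have *: "norm (d t - y) \<le> r" if t: "t \<in> {-\<delta>..\<delta>}" for t
  proof -
    have B0: "0 \<le> B"
      using B(1)[OF t] c(2) t norm_ge_zero order_trans by (metis image_subset_iff)
    have "norm (d t - d 0) \<le> B * norm (t - 0)"
    proof (rule differentiable_bound[of "{-\<delta>..\<delta>}" d "\<lambda>s h. h *\<^sub>R g s (c s)"])
      show "onorm (\<lambda>h. h *\<^sub>R g s (c s)) \<le> B" if "s \<in> {-\<delta>..\<delta>}" for s
      proof (rule onorm_le)
        fix h :: real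
        have "norm (g s (c s)) \<le> B" using B(1) that c(2) by (metis image_subset_iff)
        then show "norm (h *\<^sub>R g s (c s)) \<le> B * norm h"
          by (simp add: mult.commute[of B] mult_left_mono)
      qed
    qed (use d t \<delta> in \<open>auto simp: has_vector_derivative_def\<close>)
    also have "\<dots> \<le> B * \<delta>"
      using t B0 by (intro mult_left_mono) auto
    finally show ?thesis using B(2) by (simp add: d_def mult.commute)
  qed
  have "continuous_on {-\<delta>..\<delta>} d"
    using d by (meson continuous_on_eq_continuous_within has_vector_derivative_continuous)
  with d * show ?thesis
    by (intro exI[of _ d]) (auto simp: d_def dist_norm norm_minus_commute)
qed

text \<open>\<open>g\<close> may depend on time because there are two uses: the flow, with
  \<open>g\<close> constant in time, and the linear variational equation along an orbit, in the
  Banach space of bounded linear maps.\<close>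

lemma picard:
  fixes g :: "real \<Rightarrow> 'b::banach \<Rightarrow> 'b"
  assumes \<delta>: "0 < \<delta>" and r: "0 \<le> r"
    and cont: "continuous_on ({-\<delta>..\<delta>} \<times> cball y r) (\<lambda>(t, x). g t x)"
    and B: "\<And>t x. t \<in> {-\<delta>..\<delta>} \<Longrightarrow> x \<in> cball y r \<Longrightarrow> norm (g t x) \<le> B" "\<delta> * B \<le> r"
    and L: "\<And>t x x'. t \<in> {-\<delta>..\<delta>} \<Longrightarrow> x \<in> cball y r \<Longrightarrow> x' \<in> cball y r \<Longrightarrow>
      norm (g t x - g t x') \<le> L * norm (x - x')" "0 \<le> L" "\<delta> * L \<le> 1/4"
  shows "\<exists>c. c 0 = y \<and> c ` {-\<delta>..\<delta>} \<subseteq> cball y r \<and>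
    (\<forall>t\<in>{-\<delta>..\<delta>}. (c has_vector_derivative g t (c t)) (at t within {-\<delta>..\<delta>}))"
proof -
  let ?I = "{-\<delta>..\<delta>}"
  define ok where "ok c \<longleftrightarrow> c 0 = y \<and> continuous_on ?I c \<and> c ` ?I \<subseteq> cball y r" for c
  define nx where "nx c = (SOME d. ok d \<and>
    (\<forall>t\<in>?I. (d has_vector_derivative g t (c t)) (at t within ?I)))" for c
  have nx: "ok (nx c) \<and> (\<forall>t\<in>?I. (nx c has_vector_derivative g t (c t)) (at t within ?I))"
    if "ok c" for c
  proof -
    have "\<exists>d. ok d \<and> (\<forall>t\<in>?I. (d has_vector_derivative g t (c t)) (at t within ?I))"
      using picard_step[OF \<delta> cont B, of c] that by (simp add: ok_def)
    then show ?thesis unfolding nx_def by (rule someI_ex)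
  qed
  define p where "p n = (nx ^^ n) (\<lambda>_. y)" for n
  have ok: "ok (p n)" for n
    by (induction n) (use nx r in \<open>auto simp: p_def ok_def\<close>)
  have dp: "(p (Suc n) has_vector_derivative g t (p n t)) (at t within ?I)" if "t \<in> ?I" for n t
    using nx[OF ok[of n]] that by (simp add: p_def)
  have mem: "p n t \<in> cball y r" if "t \<in> ?I" for n t
    using ok[of n] that unfolding ok_def by blast
  have diff: "norm (p (Suc n) t - p n t) \<le> 2 * r * (1/2)^n" if "t \<in> ?I" for n t
    using that
  proof (induction n arbitrary: t)
    case 0
    have "dist y (p 1 t) \<le> r" using mem[OF 0, of 1] by (simp del: One_nat_def)
    then show ?case using r by (simp add: p_def dist_norm norm_minus_commute)
  next
    case (Suc n)
    have "norm (p (Suc (Suc n)) t - p (Suc n) t) \<le>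
      2 * (norm (p (Suc (Suc n)) 0 - p (Suc n) 0) + \<delta> * (L * (2 * r * (1/2)^n)))"
    \<comment> \<open>The derivative is estimated by the previous difference alone, hence
      \<open>L=0\<close> here. The factor 2 of the bound and \<open>\<delta> * L \<le> 1/4\<close>
      halve the distance at each iteration.\<close>
    proof (rule short_time_bound[where I="?I" and L=0])
      fix s assume s: "s \<in> ?I"
      show "((\<lambda>s. p (Suc (Suc n)) s - p (Suc n) s) has_vector_derivative
          (g s (p (Suc n) s) - g s (p n s))) (at s within ?I)"
        by (intro derivative_intros dp s)
      have "norm (g s (p (Suc n) s) - g s (p n s)) \<le> L * norm (p (Suc n) s - p n s)"
        by (intro L mem s)
      also have "\<dots> \<le> L * (2 * r * (1/2)^n)"
        by (intro mult_left_mono Suc.IH s L)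
      finally show "norm (g s (p (Suc n) s) - g s (p n s)) \<le>
          0 * norm (p (Suc (Suc n)) s - p (Suc n) s) + L * (2 * r * (1/2)^n)"
        by simp
    qed (use \<delta> L r Suc.prems in auto)
    also have "\<dots> = (\<delta> * L) * (4 * r * (1/2)^n)"
      using ok[of "Suc n"] ok[of "Suc (Suc n)"] by (simp add: ok_def)
    also have "\<dots> \<le> 1/4 * (4 * r * (1/2)^n)"
      using r L(3) by (intro mult_right_mono) auto
    also have "\<dots> \<le> 2 * r * (1/2)^Suc n" using r by simp
    finally show ?case .
  qed
  define c where "c t = lim (\<lambda>n. p n t)" for t
  have lim: "(\<lambda>n. p n t) \<longlonglongrightarrow> c t" if t: "t \<in> ?I" for t
  proof -
    have "summable (\<lambda>n. p (Suc n) t - p n t)"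
      by (rule summable_comparison_test'[OF summable_mult[OF summable_geometric], where N=0])
         (use diff[OF t] in auto)
    then have "convergent (\<lambda>n. \<Sum>i<n. p (Suc i) t - p i t)"
      by (simp add: summable_iff_convergent)
    moreover have "(\<Sum>i<n. p (Suc i) t - p i t) = p n t - p 0 t" for n
      by (rule sum_lessThan_telescope)
    ultimately have "convergent (\<lambda>n. p n t - p 0 t)" by simp
    from convergent_add[OF this convergent_const[of "p 0 t"]] show ?thesis
      by (simp add: c_def convergent_LIMSEQ_iff)
  qed
  have memc: "c t \<in> cball y r" if "t \<in> ?I" for t
    using closed_sequentially[OF closed_cball mem[OF that] lim[OF that]] .
  have err: "norm (c t - p n t) \<le> 4 * r * (1/2)^n" if t: "t \<in> ?I" for n t
  proof -
    have *: "norm (p (n + m) t - p n t) \<le> 4 * r * (1/2)^n - 4 * r * (1/2)^(n+m)" for m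
    proof (induction m)
      case (Suc m)
      have "norm (p (n + Suc m) t - p n t) \<le> norm (p (Suc (n + m)) t - p (n + m) t) + norm (p (n + m) t - p n t)"
        using norm_triangle_ineq[of "p (Suc (n + m)) t - p (n + m) t" "p (n + m) t - p n t"] by simp
      with Suc diff[OF t, of "n+m"] show ?case by simp
    qed simp
    have "norm (p (n + m) t - p n t) \<le> 4 * r * (1/2)^n" for m
    proof -
      have "0 \<le> 4 * r * (1/2)^(n+m)" using r by simp
      with *[of m] show ?thesis by linarith
    qed
    moreover have "(\<lambda>m. norm (p (n + m) t - p n t)) \<longlonglongrightarrow> norm (c t - p n t)"
      using LIMSEQ_ignore_initial_segment[OF lim[OF t], of n]
      by (intro tendsto_intros) (simp add: add.commute)
    ultimately show ?thesis
      by (intro LIMSEQ_le_const2) auto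
  qed
  \<comment> \<open>The derivative of \<open>p (Suc n)\<close> is \<open>g t (p n t)\<close>, which
    converges uniformly, so the limit of the shifted sequence is differentiable; this limit
    \<open>d\<close> agrees with \<open>c\<close> on the interval.\<close>
  have "\<exists>d. \<forall>t\<in>?I. (\<lambda>n. p (Suc n) t) \<longlonglongrightarrow> d t \<and>
      (d has_derivative (\<lambda>h. h *\<^sub>R g t (c t))) (at t within ?I)"
  proof (rule has_derivative_sequence)
    show "(\<lambda>n. p (Suc n) 0) \<longlonglongrightarrow> y"
      using ok by (simp add: ok_def)
    show "(p (Suc n) has_derivative (\<lambda>h. h *\<^sub>R g t (p n t))) (at t within ?I)" if "t \<in> ?I" for n t
      using dp[OF that] by (simp add: has_vector_derivative_def)
    fix e :: real assume "e > 0"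
    have "(\<lambda>n. L * (4 * r * (1/2)^n)) \<longlonglongrightarrow> L * (4 * r * 0)"
      by (intro tendsto_intros LIMSEQ_realpow_zero) auto
    then have "\<forall>\<^sub>F n in sequentially. L * (4 * r * (1/2)^n) < e"
      using \<open>e > 0\<close> order_tendstoD(2) by fastforce
    then show "\<forall>\<^sub>F n in sequentially. \<forall>t\<in>?I. \<forall>h. norm (h *\<^sub>R g t (p n t) - h *\<^sub>R g t (c t)) \<le> e * norm h"
    proof eventually_elim
      case (elim n)
      show ?case
      proof (intro ballI allI)
        fix t h assume t: "t \<in> ?I"
        have "norm (g t (c t) - g t (p n t)) \<le> L * norm (c t - p n t)"
          by (intro L t mem memc)
        also have "\<dots> \<le> L * (4 * r * (1/2)^n)"
          by (intro mult_left_mono err t L)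
        finally have "norm (g t (p n t) - g t (c t)) \<le> e"
          using elim by (simp add: norm_minus_commute)
        then show "norm (h *\<^sub>R g t (p n t) - h *\<^sub>R g t (c t)) \<le> e * norm h"
          by (simp add: scaleR_diff_right[symmetric] mult.commute[of e] mult_left_mono)
      qed
    qed
  qed (use \<delta> in auto)
  then obtain d where d: "\<And>t. t \<in> ?I \<Longrightarrow> (\<lambda>n. p (Suc n) t) \<longlonglongrightarrow> d t"
      "\<And>t. t \<in> ?I \<Longrightarrow> (d has_vector_derivative g t (c t)) (at t within ?I)"
    unfolding has_vector_derivative_def by blast
  have dc: "d t = c t" if "t \<in> ?I" for t
    using LIMSEQ_unique[OF d(1)[OF that] LIMSEQ_Suc[OF lim[OF that]]] .
  have I0: "0 \<in> ?I" using \<delta> by simp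
  have "p n 0 = y" for n using ok[of n] by (simp add: ok_def)
  then have "c 0 = y"
    using lim[OF I0] by (simp add: LIMSEQ_const_iff)
  with dc[OF I0] have "d 0 = y" by simp
  moreover have "d ` ?I \<subseteq> cball y r"
    using memc by (force simp: dc)
  moreover have "\<forall>t\<in>?I. (d has_vector_derivative g t (d t)) (at t within ?I)"
    using d(2) by (simp add: dc)
  ultimately show ?thesis by blast
qed

section \<open>C1 flows of vector fields on Euclidean balls\<close>

lemma C1_ball_bounds:
  fixes f :: "'e::euclidean_space \<Rightarrow> 'e" and f' :: "'e \<Rightarrow> 'e \<Rightarrow>\<^sub>L 'e"
  assumes R: "0 < R"
    and f: "\<And>z. z \<in> ball z0 R \<Longrightarrow> (f has_derivative blinfun_apply (f' z)) (at z)"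
    and f': "continuous_on (ball z0 R) f'"
  obtains L where "1 \<le> L" "\<And>z. z \<in> cball z0 (R/2) \<Longrightarrow> norm (f z) \<le> L"
    "\<And>z. z \<in> cball z0 (R/2) \<Longrightarrow> norm (f' z) \<le> L"
    "\<And>z z'. z \<in> cball z0 (R/2) \<Longrightarrow> z' \<in> cball z0 (R/2) \<Longrightarrow> norm (f z - f z') \<le> L * norm (z - z')"
proof -
  let ?C = "cball z0 (R/2)"
  have C: "?C \<subseteq> ball z0 R" using R by auto
  have cf: "continuous_on ?C f"
    using f C by (meson continuous_at_imp_continuous_on has_derivative_continuous subsetD)
  have cf': "continuous_on ?C f'"
    using f' C by (rule continuous_on_subset)
  obtain B1 where B1: "\<And>z. z \<in> ?C \<Longrightarrow> norm (f z) \<le> B1"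
    using compact_imp_bounded[OF compact_continuous_image[OF cf compact_cball]]
    unfolding bounded_iff by blast
  obtain B2 where B2: "\<And>z. z \<in> ?C \<Longrightarrow> norm (f' z) \<le> B2"
    using compact_imp_bounded[OF compact_continuous_image[OF cf' compact_cball]]
    unfolding bounded_iff by blast
  define L where "L = max 1 (max B1 B2)"
  show ?thesis
  proof (rule that[of L])
    show "norm (f z - f z') \<le> L * norm (z - z')" if "z \<in> ?C" "z' \<in> ?C" for z z'
    proof (rule differentiable_bound[of ?C f "\<lambda>z. blinfun_apply (f' z)"])
      show "onorm (blinfun_apply (f' z)) \<le> L" if "z \<in> ?C" for z
        using B2[OF that] by (simp add: L_def norm_blinfun.rep_eq)
      show "(f has_derivative blinfun_apply (f' z)) (at z within ?C)" if "z \<in> ?C" for z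
        using f C that has_derivative_at_withinI by blast
    qed (use that in auto)
  qed (use B1 B2 in \<open>force simp: L_def\<close>)+
qed

text \<open>Uniform continuity of \<open>f'\<close> on the compact set makes the linearization error
  uniform in the base point, so that one \<open>d\<close> serves along an entire trajectory.
  Convexity keeps the segment between \<open>z\<close> and \<open>z'\<close> inside
  \<open>C\<close>.\<close>

lemma C1_uniform_linearization:
  fixes f :: "'e::euclidean_space \<Rightarrow> 'e" and f' :: "'e \<Rightarrow> 'e \<Rightarrow>\<^sub>L 'e"
  assumes C: "convex C" "compact C" "open U" "C \<subseteq> U"
    and f: "\<And>z. z \<in> U \<Longrightarrow> (f has_derivative blinfun_apply (f' z)) (at z)"
    and f': "continuous_on U f'" and e: "0 < e"
  obtains d where "0 < d" "\<And>z z'. z \<in> C \<Longrightarrow> z' \<in> C \<Longrightarrow> norm (z' - z) < d \<Longrightarrow>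
    norm (f z' - f z - f' z (z' - z)) \<le> e * norm (z' - z)"
proof -
  have "uniformly_continuous_on C f'"
    using f' C by (intro compact_uniformly_continuous) (auto intro: continuous_on_subset)
  then obtain d where d: "0 < d" "\<And>z z'. z \<in> C \<Longrightarrow> z' \<in> C \<Longrightarrow> dist z' z < d \<Longrightarrow> dist (f' z') (f' z) < e"
    using e unfolding uniformly_continuous_on_def by metis
  show ?thesis
  proof (rule that[OF d(1)])
    fix z z' assume z: "z \<in> C" "z' \<in> C" "norm (z' - z) < d"
    have "norm (f z' - f z - f' z (z' - z)) \<le> norm (z' - z) * e"
    proof (rule differentiable_bound_linearization[where S="closed_segment z z'" and f'="\<lambda>z. blinfun_apply (f' z)"])
      have sub: "closed_segment z z' \<subseteq> C" using C z by (simp add: closed_segment_subset)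
      show "(f has_derivative blinfun_apply (f' x)) (at x within closed_segment z z')"
        if "x \<in> closed_segment z z'" for x
        using f sub C(4) that has_derivative_at_withinI by blast
      show "onorm (blinfun_apply (f' x) - blinfun_apply (f' z)) \<le> e" if "x \<in> closed_segment z z'" for x
      proof -
        have "norm (x - z) \<le> norm (z' - z)" using segment_bound(1)[OF that] by simp
        then have "dist (f' x) (f' z) < e"
          using d(2)[of z x] z sub that by (auto simp: dist_norm)
        moreover have "blinfun_apply (f' x) - blinfun_apply (f' z) = blinfun_apply (f' x - f' z)"
          by (auto simp: blinfun.diff_left)
        ultimately show ?thesis by (simp add: dist_norm norm_blinfun.rep_eq)
      qed
      show "z + t *\<^sub>R (z' - z) \<in> closed_segment z z'" if "t \<in> {0..1}" for t
        using that by (auto simp: in_segment algebra_simps)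
    qed simp
    then show "norm (f z' - f z - f' z (z' - z)) \<le> e * norm (z' - z)" by (simp add: mult.commute)
  qed
qed

text \<open>The spatial derivative is taken to be the solution \<open>a\<close> of the variational
  equation, with right-hand side \<open>f' (c y t) o\<^sub>L a\<close> and the identity as initial
  value. The remainder \<open>w\<close> of the linear approximation satisfies the same equation up
  to an error small compared with the displacement, and \<open>short_time_bound\<close> makes
  \<open>w\<close> itself that small.\<close>

lemma local_C1_flow:
  fixes f :: "'e::euclidean_space \<Rightarrow> 'e" and f' :: "'e \<Rightarrow> 'e \<Rightarrow>\<^sub>L 'e"
  assumes R: "0 < R"
    and f: "\<And>z. z \<in> ball z0 R \<Longrightarrow> (f has_derivative blinfun_apply (f' z)) (at z)"
    and f': "continuous_on (ball z0 R) f'"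
  obtains \<delta> r \<Phi> A where "0 < \<delta>" "0 < r" "r \<le> R"
    "\<And>t y. t \<in> {-\<delta>..\<delta>} \<Longrightarrow> y \<in> ball z0 r \<Longrightarrow> \<Phi> t y \<in> ball z0 R"
    "\<And>y. y \<in> ball z0 r \<Longrightarrow> \<Phi> 0 y = y"
    "\<And>t y. t \<in> {-\<delta>..\<delta>} \<Longrightarrow> y \<in> ball z0 r \<Longrightarrow>
      ((\<lambda>t. \<Phi> t y) has_vector_derivative f (\<Phi> t y)) (at t within {-\<delta>..\<delta>})"
    "\<And>t y. t \<in> {-\<delta>..\<delta>} \<Longrightarrow> y \<in> ball z0 r \<Longrightarrow> (\<Phi> t has_derivative blinfun_apply (A t y)) (at y)"
    "continuous_on ({-\<delta>..\<delta>} \<times> ball z0 r) (\<lambda>(t, y). \<Phi> t y)"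
    "continuous_on ({-\<delta>..\<delta>} \<times> ball z0 r) (\<lambda>(t, y). A t y)"
proof -
  let ?C = "cball z0 (R/2)"
  have C: "?C \<subseteq> ball z0 R" using R by auto
  obtain L where L: "1 \<le> L" "\<And>z. z \<in> ?C \<Longrightarrow> norm (f z) \<le> L" "\<And>z. z \<in> ?C \<Longrightarrow> norm (f' z) \<le> L"
    "\<And>z z'. z \<in> ?C \<Longrightarrow> z' \<in> ?C \<Longrightarrow> norm (f z - f z') \<le> L * norm (z - z')"
    using C1_ball_bounds[OF assms] by blast
  \<comment> \<open>Curves starting in \<open>ball z0 r\<close> move by at most \<open>r\<close>,
    hence stay in the compact ball of radius \<open>R/2\<close>, where \<open>L\<close> bounds
    everything. The two terms in the definition of \<delta> give the contraction factor and this
    confinement.\<close>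
  define r where "r = R/4"
  define \<delta> where "\<delta> = min (1/(4*L)) (r/L)"
  have r: "0 < r" "r \<le> R" and \<delta>: "0 < \<delta>" "\<delta> * L \<le> 1/4" "\<delta> * L \<le> r"
    using R L(1) by (auto simp: r_def \<delta>_def min_def field_simps)
  let ?I = "{-\<delta>..\<delta>}"
  have sub: "cball y r \<subseteq> ?C" if "y \<in> ball z0 r" for y
  proof
    fix x assume "x \<in> cball y r"
    then have "dist z0 x \<le> r + r" using that dist_triangle[of z0 x y] by auto
    then show "x \<in> ?C" by (simp add: r_def)
  qed
  have cf: "continuous_on ?C f"
    using f C by (meson continuous_at_imp_continuous_on has_derivative_continuous subsetD)
  have "\<exists>c. c 0 = y \<and> c ` ?I \<subseteq> cball y r \<and>
      (\<forall>t\<in>?I. (c has_vector_derivative f (c t)) (at t within ?I))" if y: "y \<in> ball z0 r" for y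
  proof (rule picard[where g="\<lambda>_. f" and B=L and L=L])
    have "continuous_on (?I \<times> cball y r) (f \<circ> snd)"
      using sub[OF y] by (intro continuous_on_compose continuous_intros continuous_on_subset[OF cf]) auto
    then show "continuous_on (?I \<times> cball y r) (\<lambda>(t, x). f x)"
      by (simp add: o_def case_prod_unfold)
    show "norm (f x - f x') \<le> L * norm (x - x')" if "x \<in> cball y r" "x' \<in> cball y r" for x x'
      using L(4) sub[OF y] that by blast
  qed (use \<delta> r L sub[OF y] in auto)
  then obtain c where c: "\<And>y. y \<in> ball z0 r \<Longrightarrow> c y 0 = y"
      "\<And>y t. y \<in> ball z0 r \<Longrightarrow> t \<in> ?I \<Longrightarrow> c y t \<in> cball y r"
      "\<And>y t. y \<in> ball z0 r \<Longrightarrow> t \<in> ?I \<Longrightarrow> (c y has_vector_derivative f (c y t)) (at t within ?I)"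
    by (metis image_subset_iff)
  have cC: "c y t \<in> ?C" if "y \<in> ball z0 r" "t \<in> ?I" for y t
    using c(2)[OF that] sub[OF that(1)] by blast
  have cc: "continuous_on ?I (c y)" if "y \<in> ball z0 r" for y
    using c(3)[OF that] by (meson continuous_on_eq_continuous_within has_vector_derivative_continuous)
  have lip_y: "norm (c y t - c y' t) \<le> 2 * norm (y - y')"
    if y: "y \<in> ball z0 r" "y' \<in> ball z0 r" and t: "t \<in> ?I" for y y' t
  proof -
    have "norm (c y t - c y' t) \<le> 2 * (norm (c y 0 - c y' 0) + \<delta> * 0)"
      by (rule short_time_bound[where I="?I" and L=L and u'="\<lambda>t. f (c y t) - f (c y' t)"])
        (use y t \<delta> L cC in \<open>auto intro!: derivative_intros c\<close>)
    then show ?thesis using c(1) y by simp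
  qed
  have lip_t: "norm (c y t - c y s) \<le> L * norm (t - s)"
    if y: "y \<in> ball z0 r" and t: "t \<in> ?I" "s \<in> ?I" for y t s
  proof (rule differentiable_bound[of ?I "c y" "\<lambda>s h. h *\<^sub>R f (c y s)"])
    show "onorm (\<lambda>h. h *\<^sub>R f (c y s)) \<le> L" if "s \<in> ?I" for s
      using L(2)[OF cC[OF y that]] by (intro onorm_le) (simp add: mult.commute[of L] mult_left_mono)
  qed (use t c(3)[OF y] in \<open>auto simp: has_vector_derivative_def\<close>)
  \<comment> \<open>The unit ball around the identity bounds the norm of \<open>a\<close> by 2, so
    the right-hand side is at most \<open>2 * L\<close>, and
    \<open>\<delta> * (2 * L) \<le> 1/2\<close> keeps the solution in this ball.\<close>
  have "\<exists>a. a 0 = id_blinfun \<and> a ` ?I \<subseteq> cball id_blinfun 1 \<and>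
      (\<forall>t\<in>?I. (a has_vector_derivative (f' (c y t) o\<^sub>L a t)) (at t within ?I))" if y: "y \<in> ball z0 r" for y
  proof (rule picard[where g="\<lambda>t a. f' (c y t) o\<^sub>L a" and B="2*L" and L=L])
    show "continuous_on (?I \<times> cball id_blinfun 1) (\<lambda>(t, a). f' (c y t) o\<^sub>L a)"
    proof -
      have *: "continuous_on ?I (\<lambda>t. f' (c y t))"
        by (rule continuous_on_compose2[OF f' cc[OF y]]) (use cC[OF y] C in blast)
      have "continuous_on (?I \<times> cball id_blinfun 1) (\<lambda>p. f' (c y (fst p)) o\<^sub>L snd p)"
        by (intro bounded_bilinear.continuous_on[OF bounded_bilinear_blinfun_compose]
            continuous_on_compose2[OF *] continuous_intros) auto
      then show ?thesis by (simp add: case_prod_unfold)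
    qed
    show "norm (f' (c y t) o\<^sub>L a) \<le> 2 * L" if "t \<in> ?I" "a \<in> cball id_blinfun 1" for t a
    proof -
      have "norm a \<le> norm (id_blinfun :: 'e \<Rightarrow>\<^sub>L 'e) + dist id_blinfun a"
        by (metis dist_norm norm_minus_commute norm_triangle_sub)
      also have "\<dots> \<le> 2" using that norm_blinfun_id_le[where 'a='e] by simp
      finally have "norm (f' (c y t)) * norm a \<le> L * 2"
        using L(3)[OF cC[OF y that(1)]] L(1) by (intro mult_mono) auto
      then show ?thesis using norm_blinfun_compose[of "f' (c y t)" a] by simp
    qed
    show "norm ((f' (c y t) o\<^sub>L a) - (f' (c y t) o\<^sub>L b)) \<le> L * norm (a - b)" if "t \<in> ?I" for t a b
    proof -
      have "(f' (c y t) o\<^sub>L a) - (f' (c y t) o\<^sub>L b) = f' (c y t) o\<^sub>L (a - b)"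
        by (simp add: bounded_bilinear.diff_right[OF bounded_bilinear_blinfun_compose])
      also have "norm \<dots> \<le> norm (f' (c y t)) * norm (a - b)" by (rule norm_blinfun_compose)
      also have "\<dots> \<le> L * norm (a - b)"
        using L(3)[OF cC[OF y that(1)]] by (intro mult_right_mono) auto
      finally show ?thesis .
    qed
  qed (use \<delta> L in auto)
  then obtain a where a: "\<And>y. y \<in> ball z0 r \<Longrightarrow> a y 0 = id_blinfun"
      "\<And>y t. y \<in> ball z0 r \<Longrightarrow> t \<in> ?I \<Longrightarrow> a y t \<in> cball id_blinfun 1"
      "\<And>y t. y \<in> ball z0 r \<Longrightarrow> t \<in> ?I \<Longrightarrow> (a y has_vector_derivative (f' (c y t) o\<^sub>L a y t)) (at t within ?I)"
    by (metis image_subset_iff)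
  have norm_a: "norm (a y t) \<le> 2" if "y \<in> ball z0 r" "t \<in> ?I" for y t
  proof -
    have "norm (a y t) \<le> norm (id_blinfun :: 'e \<Rightarrow>\<^sub>L 'e) + dist id_blinfun (a y t)"
      by (metis dist_norm norm_minus_commute norm_triangle_sub)
    also have "\<dots> \<le> 2" using a(2)[OF that] norm_blinfun_id_le[where 'a='e] by simp
    finally show ?thesis .
  qed
  have deriv: "((\<lambda>y. c y t) has_derivative blinfun_apply (a y t)) (at y)"
    if y: "y \<in> ball z0 r" and t: "t \<in> ?I" for y t
    unfolding has_derivative_at_alt
  proof (intro conjI allI impI)
    show "bounded_linear (blinfun_apply (a y t))" by (rule blinfun.bounded_linear_right)
    fix e :: real assume e: "0 < e"
    \<comment> \<open>Chosen so that the bound \<open>2 * \<delta> * e' * 2 * norm (y' - y)\<close>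
      below equals \<open>e * norm (y' - y)\<close>; the second 2 is the Lipschitz constant of the
      flow in \<open>y\<close>.\<close>
    define e' where "e' = e / (4 * \<delta>)"
    have e': "0 < e'" using e \<delta> by (simp add: e'_def)
    obtain d where d: "0 < d" "\<And>z z'. z \<in> ?C \<Longrightarrow> z' \<in> ?C \<Longrightarrow> norm (z' - z) < d \<Longrightarrow>
        norm (f z' - f z - f' z (z' - z)) \<le> e' * norm (z' - z)"
      using C1_uniform_linearization[OF convex_cball compact_cball open_ball C f f' e'] by blast
    obtain d2 where d2: "0 < d2" "ball y d2 \<subseteq> ball z0 r"
      using y openE[OF open_ball y] by blast
    show "\<exists>d>0. \<forall>y'. norm (y' - y) < d \<longrightarrow> norm (c y' t - c y t - a y t (y' - y)) \<le> e * norm (y' - y)"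
    \<comment> \<open>Trajectories separate by at most twice the initial distance, so
      \<open>d/2\<close> keeps them within \<open>d\<close> of each other; \<open>d2\<close> keeps
      \<open>y'\<close> in the domain of the flow.\<close>
    proof (intro exI[of _ "min (d/2) d2"] conjI allI impI)
      fix y' assume y': "norm (y' - y) < min (d/2) d2"
      then have "y' \<in> ball y d2" by (simp add: dist_norm norm_minus_commute)
      then have y'b: "y' \<in> ball z0 r" using d2 by blast
      define w where "w s = c y' s - c y s - a y s (y' - y)" for s
      have "norm (w t) \<le> 2 * (norm (w 0) + \<delta> * (e' * (2 * norm (y' - y))))"
      proof (rule short_time_bound[where I="?I" and L=L])
        fix s assume s: "s \<in> ?I"
        show "(w has_vector_derivative (f (c y' s) - f (c y s) - (f' (c y s) o\<^sub>L a y s) (y' - y))) (at s within ?I)"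
          unfolding w_def
          by (intro derivative_intros c y y'b s
              bounded_linear.has_vector_derivative[OF blinfun.bounded_linear_left] a)
        have nd: "norm (c y' s - c y s) \<le> 2 * norm (y' - y)"
          by (intro lip_y y y'b s)
        have "norm (f (c y' s) - f (c y s) - (f' (c y s) o\<^sub>L a y s) (y' - y)) =
          norm ((f (c y' s) - f (c y s) - f' (c y s) (c y' s - c y s)) + f' (c y s) (w s))"
          by (intro arg_cong[where f=norm]) (simp add: w_def blinfun.bilinear_simps)
        also have "\<dots> \<le> e' * norm (c y' s - c y s) + norm (f' (c y s)) * norm (w s)"
          by (intro norm_triangle_mono norm_blinfun d cC y y'b s) (use nd y' in auto)
        also have "\<dots> \<le> e' * (2 * norm (y' - y)) + L * norm (w s)"
          using L(3)[OF cC[OF y s]] nd e' by (intro add_mono mult_left_mono mult_right_mono) auto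
        finally show "norm (f (c y' s) - f (c y s) - (f' (c y s) o\<^sub>L a y s) (y' - y)) \<le>
            L * norm (w s) + e' * (2 * norm (y' - y))" by simp
      qed (use \<delta> L e' t in auto)
      also have "\<dots> = e * norm (y' - y)"
        using \<delta> c(1)[OF y] c(1)[OF y'b] a(1)[OF y] by (simp add: w_def e'_def)
      finally show "norm (c y' t - c y t - a y t (y' - y)) \<le> e * norm (y' - y)"
        by (simp add: w_def)
    qed (use d d2 in auto)
  qed
  have "continuous_on (?I \<times> ball z0 r) (\<lambda>(t, y). c y t)"
    unfolding continuous_on_iff
  proof (intro ballI allI impI)
    fix p e assume p: "p \<in> ?I \<times> ball z0 r" and e: "0 < (e::real)"
    obtain t y where ty: "p = (t, y)" "t \<in> ?I" "y \<in> ball z0 r" using p by blast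
    show "\<exists>d>0. \<forall>x'\<in>?I \<times> ball z0 r. dist x' p < d \<longrightarrow> dist (case x' of (t, y) \<Rightarrow> c y t) (case p of (t, y) \<Rightarrow> c y t) < e"
    proof (intro exI[of _ "e / (2 + L)"] conjI ballI impI)
      fix x' assume x': "x' \<in> ?I \<times> ball z0 r" "dist x' p < e / (2 + L)"
      obtain t' y' where ty': "x' = (t', y')" "t' \<in> ?I" "y' \<in> ball z0 r" using x' by blast
      have *: "norm (t' - t) < e / (2 + L)" "norm (y' - y) < e / (2 + L)"
        using x'(2) dist_fst_le[of x' p] dist_snd_le[of x' p] by (auto simp: ty ty' dist_norm)
      have "norm (c y' t' - c y t) \<le> norm (c y' t' - c y t') + norm (c y t' - c y t)"
        by norm
      also have "\<dots> \<le> 2 * norm (y' - y) + L * norm (t' - t)"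
        by (intro add_mono lip_y lip_t ty ty')
      also have "\<dots> < 2 * (e / (2 + L)) + L * (e / (2 + L))"
        using * L(1) by (intro add_less_le_mono mult_strict_left_mono mult_left_mono) auto
      also have "\<dots> = (2 + L) * (e / (2 + L))" by (simp only: distrib_right)
      also have "\<dots> = e" using L(1) by simp
      finally show "dist (case x' of (t, y) \<Rightarrow> c y t) (case p of (t, y) \<Rightarrow> c y t) < e"
        by (simp add: ty ty' dist_norm)
    qed (use e L in auto)
  qed
  moreover have "continuous_on (?I \<times> ball z0 r) (\<lambda>(t, y). a y t)"
    unfolding continuous_on_iff
  proof (intro ballI allI impI)
    fix p e assume p: "p \<in> ?I \<times> ball z0 r" and e: "0 < (e::real)"
    obtain t y where ty: "p = (t, y)" "t \<in> ?I" "y \<in> ball z0 r" using p by blast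
    \<comment> \<open>Half of \<open>e\<close> goes to the change of the initial point, where two
      variational equations with coefficients \<open>e'\<close>-close are compared, and half to the
      change of time, in which \<open>a\<close> is Lipschitz with constant
      \<open>2 * L\<close>.\<close>
    define e' where "e' = e / (8 * \<delta>)"
    have e': "0 < e'" using e \<delta> by (simp add: e'_def)
    have "uniformly_continuous_on ?C f'"
      using f' C by (intro compact_uniformly_continuous) (auto intro: continuous_on_subset)
    then obtain d where d: "0 < d" "\<And>z z'. z \<in> ?C \<Longrightarrow> z' \<in> ?C \<Longrightarrow> dist z' z < d \<Longrightarrow> dist (f' z') (f' z) < e'"
      using e' unfolding uniformly_continuous_on_def by metis
    show "\<exists>d>0. \<forall>x'\<in>?I \<times> ball z0 r. dist x' p < d \<longrightarrow> dist (case x' of (t, y) \<Rightarrow> a y t) (case p of (t, y) \<Rightarrow> a y t) < e"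
    proof (intro exI[of _ "min (d/2) (e / (4 * L))"] conjI ballI impI)
      fix x' assume x': "x' \<in> ?I \<times> ball z0 r" "dist x' p < min (d/2) (e / (4 * L))"
      obtain t' y' where ty': "x' = (t', y')" "t' \<in> ?I" "y' \<in> ball z0 r" using x' by blast
      have *: "norm (t' - t) < e / (4 * L)" "norm (y' - y) < d / 2"
        using x'(2) dist_fst_le[of x' p] dist_snd_le[of x' p] by (auto simp: ty ty' dist_norm)
      have "norm (a y' t' - a y t') \<le> 2 * (norm (a y' 0 - a y 0) + \<delta> * (2 * e'))"
      proof (rule short_time_bound[where I="?I" and L=L
            and u'="\<lambda>t. (f' (c y' t) o\<^sub>L a y' t) - (f' (c y t) o\<^sub>L a y t)"])
        fix s assume s: "s \<in> ?I"
        show "((\<lambda>t. a y' t - a y t) has_vector_derivative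
            ((f' (c y' s) o\<^sub>L a y' s) - (f' (c y s) o\<^sub>L a y s))) (at s within ?I)"
          by (intro derivative_intros a s ty ty')
        have "norm (c y' s - c y s) < d" using lip_y[OF ty'(3) ty(3) s] *(2) by simp
        then have nf: "norm (f' (c y' s) - f' (c y s)) \<le> e'"
          using d(2)[OF cC cC] ty ty' s by (simp add: dist_norm less_imp_le)
        have "(f' (c y' s) o\<^sub>L a y' s) - (f' (c y s) o\<^sub>L a y s) =
          (f' (c y' s) o\<^sub>L (a y' s - a y s)) + ((f' (c y' s) - f' (c y s)) o\<^sub>L a y s)"
          by (simp add: bounded_bilinear.diff_right[OF bounded_bilinear_blinfun_compose]
            bounded_bilinear.diff_left[OF bounded_bilinear_blinfun_compose])
        also have "norm \<dots> \<le> norm (f' (c y' s)) * norm (a y' s - a y s) + norm (f' (c y' s) - f' (c y s)) * norm (a y s)"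
          by (intro norm_triangle_mono norm_blinfun_compose)
        also have "\<dots> \<le> L * norm (a y' s - a y s) + e' * 2"
          using L(3)[OF cC[OF ty'(3) s]] norm_a[OF ty(3) s] nf e'
          by (intro add_mono mult_right_mono mult_mono) auto
        finally show "norm ((f' (c y' s) o\<^sub>L a y' s) - (f' (c y s) o\<^sub>L a y s)) \<le>
            L * norm (a y' s - a y s) + 2 * e'" by simp
      qed (use \<delta> L e' ty ty' in auto)
      also have "\<dots> = e / 2"
        using \<delta> a(1)[OF ty(3)] a(1)[OF ty'(3)] by (simp add: e'_def)
      finally have 1: "norm (a y' t' - a y t') \<le> e / 2" .
      have "norm (a y t' - a y t) \<le> (2 * L) * norm (t' - t)"
      proof (rule differentiable_bound[of ?I "a y" "\<lambda>s h. h *\<^sub>R (f' (c y s) o\<^sub>L a y s)"])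
        show "onorm (\<lambda>h. h *\<^sub>R (f' (c y s) o\<^sub>L a y s)) \<le> 2 * L" if s: "s \<in> ?I" for s
        proof (rule onorm_le)
          fix h :: real
          have "norm (f' (c y s)) * norm (a y s) \<le> L * 2"
            using L(1,3) cC norm_a ty s by (intro mult_mono) auto
          then have "norm (f' (c y s) o\<^sub>L a y s) \<le> 2 * L"
            using norm_blinfun_compose[of "f' (c y s)" "a y s"] by simp
          then show "norm (h *\<^sub>R (f' (c y s) o\<^sub>L a y s)) \<le> 2 * L * norm h"
            by (simp add: mult.commute[of "2 * L"] mult_left_mono del: mult.assoc)
        qed
      qed (use ty ty' a(3)[OF ty(3)] in \<open>auto simp: has_vector_derivative_def\<close>)
      also have "\<dots> < (2 * L) * (e / (4 * L))"
        using *(1) L(1) by (intro mult_strict_left_mono) auto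
      also have "\<dots> = e / 2" using L(1) by simp
      finally have "norm (a y t' - a y t) < e / 2" .
      with 1 have "norm (a y' t' - a y t) < e"
        using norm_triangle_ineq[of "a y' t' - a y t'" "a y t' - a y t"] by simp
      then show "dist (case x' of (t, y) \<Rightarrow> a y t) (case p of (t, y) \<Rightarrow> a y t) < e"
        by (simp add: ty ty' dist_norm)
    qed (use e L d in auto)
  qed
  ultimately show ?thesis
    using \<delta> r c(1,3) cC C deriv
    by (intro that[of \<delta> r "\<lambda>t y. c y t" "\<lambda>t y. a y t"]) blast+
qed

section \<open>Subadditive sequences over a measure preserving map\<close>

text \<open>For bounded sequences the extended liminf is a real number, with the usual epsilon
  characterisations. The last of them recovers lower bounds; it is how monotonicity of a liminf
  along orbits is shown.\<close>

lemma liminf_bounded_real: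
  fixes u :: "nat \<Rightarrow> real"
  assumes u: "\<And>n. \<bar>u n\<bar> \<le> C"
  defines "l \<equiv> real_of_ereal (liminf (\<lambda>n. ereal (u n)))"
  shows "ereal l = liminf (\<lambda>n. ereal (u n))" "\<bar>l\<bar> \<le> C"
    "0 < e \<Longrightarrow> \<forall>\<^sub>F n in sequentially. l - e < u n"
    "0 < e \<Longrightarrow> \<exists>\<^sub>F n in sequentially. u n < l + e"
    "(\<And>e. 0 < e \<Longrightarrow> \<forall>\<^sub>F n in sequentially. b - e < u n) \<Longrightarrow> b \<le> l"
proof -
  let ?L = "liminf (\<lambda>n. ereal (u n))"
  have lo: "ereal (- C) \<le> ?L"
    by (rule Liminf_bounded) (use u in \<open>auto simp: abs_le_iff minus_le_iff\<close>)
  have "?L \<le> limsup (\<lambda>n. ereal (u n))" by (rule Liminf_le_Limsup) simp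
  also have "\<dots> \<le> ereal C"
    by (rule Limsup_bounded) (use u in \<open>auto simp: abs_le_iff\<close>)
  finally have hi: "?L \<le> ereal C" .
  show l: "ereal l = ?L"
    using lo hi unfolding l_def by (cases ?L) auto
  show "\<bar>l\<bar> \<le> C" using lo hi by (simp add: l[symmetric] abs_le_iff)
  show "\<forall>\<^sub>F n in sequentially. l - e < u n" if "0 < e"
  proof -
    have "\<forall>y<?L. \<forall>\<^sub>F n in sequentially. y < ereal (u n)" using le_Liminf_iff[of ?L sequentially "\<lambda>n. ereal (u n)"] by simp
    moreover have "ereal (l - e) < ?L" using that by (simp add: l[symmetric])
    ultimately show ?thesis by fastforce
  qed
  show "b \<le> l" if b: "\<And>e. 0 < e \<Longrightarrow> \<forall>\<^sub>F n in sequentially. b - e < u n" for b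
  proof (rule field_le_epsilon)
    fix e :: real assume "0 < e"
    have "ereal (b - e) \<le> ?L"
      by (rule Liminf_bounded) (use b[OF \<open>0 < e\<close>] in \<open>auto elim: eventually_mono\<close>)
    then show "b \<le> l + e" by (simp add: l[symmetric])
  qed
  then have *: "b \<le> l" if "\<And>e. 0 < e \<Longrightarrow> \<forall>\<^sub>F n in sequentially. b - e < u n" for b
    using that by blast
  show "\<exists>\<^sub>F n in sequentially. u n < l + e" if "0 < e"
  proof (rule ccontr)
    assume "\<not> (\<exists>\<^sub>F n in sequentially. u n < l + e)"
    then have "\<forall>\<^sub>F n in sequentially. l + e \<le> u n" by (simp add: not_frequently not_less)
    then have "l + e \<le> l" by (intro *) (auto elim: eventually_mono)
    with that show False by simp
  qed
qed

text \<open>Katznelson and Weiss: a point is good if \<open>a n x\<close> falls below \<open>n (A x + e)\<close> for some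
  \<open>n \<le> N\<close>.  An orbit of length \<open>L\<close> is cut into such blocks and, at the bad points, into single steps;
  since \<open>A\<close> does not decrease along orbits, \<open>n (A x + e)\<close> is dominated by a Birkhoff sum over the block.\<close>

lemma (in prob_space) subadditive_liminf:
  fixes a :: "nat \<Rightarrow> 'a \<Rightarrow> real" and T :: "nat \<Rightarrow> 'a \<Rightarrow> 'a"
  assumes T: "\<And>n. T n \<in> measurable M M" "\<And>n. distr M M (T n) = M"
    and T0: "\<And>x. x \<in> space M \<Longrightarrow> T 0 x = x" and T_add: "\<And>m n x. x \<in> space M \<Longrightarrow> T (m + n) x = T n (T m x)"
    and meas [measurable]: "\<And>n. a n \<in> borel_measurable M"
    and sub: "\<And>m n x. x \<in> space M \<Longrightarrow> a (m + n) x \<le> a m x + a n (T m x)"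
    and bd: "\<And>n x. x \<in> space M \<Longrightarrow> \<bar>a n x\<bar> \<le> C * real n" and C: "0 \<le> C" and e: "0 < e"
  defines "A \<equiv> (\<lambda>x. real_of_ereal (liminf (\<lambda>n. ereal (a n x / real n))))"
  shows "\<forall>\<^sub>F L in sequentially. expectation (a L) \<le> real L * (expectation A + e)"
proof -
  have Tsp: "T n x \<in> space M" if "x \<in> space M" for n x
    using T(1)[of n] that by (rule measurable_space)
  have bd1: "\<bar>a n x / real n\<bar> \<le> C" if "x \<in> space M" for n x
    using bd[OF that, of n] C by (cases "n = 0") (auto simp: field_simps abs_divide)
  have Lim: "\<bar>A x\<bar> \<le> C" "\<And>e. 0 < e \<Longrightarrow> \<forall>\<^sub>F n in sequentially. A x - e < a n x / real n"
    "\<And>e. 0 < e \<Longrightarrow> \<exists>\<^sub>F n in sequentially. a n x / real n < A x + e"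
    "\<And>b. (\<And>e. 0 < e \<Longrightarrow> \<forall>\<^sub>F n in sequentially. b - e < a n x / real n) \<Longrightarrow> b \<le> A x"
    if x: "x \<in> space M" for x
    unfolding A_def by (rule liminf_bounded_real[where C=C]; use bd1[OF x] in blast)+
  have A_meas [measurable]: "A \<in> borel_measurable M"
    unfolding A_def by measurable
  \<comment> \<open>Subadditivity gives \<open>a n (T m x) \<ge> a (m + n) x - a m x\<close>; the
    term \<open>a m x\<close> and the replacement of the divisor \<open>n + m\<close> by
    \<open>n\<close> each cost at most \<open>C * m\<close>, which disappears after division by
    \<open>n\<close>.\<close>
  have A_mono: "A x \<le> A (T m x)" if x: "x \<in> space M" for m x
  proof (rule Lim(4)[OF Tsp[OF x]])
    fix e :: real assume e: "0 < e"
    have "((\<lambda>n. (2 * C * real m) / real n) \<longlongrightarrow> 0) sequentially" by real_asymp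
    then have "\<forall>\<^sub>F n in sequentially. (2 * C * real m) / real n < e / 2"
      using e order_tendstoD(2) by (metis half_gt_zero)
    moreover have "\<forall>\<^sub>F n in sequentially. A x - e/2 < a (n + m) x / real (n + m)"
      using eventually_ge_at_top Lim(2)[OF x, of "e/2"] e
      by (subst eventually_sequentially_seg[where P="\<lambda>n. A x - e/2 < a n x / real n"]) simp
    ultimately show "\<forall>\<^sub>F n in sequentially. A x - e < a n (T m x) / real n"
      using eventually_gt_at_top[of 0]
    proof eventually_elim
      case (elim n)
      let ?s = "a (m + n) x"
      have "?s \<le> C * real m + a n (T m x)"
        using sub[OF x, of m n] bd[OF x, of m] by linarith
      moreover have "?s / real (n + m) * real n \<le> ?s + C * real m"
      proof -
        have "?s / real (n + m) * real n = ?s - ?s / real (n + m) * real m"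
          using elim by (simp add: field_simps)
        also have "\<dots> \<le> ?s + C * real m"
        proof -
          have "- C \<le> ?s / real (n + m)" using bd1[OF x, of "n + m"] by (simp only: add.commute abs_le_iff) linarith
          then have "- C * real m \<le> ?s / real (n + m) * real m" by (rule mult_right_mono) simp
          then show ?thesis by simp
        qed
        finally show ?thesis .
      qed
      moreover have "(A x - e/2) * real n \<le> ?s / real (n + m) * real n"
        using elim by (intro mult_right_mono) (auto simp: add.commute)
      moreover have "2 * C * real m < e / 2 * real n"
        using elim by (simp add: field_simps)
      ultimately have "(A x - e) * real n < a n (T m x)" by (simp add: algebra_simps)
      then show ?case using elim by (simp add: field_simps)
    qed
  qed
  define bad where "bad N = {x\<in>space M. \<forall>n\<in>{1..N}. real n * (A x + e/2) < a n x}" for N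
  have bad_sets [measurable]: "bad N \<in> sets M" for N unfolding bad_def by measurable
  \<comment> \<open>The averages at a point drop below \<open>A x + e/2\<close> infinitely often, so
    every point is good for large \<open>N\<close> and the bad sets decrease to the empty
    set.\<close>
  have "(\<lambda>N. prob (bad N)) \<longlonglongrightarrow> prob (\<Inter>N. bad N)"
    by (rule finite_Lim_measure_decseq) (auto simp: decseq_def bad_def)
  moreover have "(\<Inter>N. bad N) = {}"
  proof -
    have "\<exists>N. x \<notin> bad N" if x: "x \<in> space M" for x
    proof -
      have "\<exists>\<^sub>F n in sequentially. a n x / real n < A x + e/2"
        using Lim(3)[OF x, of "e/2"] e by simp
      then obtain n where "1 \<le> n" "a n x / real n < A x + e/2"
        by (auto simp: frequently_sequentially)
      then have "x \<notin> bad n" by (auto simp: bad_def field_simps intro!: bexI[of _ n])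
      then show ?thesis ..
    qed
    then show ?thesis by (auto simp: bad_def)
  qed
  ultimately have "(\<lambda>N. 2 * C * prob (bad N)) \<longlonglongrightarrow> 2 * C * 0"
    by (intro tendsto_intros) simp
  then have "\<forall>\<^sub>F N in sequentially. 2 * C * prob (bad N) < e / 4"
    by (rule order_tendstoD(2)) (use e in simp)
  then obtain N where N: "2 * C * prob (bad N) < e / 4" "1 \<le> N"
    by (metis (mono_tags, lifting) eventually_sequentially nat_le_linear)
  \<comment> \<open>The surcharge \<open>2 * C\<close> makes \<open>g \<ge> C \<ge> a 1\<close> at
    bad points, since \<open>A \<ge> - C\<close>; a bad point is thus paid for by a single step. The
    integral of the surcharge, \<open>2 * C * prob (bad N)\<close>, is below
    \<open>e / 4\<close>.\<close>
  define g where "g x = A x + e/2 + 2 * C * indicator (bad N) x" for x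
  have g_meas [measurable]: "g \<in> borel_measurable M" unfolding g_def by measurable
  have A_bd: "\<bar>A x\<bar> \<le> C" if "x \<in> space M" for x using Lim(1)[OF that] .
  have g_lo: "- C \<le> g x" if "x \<in> space M" for x
    using A_bd[OF that] e C by (auto simp: g_def indicator_def)
  have A_int: "integrable M A"
    by (rule integrable_const_bound[where B=C]) (use A_bd in auto)
  have g_int: "integrable M g"
    unfolding g_def by (intro Bochner_Integration.integrable_add integrable_mult_right A_int integrable_const integrable_real_indicator) (auto simp: emeasure_eq_measure)
  \<comment> \<open>Strong induction on \<open>L\<close>. The term \<open>2 * C * real N\<close>
    pays for the last incomplete stretch of fewer than \<open>N\<close> steps, where
    \<open>a\<close> is at most \<open>C * L\<close> and the sum of \<open>g\<close> is at least
    \<open>- C * L\<close>.\<close>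
  have block: "a L x \<le> (\<Sum>i<L. g (T i x)) + 2 * C * real N" if "x \<in> space M" for L x
    using that
  proof (induction L arbitrary: x rule: less_induct)
    case (less L)
    have "(\<Sum>i<L. - C) \<le> (\<Sum>i<L. g (T i x))"
      by (intro sum_mono g_lo Tsp less.prems)
    then have lo: "- C * real L \<le> (\<Sum>i<L. g (T i x))" by (simp add: mult.commute)
    show ?case
    proof (cases "L < N")
      case True
      then have "C * real L \<le> C * real N" using C by (intro mult_left_mono) auto
      with lo bd[OF less.prems, of L] show ?thesis by simp
    next
      case False
      have "\<exists>n\<in>{1..N}. a n x \<le> (\<Sum>i<n. g (T i x))"
      proof (cases "x \<in> bad N")
        case True
        have "a 1 x \<le> C" using bd[OF less.prems, of 1] by simp
        also have "\<dots> \<le> g x" using True A_bd[OF less.prems] e by (simp add: g_def)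
        finally show ?thesis using N(2) T0[OF less.prems] by (intro bexI[of _ 1]) auto
      next
        case False
        then obtain n where n: "n \<in> {1..N}" "a n x \<le> real n * (A x + e/2)"
          using less.prems by (force simp: bad_def)
        have "real n * (A x + e/2) = (\<Sum>i<n. A x + e/2)" by simp
        also have "\<dots> \<le> (\<Sum>i<n. g (T i x))"
        proof (rule sum_mono)
          fix i show "A x + e/2 \<le> g (T i x)"
            using A_mono[OF less.prems, of i] C by (auto simp: g_def indicator_def)
        qed
        finally have "a n x \<le> (\<Sum>i<n. g (T i x))" using n(2) by linarith
        then show ?thesis using n(1) by blast
      qed
      then obtain n where n: "n \<in> {1..N}" "a n x \<le> (\<Sum>i<n. g (T i x))" ..
      have "L = n + (L - n)" using n False by simp
      then have "a L x \<le> a n x + a (L - n) (T n x)" using sub[OF less.prems, of n "L - n"] by simp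
      also have "\<dots> \<le> (\<Sum>i<n. g (T i x)) + ((\<Sum>i<L - n. g (T i (T n x))) + 2 * C * real N)"
        using n False by (intro add_mono less.IH Tsp less.prems) auto
      also have "(\<Sum>i<L - n. g (T i (T n x))) = (\<Sum>i=n..<L. g (T i x))"
        by (rule sum.reindex_bij_witness[of _ "\<lambda>i. i - n" "\<lambda>i. i + n"])
           (use n False in \<open>auto simp: T_add[OF less.prems, symmetric] add.commute\<close>)
      also have "(\<Sum>i<n. g (T i x)) + ((\<Sum>i=n..<L. g (T i x)) + 2 * C * real N) = (\<Sum>i<L. g (T i x)) + 2 * C * real N"
        using sum.atLeastLessThan_concat[of 0 n L "\<lambda>i. g (T i x)"] n False by (simp add: atLeast0LessThan)
      finally show ?thesis .
    qed
  qed
  have gT_int: "integrable M (\<lambda>x. g (T i x))" for i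
    using g_int integrable_distr_eq[OF T(1) g_meas, of i] T(2) by simp
  have gT_exp: "expectation (\<lambda>x. g (T i x)) = expectation g" for i
    using integral_distr[OF T(1) g_meas, of i] T(2) by simp
  have a_int: "integrable M (a L)" for L
    by (rule integrable_const_bound[where B="C * real L"]) (use bd in auto)
  have bound: "expectation (a L) \<le> real L * (expectation A + 3/4 * e) + 2 * C * real N" for L
  proof -
    have "expectation (a L) \<le> expectation (\<lambda>x. (\<Sum>i<L. g (T i x)) + 2 * C * real N)"
      by (intro integral_mono a_int Bochner_Integration.integrable_add Bochner_Integration.integrable_sum gT_int integrable_const block) auto
    also have "\<dots> = real L * expectation g + 2 * C * real N"
      by (subst Bochner_Integration.integral_add) (auto simp: gT_int gT_exp prob_space Bochner_Integration.integral_sum)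
    also have "expectation g = expectation A + e/2 + 2 * C * prob (bad N)"
    proof -
      have "expectation g = expectation (\<lambda>x. A x + e/2) + expectation (\<lambda>x. 2 * C * indicator (bad N) x)"
        unfolding g_def
        by (intro Bochner_Integration.integral_add Bochner_Integration.integrable_add integrable_mult_right
            A_int integrable_const integrable_real_indicator) (auto simp: emeasure_eq_measure)
      also have "expectation (\<lambda>x. A x + e/2) = expectation A + expectation (\<lambda>x. e/2)"
        by (intro Bochner_Integration.integral_add A_int integrable_const)
      finally show ?thesis by (simp add: prob_space)
    qed
    also have "real L * (expectation A + e/2 + 2 * C * prob (bad N)) \<le> real L * (expectation A + 3/4 * e)"
      using N(1) by (intro mult_left_mono) auto
    finally show ?thesis by simp
  qed
  have "((\<lambda>L. (2 * C * real N) / real L) \<longlongrightarrow> 0) sequentially" by real_asymp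
  then have "\<forall>\<^sub>F L in sequentially. (2 * C * real N) / real L < e / 4"
    by (rule order_tendstoD(2)) (use e in simp)
  then show ?thesis using eventually_gt_at_top[of 0]
  proof eventually_elim
    case (elim L)
    then have "2 * C * real N < real L * (e / 4)" by (simp add: field_simps)
    with bound[of L] show ?case by (simp add: algebra_simps)
  qed
qed

section \<open>Probability measures on a compact space\<close>

lemma sets_restrict_borel:
  fixes \<Lambda> :: "'a::topological_space set"
  assumes "closed \<Lambda>"
  shows "sets (restrict_space borel \<Lambda>) = sigma_sets \<Lambda> ((\<inter>) \<Lambda> ` {U. open U})"
  using sigma_sets_Int[of \<Lambda> UNIV "{U. open U}"] assms borel_closed[OF assms]
  by (simp add: sets_restrict_space borel_def)

text \<open>Urysohn functions are available one point at a time. The sets where they exceed 1/2 have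
  a countable subcover by the Lindelof property, which allows the functions to be summed into a
  sequence.\<close>

lemma open_indicator_limit:
  fixes \<Lambda> :: "'a::{t2_space,second_countable_topology} set"
  assumes \<Lambda>: "compact \<Lambda>" and U: "open U"
  obtains h :: "nat \<Rightarrow> 'a \<Rightarrow> real" where "\<And>n. continuous_on \<Lambda> (h n)"
    "\<And>n x. x \<in> \<Lambda> \<Longrightarrow> h n x \<in> {0..1}" "\<And>x. x \<in> \<Lambda> \<Longrightarrow> (\<lambda>n. h n x) \<longlonglongrightarrow> indicator U x"
proof (cases "\<Lambda> \<inter> U = {}")
  case True
  then have "indicator U x = (0::real)" if "x \<in> \<Lambda>" for x
    using that by (auto simp: indicator_def)
  then show ?thesis by (intro that[of "\<lambda>_ _. 0"]) auto
next
  case False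
  have "Hausdorff_space (euclidean :: 'a topology)"
    unfolding Hausdorff_space_def disjnt_def using hausdorff by simp blast
  then have normal: "normal_space (top_of_set \<Lambda>)"
    using \<Lambda> by (intro compact_Hausdorff_or_regular_imp_normal_space)
      (auto simp: compact_space_subtopology intro: Hausdorff_space_subtopology)
  have "\<exists>f. continuous_on \<Lambda> f \<and> (\<forall>y\<in>\<Lambda>. f y \<in> {0..1::real}) \<and> f x = 1 \<and> (\<forall>y\<in>\<Lambda> - U. f y = 0)" if x: "x \<in> \<Lambda> \<inter> U" for x
  proof -
    have cl: "closedin (top_of_set \<Lambda>) (\<Lambda> - U)"
      using U by (auto simp: closedin_closed Diff_eq intro!: exI[of _ "- U"])
    have "closedin (top_of_set \<Lambda>) {x}"
      using x by (auto simp: closedin_closed intro!: exI[of _ "{x}"])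
    with normal cl obtain f where "continuous_map (top_of_set \<Lambda>) (top_of_set {0..1::real}) f"
        "f ` (\<Lambda> - U) \<subseteq> {0}" "f ` {x} \<subseteq> {1}"
      by (rule Urysohn_lemma[of _ _ "{x}" 0 1]) (use x in auto)
    then show ?thesis by (intro exI[of _ f]) (auto simp: continuous_map_in_subtopology Pi_iff)
  qed
  then have "\<forall>x\<in>\<Lambda> \<inter> U. \<exists>f. continuous_on \<Lambda> f \<and> (\<forall>y\<in>\<Lambda>. f y \<in> {0..1::real}) \<and> f x = 1 \<and> (\<forall>y\<in>\<Lambda> - U. f y = 0)"
    by blast
  from bchoice[OF this] obtain f where f': "\<forall>x\<in>\<Lambda> \<inter> U. continuous_on \<Lambda> (f x) \<and>
      (\<forall>y\<in>\<Lambda>. f x y \<in> {0..1::real}) \<and> f x x = 1 \<and> (\<forall>y\<in>\<Lambda> - U. f x y = 0)" ..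
  then have f: "\<And>x. x \<in> \<Lambda> \<inter> U \<Longrightarrow> continuous_on \<Lambda> (f x)"
      "\<And>x y. x \<in> \<Lambda> \<inter> U \<Longrightarrow> y \<in> \<Lambda> \<Longrightarrow> f x y \<in> {0..1::real}" "\<And>x. x \<in> \<Lambda> \<inter> U \<Longrightarrow> f x x = 1"
      "\<And>x y. x \<in> \<Lambda> \<inter> U \<Longrightarrow> y \<in> \<Lambda> - U \<Longrightarrow> f x y = 0"
    by blast+
  define V where "V x = {y\<in>\<Lambda>. 1/2 < f x y}" for x
  have "openin (top_of_set \<Lambda>) (V x)" if "x \<in> \<Lambda> \<inter> U" for x
  proof -
    have "V x = \<Lambda> \<inter> f x -` {1/2<..}" by (auto simp: V_def)
    then show ?thesis using f(1)[OF that] continuous_openin_preimage_gen[of \<Lambda> "f x" "{1/2<..}"] by simp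
  qed
  then have "openin (top_of_set \<Lambda>) S" if "S \<in> V ` (\<Lambda> \<inter> U)" for S
    using that by blast
  from Lindelof_openin[OF this] obtain \<F>
    where F: "\<F> \<subseteq> V ` (\<Lambda> \<inter> U)" "countable \<F>" "\<Union>\<F> = \<Union>(V ` (\<Lambda> \<inter> U))" .
  obtain I where I: "countable I" "I \<subseteq> \<Lambda> \<inter> U" "\<F> = V ` I"
    using F countable_subset_image[of \<F> V "\<Lambda> \<inter> U"] by blast
  have cover: "\<exists>i\<in>I. y \<in> V i" if "y \<in> \<Lambda> \<inter> U" for y
  proof -
    have "y \<in> V y" using that f(3) by (auto simp: V_def)
    then have "y \<in> \<Union>\<F>" using F(3) that by blast
    then show ?thesis using I by blast
  qed
  then have ne: "I \<noteq> {}" using False by blast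
  define e where "e = from_nat_into I"
  have e: "e n \<in> \<Lambda> \<inter> U" for n
    using from_nat_into[OF ne, of n] I(2) by (auto simp: e_def)
  \<comment> \<open>The enumeration \<open>e\<close> may repeat elements of \<open>I\<close>. Inside
    \<open>U\<close> some term exceeds 1/2, and multiplication by \<open>n\<close> lifts the sum
    above 1, where the minimum cuts it off; outside \<open>U\<close> every term is 0.\<close>
  define h where "h n y = min 1 (real n * (\<Sum>i<n. f (e i) y))" for n y
  have nonneg: "0 \<le> f (e i) y" if "y \<in> \<Lambda>" for i y using f(2)[OF e that] by simp
  show ?thesis
  proof (rule that[of h])
    show "continuous_on \<Lambda> (h n)" for n
      unfolding h_def by (intro continuous_intros f(1) e)
    show "h n x \<in> {0..1}" if "x \<in> \<Lambda>" for n x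
      unfolding h_def using nonneg[OF that] by (auto intro!: mult_nonneg_nonneg sum_nonneg)
    show "(\<lambda>n. h n x) \<longlonglongrightarrow> indicator U x" if x: "x \<in> \<Lambda>" for x
    proof (cases "x \<in> U")
      case True
      then obtain i where i: "x \<in> V (e i)"
        using cover x I(1) ne by (metis Int_iff e_def from_nat_into_surj)
      have "\<forall>\<^sub>F n in sequentially. h n x = 1"
        using eventually_ge_at_top[of "i + 2"]
      proof eventually_elim
        case (elim n)
        have "1/2 \<le> f (e i) x" using i by (simp add: V_def)
        also have "\<dots> \<le> (\<Sum>i<n. f (e i) x)"
          by (rule member_le_sum) (use elim nonneg[OF x] in auto)
        finally have "2 * (1/2) \<le> real n * (\<Sum>i<n. f (e i) x)"
          using elim by (intro mult_mono) auto
        then show ?case by (simp add: h_def)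
      qed
      then show ?thesis using True by (simp add: tendsto_eventually)
    next
      case False
      then have "h n x = 0" for n using f(4)[OF e] x by (simp add: h_def)
      then show ?thesis using False by simp
    qed
  qed
qed

text \<open>The traces of open sets are stable under intersection and generate the sigma-algebra;
  their measures are limits of integrals of continuous functions by dominated convergence.\<close>

lemma compact_measure_eqI:
  fixes \<Lambda> :: "'a::{t2_space,second_countable_topology} set"
  assumes \<Lambda>: "compact \<Lambda>" and M: "prob_space M" "sets M = sets (restrict_space borel \<Lambda>)"
    and N: "prob_space N" "sets N = sets (restrict_space borel \<Lambda>)"
    and eq: "\<And>f :: 'a \<Rightarrow> real. continuous_on \<Lambda> f \<Longrightarrow> integral\<^sup>L M f = integral\<^sup>L N f"
  shows "M = N"
proof -
  interpret M: prob_space M by fact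
  interpret N: prob_space N by fact
  let ?E = "(\<inter>) \<Lambda> ` {U. open U}"
  show ?thesis
  proof (rule measure_eqI_generator_eq[of ?E \<Lambda> _ _ "\<lambda>_. \<Lambda>"])
    show "Int_stable ?E"
    proof (rule Int_stableI)
      fix a b assume "a \<in> ?E" "b \<in> ?E"
      then obtain U V where "open U" "open V" "a = \<Lambda> \<inter> U" "b = \<Lambda> \<inter> V" by blast
      then show "a \<inter> b \<in> ?E" by (intro image_eqI[where x="U \<inter> V"]) auto
    qed
    show "sets M = sigma_sets \<Lambda> ?E" "sets N = sigma_sets \<Lambda> ?E"
      using M(2) N(2) sets_restrict_borel[OF compact_imp_closed[OF \<Lambda>]] by auto
    fix A assume "A \<in> ?E"
    then obtain U where U: "open U" "A = \<Lambda> \<inter> U" by blast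
    have A: "A \<in> sets (restrict_space borel \<Lambda>)"
      using U by (auto simp: sets_restrict_space)
    obtain h :: "nat \<Rightarrow> 'a \<Rightarrow> real" where h: "\<And>n. continuous_on \<Lambda> (h n)"
      "\<And>n x. x \<in> \<Lambda> \<Longrightarrow> h n x \<in> {0..1}" "\<And>x. x \<in> \<Lambda> \<Longrightarrow> (\<lambda>n. h n x) \<longlonglongrightarrow> indicator U x"
      using open_indicator_limit[OF \<Lambda> U(1)] by blast
    have hm: "h n \<in> borel_measurable (restrict_space borel \<Lambda>)" for n
      by (intro borel_measurable_continuous_on_restrict h)
    have "(\<lambda>n. integral\<^sup>L P (h n)) \<longlonglongrightarrow> measure P A"
      if P: "prob_space P" "sets P = sets (restrict_space borel \<Lambda>)" for P
    proof -
      interpret P: prob_space P by fact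
      have spP: "space P = \<Lambda>"
        using sets_eq_imp_space_eq[OF P(2)] by (simp add: space_restrict_space)
      have AP: "A \<in> sets P" using A P(2) by simp
      have "(\<lambda>n. integral\<^sup>L P (h n)) \<longlonglongrightarrow> integral\<^sup>L P (indicator A :: 'a \<Rightarrow> real)"
      proof (rule integral_dominated_convergence[where w="\<lambda>_. 1"])
        show "h n \<in> borel_measurable P" for n by (subst measurable_cong_sets[OF P(2) refl]) (rule hm)
        show "AE x in P. (\<lambda>n. h n x) \<longlonglongrightarrow> indicator A x"
        proof (rule AE_I2)
          fix x assume "x \<in> space P"
          then show "(\<lambda>n. h n x) \<longlonglongrightarrow> indicator A x"
            using h(3)[of x] by (simp add: spP U indicator_def)
        qed
        show "AE x in P. norm (h n x) \<le> 1" for n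
        proof (rule AE_I2)
          fix x assume "x \<in> space P"
          then show "norm (h n x) \<le> 1" using h(2)[of x n] by (simp add: spP)
        qed
      qed (use AP in auto)
      then show ?thesis using AP by simp
    qed
    from this[OF M] this[OF N] have "measure M A = measure N A"
      using eq[OF h(1)] LIMSEQ_unique by auto
    then show "emeasure M A = emeasure N A"
      by (simp add: M.emeasure_eq_measure N.emeasure_eq_measure)
  qed (auto intro: image_eqI[where x=UNIV])
qed

text \<open>The membership pattern of a point in a countable base, written as a ternary expansion.\<close>

definition code :: "(nat \<Rightarrow> 'a set) \<Rightarrow> 'a \<Rightarrow> real" where
  "code B x = (\<Sum>i. 2 * indicator (B i) x * (1/3)^Suc i)"

lemma code_summable: "summable (\<lambda>i. 2 * indicator (B i) x * (1/3::real)^Suc i)"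
  by (rule summable_comparison_test'[where N=0, OF summable_mult[OF summable_geometric, of "1/3" 2]])
     (auto simp: indicator_def)

lemma code_rec: "code B x = 2/3 * indicator (B 0) x + code (\<lambda>i. B (Suc i)) x / 3"
proof -
  have "code B x = 2 * indicator (B 0) x * (1/3)^Suc 0 + (\<Sum>i. 2 * indicator (B (Suc i)) x * (1/3)^Suc (Suc i))"
    unfolding code_def using suminf_split_head[OF code_summable[of B x]] by simp
  also have "(\<Sum>i. 2 * indicator (B (Suc i)) x * (1/3::real)^Suc (Suc i)) = (\<Sum>i. (2 * indicator (B (Suc i)) x * (1/3)^Suc i) * (1/3))"
    by (simp add: mult_ac)
  also have "\<dots> = code (\<lambda>i. B (Suc i)) x * (1/3)"
    unfolding code_def by (rule suminf_mult2[symmetric]) (rule code_summable)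
  finally show ?thesis by simp
qed

lemma code_bounds: "0 \<le> code B x" "code B x \<le> 1"
proof -
  show "0 \<le> code B x"
    unfolding code_def by (intro suminf_nonneg code_summable) (simp add: indicator_def)
  have sm: "summable (\<lambda>i. 2/3 * (1/3::real)^i)"
    by (intro summable_mult summable_geometric) simp
  have "code B x \<le> (\<Sum>i. 2/3 * (1/3::real)^i)"
    unfolding code_def by (rule suminf_le[OF _ code_summable sm]) (simp add: indicator_def)
  also have "\<dots> = 2/3 * (\<Sum>i. (1/3::real)^i)"
    by (intro suminf_mult summable_geometric) simp
  also have "\<dots> = 1" by (simp add: suminf_geometric)
  finally show "code B x \<le> 1" .
qed

text \<open>The digits are 0 and 2, so codes avoid the open middle third and a convergent sequence
  of codes must settle its first digit. Removing this digit and scaling by 3 leaves a convergent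
  sequence of codes for the shifted sets.\<close>

lemma code_convergent:
  assumes "convergent (\<lambda>k. code B (x k))"
  shows "(\<forall>\<^sub>F k in sequentially. x k \<in> B i) \<or> (\<forall>\<^sub>F k in sequentially. x k \<notin> B i)"
proof -
  have first: "(\<forall>\<^sub>F k in sequentially. x k \<in> B 0) \<or> (\<forall>\<^sub>F k in sequentially. x k \<notin> B 0)"
    if conv: "convergent (\<lambda>k. code B (x k))" for B
  proof -
    obtain l where l: "(\<lambda>k. code B (x k)) \<longlonglongrightarrow> l" using conv unfolding convergent_def by blast
    have *: "x k \<in> B 0 \<longleftrightarrow> 1/3 < code B (x k)" "x k \<in> B 0 \<longleftrightarrow> 2/3 \<le> code B (x k)" for k
      using code_rec[of B "x k"] code_bounds[of "\<lambda>i. B (Suc i)" "x k"] by (auto simp: indicator_def)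
    show ?thesis
    proof (cases "1/3 < l")
      case True
      then show ?thesis using order_tendstoD(1)[OF l True] *(1) by simp
    next
      case False
      then have "\<forall>\<^sub>F k in sequentially. code B (x k) < 2/3" by (intro order_tendstoD(2)[OF l]) simp
      then show ?thesis using *(2) by (simp add: not_le[symmetric])
    qed
  qed
  show ?thesis
    using assms
  proof (induction i arbitrary: B)
    case 0
    then show ?case by (rule first)
  next
    case (Suc i)
    obtain b where "\<forall>\<^sub>F k in sequentially. indicator (B 0) (x k) = (b::real)"
    proof (cases "\<forall>\<^sub>F k in sequentially. x k \<in> B 0")
      case True
      then show ?thesis by (intro that[of 1]) (auto elim: eventually_mono)
    next
      case False
      then have "\<forall>\<^sub>F k in sequentially. x k \<notin> B 0" using first[OF Suc.prems] by blast
      then show ?thesis by (intro that[of 0]) (auto elim: eventually_mono)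
    qed
    then have b: "(\<lambda>k. indicator (B 0) (x k)) \<longlonglongrightarrow> b" by (rule tendsto_eventually)
    obtain l where "(\<lambda>k. code B (x k)) \<longlonglongrightarrow> l" using Suc.prems unfolding convergent_def by blast
    then have "(\<lambda>k. 3 * code B (x k) - 2 * indicator (B 0) (x k)) \<longlonglongrightarrow> 3 * l - 2 * b"
      using b by (intro tendsto_intros)
    moreover have "3 * code B y - 2 * indicator (B 0) y = code (\<lambda>i. B (Suc i)) y" for y
      using code_rec[of B y] by simp
    ultimately have "convergent (\<lambda>k. code (\<lambda>i. B (Suc i)) (x k))"
      by (simp add: convergent_def) blast
    from Suc.IH[OF this] show ?case .
  qed
qed

text \<open>\<open>code B\<close> itself is in general discontinuous, but convergence of codes
  forces convergence of points: two different cluster points in the compact set would be separated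
  by some basic set, contradicting \<open>code_convergent\<close>. Hence the inverse extends
  continuously to the closure of the image.\<close>

lemma code_continuous_inverse:
  fixes B :: "nat \<Rightarrow> 'a::{t2_space,second_countable_topology} set"
  assumes \<Lambda>: "compact \<Lambda>" and B: "topological_basis (range B)"
  obtains \<pi> where "continuous_on (closure (code B ` \<Lambda>)) \<pi>" "\<pi> ` closure (code B ` \<Lambda>) \<subseteq> \<Lambda>"
    "\<And>x. x \<in> \<Lambda> \<Longrightarrow> \<pi> (code B x) = x"
proof -
  let ?K = "closure (code B ` \<Lambda>)"
  have seq: "seq_compact \<Lambda>" using \<Lambda> by (simp add: seq_compact_eq_compact compact_imp_seq_compact)
  have conv: "\<exists>y\<in>\<Lambda>. x \<longlonglongrightarrow> y" if x: "\<And>k. x k \<in> \<Lambda>" "convergent (\<lambda>k. code B (x k))" for x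
  proof -
    obtain y s where y: "y \<in> \<Lambda>" "strict_mono s" "(x \<circ> s) \<longlonglongrightarrow> y"
      using seq x(1) unfolding seq_compact_def by metis
    have "x \<longlonglongrightarrow> y"
    proof (rule ccontr)
      assume "\<not> x \<longlonglongrightarrow> y"
      then obtain U where U: "open U" "y \<in> U" "\<not> (\<forall>\<^sub>F k in sequentially. x k \<in> U)"
        by (auto simp: tendsto_def)
      then have "\<exists>\<^sub>\<infinity>k. x k \<notin> U" by (simp add: frequently_def cofinite_eq_sequentially)
      then have inf: "infinite {k. x k \<notin> U}" by (simp add: frequently_cofinite)
      define s' where "s' = enumerate {k. x k \<notin> U}"
      have s': "strict_mono s'" "\<And>k. x (s' k) \<notin> U"
        using strict_mono_enumerate[OF inf] enumerate_in_set[OF inf] by (auto simp: s'_def)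
      obtain z s'' where z: "z \<in> \<Lambda>" "strict_mono s''" "((x \<circ> s') \<circ> s'') \<longlonglongrightarrow> z"
        using seq x(1) unfolding seq_compact_def by (metis comp_apply)
      have "z \<notin> U"
      proof
        assume "z \<in> U"
        then have "\<forall>\<^sub>F k in sequentially. ((x \<circ> s') \<circ> s'') k \<in> U" using z(3) U(1) by (auto simp: tendsto_def)
        then show False using s'(2) by (auto dest!: eventually_happens)
      qed
      then have "y \<noteq> z" using U(2) by blast
      then obtain V V' where V: "open V" "open V'" "y \<in> V" "z \<in> V'" "V \<inter> V' = {}"
        by (metis hausdorff)
      obtain i where i: "y \<in> B i" "B i \<subseteq> V"
        using topological_basisE[OF B V(1) V(3)] by (metis rangeE)
      have "open (B i)" using B by (auto simp: topological_basis_open)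
      then have "\<forall>\<^sub>F k in sequentially. x (s k) \<in> B i" using y(3) i(1) by (auto simp: tendsto_def)
      moreover have "\<forall>\<^sub>F k in sequentially. x (s' (s'' k)) \<in> V'" using z(3) V by (auto simp: tendsto_def)
      then have "\<forall>\<^sub>F k in sequentially. x (s' (s'' k)) \<notin> B i"
        by eventually_elim (use i V in blast)
      moreover have "filterlim s sequentially sequentially" "filterlim (\<lambda>k. s' (s'' k)) sequentially sequentially"
        using filterlim_subseq[OF y(2)] filterlim_subseq[OF strict_mono_o[OF s'(1) z(2)]] by (auto simp: o_def)
      ultimately have s: "\<forall>\<^sub>F k in sequentially. x (s k) \<in> B i"
          "\<forall>\<^sub>F k in sequentially. x (s' (s'' k)) \<notin> B i"
          "filterlim s sequentially sequentially" "filterlim (\<lambda>k. s' (s'' k)) sequentially sequentially"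
        by blast+
      from code_convergent[OF x(2), of i] show False
      proof
        assume "\<forall>\<^sub>F k in sequentially. x k \<in> B i"
        from eventually_conj[OF eventually_compose_filterlim[OF this s(4)] s(2)] show False
          by (auto dest!: eventually_happens)
      next
        assume "\<forall>\<^sub>F k in sequentially. x k \<notin> B i"
        from eventually_conj[OF eventually_compose_filterlim[OF this s(3)] s(1)] show False
          by (auto dest!: eventually_happens)
      qed
    qed
    with y show ?thesis by blast
  qed
  have lim_unique: "x' \<longlonglongrightarrow> y" if x: "\<And>k. x k \<in> \<Lambda>" "(\<lambda>k. code B (x k)) \<longlonglongrightarrow> r" "x \<longlonglongrightarrow> y"
    and x': "\<And>k. x' k \<in> \<Lambda>" "(\<lambda>k. code B (x' k)) \<longlonglongrightarrow> r" for x x' r y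
  proof -
    \<comment> \<open>Interleaving the two sequences gives a third one with convergent codes, which
      therefore converges and forces a common limit.\<close>
    define w where "w k = (if even k then x (k div 2) else x' (k div 2))" for k
    have we: "w (2 * k) = x k" "w (2 * k + 1) = x' k" for k by (auto simp: w_def)
    have "(\<lambda>k. code B (w k)) \<longlonglongrightarrow> r"
      by (rule limseq_even_odd) (simp_all only: we x x')
    then have "convergent (\<lambda>k. code B (w k))" unfolding convergent_def by blast
    moreover have "w k \<in> \<Lambda>" for k using x(1) x'(1) by (simp add: w_def)
    ultimately obtain z where z: "w \<longlonglongrightarrow> z" using conv[of w] by blast
    have "(\<lambda>k. w (2 * k)) \<longlonglongrightarrow> z" "(\<lambda>k. w (2 * k + 1)) \<longlonglongrightarrow> z"
      using LIMSEQ_subseq_LIMSEQ[OF z, of "\<lambda>k. 2 * k"] LIMSEQ_subseq_LIMSEQ[OF z, of "\<lambda>k. 2 * k + 1"]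
      by (auto simp: strict_mono_def o_def)
    then have "x \<longlonglongrightarrow> z" "x' \<longlonglongrightarrow> z" by (simp_all only: we)
    then show ?thesis using x(3) LIMSEQ_unique by blast
  qed
  have "\<exists>y. y \<in> \<Lambda> \<and> (\<forall>x. (\<forall>k. x k \<in> \<Lambda>) \<longrightarrow> (\<lambda>k. code B (x k)) \<longlonglongrightarrow> r \<longrightarrow> x \<longlonglongrightarrow> y)" if r: "r \<in> ?K" for r
  proof -
    obtain c where c: "\<And>k. c k \<in> code B ` \<Lambda>" "c \<longlonglongrightarrow> r" using r unfolding closure_sequential by blast
    have "\<forall>k. \<exists>y. y \<in> \<Lambda> \<and> c k = code B y" using c(1) by blast
    then obtain x where x: "\<And>k. x k \<in> \<Lambda>" "\<And>k. c k = code B (x k)" by metis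
    then have cx: "(\<lambda>k. code B (x k)) \<longlonglongrightarrow> r" using c(2) by (simp flip: x(2))
    then have "convergent (\<lambda>k. code B (x k))" unfolding convergent_def by blast
    then obtain y where "y \<in> \<Lambda>" "x \<longlonglongrightarrow> y" using conv[of x] x(1) by blast
    then show ?thesis using lim_unique[OF x(1) cx] by blast
  qed
  then obtain \<pi> where \<pi>: "\<And>r. r \<in> ?K \<Longrightarrow> \<pi> r \<in> \<Lambda>"
      "\<And>r x. r \<in> ?K \<Longrightarrow> (\<And>k. x k \<in> \<Lambda>) \<Longrightarrow> (\<lambda>k. code B (x k)) \<longlonglongrightarrow> r \<Longrightarrow> x \<longlonglongrightarrow> \<pi> r"
    by metis
  have code: "\<pi> (code B x) = x" if x: "x \<in> \<Lambda>" for x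
  proof -
    have "(\<lambda>_. x) \<longlonglongrightarrow> \<pi> (code B x)"
      using x by (intro \<pi>(2)) (auto intro: closure_subset[THEN subsetD])
    then show ?thesis by (simp add: LIMSEQ_const_iff)
  qed
  have "continuous_on ?K \<pi>"
    unfolding continuous_on_sequentially
  proof (intro allI ballI impI, elim conjE)
    fix c r assume r: "r \<in> ?K" and c: "\<forall>n. c n \<in> ?K" "c \<longlonglongrightarrow> r"
    show "(\<pi> \<circ> c) \<longlonglongrightarrow> \<pi> r"
    proof (rule ccontr)
      assume "\<not> (\<pi> \<circ> c) \<longlonglongrightarrow> \<pi> r"
      then obtain U where U: "open U" "\<pi> r \<in> U" "\<not> (\<forall>\<^sub>F k in sequentially. \<pi> (c k) \<in> U)"
        by (auto simp: tendsto_def)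
      then have "\<exists>\<^sub>\<infinity>k. \<pi> (c k) \<notin> U" by (simp add: frequently_def cofinite_eq_sequentially)
      then have inf: "infinite {k. \<pi> (c k) \<notin> U}" by (simp add: frequently_cofinite)
      define s where "s = enumerate {k. \<pi> (c k) \<notin> U}"
      have s: "strict_mono s" "\<And>k. \<pi> (c (s k)) \<notin> U"
        using strict_mono_enumerate[OF inf] enumerate_in_set[OF inf] by (auto simp: s_def)
      have "\<forall>k. (\<pi> \<circ> c \<circ> s) k \<in> \<Lambda>" using \<pi>(1) c(1) by simp
      then obtain z s' where z: "z \<in> \<Lambda>" "strict_mono s'" "(\<pi> \<circ> c \<circ> s \<circ> s') \<longlonglongrightarrow> z"
        using seq unfolding seq_compact_def by metis
      define c' where "c' = (\<lambda>k. c (s (s' k)))"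
      have c': "c' k \<in> ?K" "\<pi> (c' k) \<notin> U" for k using c(1) s(2) by (auto simp: c'_def)
      have c'r: "c' \<longlonglongrightarrow> r"
        using LIMSEQ_subseq_LIMSEQ[OF c(2) strict_mono_o[OF s(1) z(2)]] by (simp add: c'_def o_def)
      have c'z: "(\<lambda>k. \<pi> (c' k)) \<longlonglongrightarrow> z" using z(3) by (simp add: c'_def o_def)
      have "z \<notin> U"
      proof
        assume "z \<in> U"
        then have "\<forall>\<^sub>F k in sequentially. \<pi> (c' k) \<in> U" using c'z U(1) by (auto simp: tendsto_def)
        then show False using c'(2) by (auto dest!: eventually_happens)
      qed
      then have "\<pi> r \<noteq> z" using U(2) by blast
      then obtain V V' where V: "open V" "open V'" "\<pi> r \<in> V" "z \<in> V'" "V \<inter> V' = {}"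
        by (metis hausdorff)
      \<comment> \<open>The values \<open>c' k\<close> lie only in the closure. They are replaced by
        codes of points that lie in \<open>V'\<close> and are ever closer to them; these codes still
        tend to \<open>r\<close>, so the points would have to enter \<open>V\<close>.\<close>
      have ex: "\<exists>x\<in>\<Lambda>. \<bar>code B x - q\<bar> < e \<and> x \<in> V'" if q: "q \<in> ?K" "\<pi> q \<in> V'" and "0 < e" for q e
      proof -
        obtain a where a: "\<And>k. a k \<in> code B ` \<Lambda>" "a \<longlonglongrightarrow> q" using q(1) unfolding closure_sequential by blast
        have "\<forall>k. \<exists>y. y \<in> \<Lambda> \<and> a k = code B y" using a(1) by blast
        then obtain x where x: "\<And>k. x k \<in> \<Lambda>" "\<And>k. a k = code B (x k)" by metis
        then have "(\<lambda>k. code B (x k)) \<longlonglongrightarrow> q" using a(2) by (simp flip: x(2))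
        moreover from \<pi>(2)[OF q(1) x(1) this] have "\<forall>\<^sub>F k in sequentially. x k \<in> V'"
          using V(2) q(2) by (auto simp: tendsto_def)
        ultimately have "\<forall>\<^sub>F k in sequentially. dist (code B (x k)) q < e \<and> x k \<in> V'"
          using \<open>0 < e\<close> by (intro eventually_conj tendstoD)
        then show ?thesis using x(1) by (auto dest!: eventually_happens simp: dist_real_def)
      qed
      have "\<forall>\<^sub>F k in sequentially. \<pi> (c' k) \<in> V'" using c'z V by (auto simp: tendsto_def)
      then obtain n where n: "\<And>k. n \<le> k \<Longrightarrow> \<pi> (c' k) \<in> V'" by (auto simp: eventually_sequentially)
      have "\<forall>k. \<exists>x\<in>\<Lambda>. \<bar>code B x - c' (n + k)\<bar> < 1 / real (Suc k) \<and> x \<in> V'"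
        by (intro allI ex c' n) auto
      then obtain x where x: "\<And>k. x k \<in> \<Lambda>" "\<And>k. \<bar>code B (x k) - c' (n + k)\<bar> < 1 / real (Suc k)" "\<And>k. x k \<in> V'"
        by metis
      have "(\<lambda>k. code B (x k) - c' (n + k)) \<longlonglongrightarrow> 0"
        by (rule Lim_null_comparison[OF _ LIMSEQ_inverse_real_of_nat])
           (use x(2) in \<open>auto simp: divide_inverse less_imp_le\<close>)
      moreover have "(\<lambda>k. c' (n + k)) \<longlonglongrightarrow> r"
        using LIMSEQ_ignore_initial_segment[OF c'r, of n] by (simp add: add.commute)
      ultimately have "(\<lambda>k. code B (x k)) \<longlonglongrightarrow> r"
        using tendsto_add[of "\<lambda>k. code B (x k) - c' (n + k)" 0 sequentially "\<lambda>k. c' (n + k)" r] by simp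
      from \<pi>(2)[OF r x(1) this] have "\<forall>\<^sub>F k in sequentially. x k \<in> V" using V by (auto simp: tendsto_def)
      then show False using x(3) V(5) by (auto dest!: eventually_happens)
    qed
  qed
  with \<pi>(1) code show ?thesis by (intro that[of \<pi>]) auto
qed

lemma prob_space_nonempty_restrict:
  assumes "prob_space M" "sets M = sets (restrict_space borel \<Lambda>)"
  shows "\<Lambda> \<noteq> {}" "space M = \<Lambda>"
  using prob_space.not_empty[OF assms(1)] sets_eq_imp_space_eq[OF assms(2)]
  by (auto simp: space_restrict_space)

text \<open>Helly's theorem is available on the real line only, so the measures are transported there by
  \<open>code\<close> and the limit is pulled back by its continuous inverse.\<close>

lemma compact_weak_limit:
  fixes \<Lambda> :: "'a::{t2_space,second_countable_topology} set"
  assumes \<Lambda>: "compact \<Lambda>"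
    and \<mu>: "\<And>n::nat. prob_space (\<mu> n)" "\<And>n. sets (\<mu> n) = sets (restrict_space borel \<Lambda>)"
  obtains r M where "strict_mono (r :: nat \<Rightarrow> nat)" "prob_space M" "sets M = sets (restrict_space borel \<Lambda>)"
    "\<And>f :: 'a \<Rightarrow> real. continuous_on \<Lambda> f \<Longrightarrow> (\<lambda>n. integral\<^sup>L (\<mu> (r n)) f) \<longlonglongrightarrow> integral\<^sup>L M f"
proof -
  have sp: "space (\<mu> n) = \<Lambda>" and ne: "\<Lambda> \<noteq> {}" for n
    using prob_space_nonempty_restrict[OF \<mu>] by auto
  obtain \<B> :: "'a set set" where \<B>: "countable \<B>" "topological_basis \<B>"
    using ex_countable_basis by blast
  have Bne: "\<B> \<noteq> {}"
    using \<B>(2) ne topological_basisE[OF \<B>(2) open_UNIV] by (metis UNIV_I empty_iff)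
  define B where "B = from_nat_into \<B>"
  have rB: "range B = \<B>" unfolding B_def using \<B>(1) Bne by (rule range_from_nat_into[rotated])
  then have basis: "topological_basis (range B)" using \<B>(2) by simp
  have openB: "open (B i)" for i using basis by (rule topological_basis_open) simp
  let ?c = "code B"
  let ?K = "closure (?c ` \<Lambda>)"
  obtain \<pi> where \<pi>: "continuous_on ?K \<pi>" "\<pi> ` ?K \<subseteq> \<Lambda>" "\<And>x. x \<in> \<Lambda> \<Longrightarrow> \<pi> (?c x) = x"
    using code_continuous_inverse[OF \<Lambda> basis] by blast
  have "?c \<in> borel_measurable borel"
    unfolding code_def
    by (intro borel_measurable_suminf borel_measurable_times borel_measurable_const borel_measurable_indicator)
       (use openB in auto)
  then have cm: "?c \<in> borel_measurable (\<mu> n)" for n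
    by (subst measurable_cong_sets[OF \<mu>(2) refl]) (rule measurable_restrict_space1)
  define \<nu> where "\<nu> n = distr (\<mu> n) borel ?c" for n
  have \<nu>: "real_distribution (\<nu> n)" for n
    unfolding \<nu>_def using prob_space.real_distribution_distr[OF \<mu>(1) cm] .
  have int_\<nu>: "integral\<^sup>L (\<nu> n) g = integral\<^sup>L (\<mu> n) (\<lambda>x. g (?c x))"
    if "g \<in> borel_measurable borel" for g :: "real \<Rightarrow> real" and n
    unfolding \<nu>_def by (rule integral_distr[OF cm that])
  \<comment> \<open>No mass can escape, because all codes lie in [0, 1]. The half-open interval
    starts below 0 in order to contain the code 0.\<close>
  have "tight \<nu>"
    unfolding tight_def
  proof (intro conjI allI impI \<nu>)
    fix e :: real assume "0 < e"
    have "1 - e < measure (\<nu> n) {-1<..1}" for n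
    proof -
      have "measure (\<nu> n) {-1<..1} = measure (\<mu> n) (?c -` {-1<..1} \<inter> space (\<mu> n))"
        unfolding \<nu>_def by (rule measure_distr[OF cm]) simp
      also have "?c -` {-1<..1} \<inter> space (\<mu> n) = space (\<mu> n)"
      proof -
        have "-1 < ?c x" for x using code_bounds(1)[of B x] by linarith
        then show ?thesis using code_bounds(2)[of B] by auto
      qed
      finally show ?thesis
        using prob_space.prob_space[OF \<mu>(1)] \<open>0 < e\<close> by simp
    qed
    then show "\<exists>a b. a < b \<and> (\<forall>n. 1 - e < measure (\<nu> n) {a<..b})"
      by (intro exI[of _ "-1"] exI[of _ 1]) auto
  qed
  then obtain r N where r: "strict_mono (r :: nat \<Rightarrow> nat)" and N: "real_distribution N" "weak_conv_m (\<nu> \<circ> r) N"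
    using tight_imp_convergent_subsubsequence[of \<nu> id] by (auto simp: strict_mono_id)
  interpret N: real_distribution N by fact
  have conv: "(\<lambda>n. integral\<^sup>L (\<nu> (r n)) g) \<longlonglongrightarrow> integral\<^sup>L N g"
    if "continuous_on UNIV g" "\<And>x. norm (g x) \<le> b" for g :: "real \<Rightarrow> real" and b
    using weak_conv_imp_integral_bdd_continuous_conv[OF _ N, of g b] \<nu> that
    by (auto simp: continuous_on_eq_continuous_at)
  have K: "closed ?K" "?K \<noteq> {}" using ne by auto
  \<comment> \<open>Weak convergence tests bounded continuous functions, so the distance to the
    closure is truncated at 1. Its integral is 0 for every \<open>\<nu> n\<close>, hence for the
    limit, which is therefore concentrated on the closure.\<close>
  define d where "d x = min 1 (infdist x ?K)" for x
  have cd: "continuous_on UNIV d" unfolding d_def by (intro continuous_intros)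
  have dm: "d \<in> borel_measurable borel" using cd by (rule borel_measurable_continuous_onI)
  have d0: "0 \<le> d x" "norm (d x) \<le> 1" for x using infdist_nonneg[of x ?K] by (auto simp: d_def)
  have "integral\<^sup>L (\<nu> n) d = 0" for n
  proof -
    have "integral\<^sup>L (\<mu> n) (\<lambda>x. d (?c x)) = integral\<^sup>L (\<mu> n) (\<lambda>x. 0)"
    proof (rule Bochner_Integration.integral_cong[OF refl])
      fix x assume "x \<in> space (\<mu> n)"
      then have "?c x \<in> ?K" using closure_subset[of "?c ` \<Lambda>"] by (auto simp: sp)
      then show "d (?c x) = 0" by (simp add: d_def)
    qed
    then show ?thesis using int_\<nu>[OF dm] by simp
  qed
  then have "integral\<^sup>L N d = 0"
    using conv[OF cd d0(2)] by (simp add: LIMSEQ_const_iff)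
  moreover have "integrable N d"
    by (rule N.integrable_const_bound[where B=1]) (use d0(2) dm in auto)
  ultimately have "AE x in N. d x = 0"
    using integral_nonneg_eq_0_iff_AE[of N d] d0(1) by simp
  then have inK: "AE x in N. x \<in> ?K"
  proof eventually_elim
    case (elim x)
    then have "infdist x ?K = 0" by (auto simp: d_def min_def split: if_splits)
    then show ?case using in_closed_iff_infdist_zero[OF K] by blast
  qed
  obtain x0 where x0: "x0 \<in> \<Lambda>" using ne by blast
  \<comment> \<open>Off the closure, a null set of the limit, \<pi> is replaced by an arbitrary
    point of \<Lambda>, which makes the map total and Borel.\<close>
  define p where "p r = (if r \<in> ?K then \<pi> r else x0)" for r
  have "p \<in> measurable borel borel"
    unfolding p_def by (intro borel_measurable_continuous_on_if \<pi> continuous_on_const) (use K in auto)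
  then have pm: "p \<in> measurable N (restrict_space borel \<Lambda>)"
    using \<pi>(2) x0 by (intro measurable_restrict_space2) (auto simp: p_def image_subset_iff)
  define M where "M = distr N (restrict_space borel \<Lambda>) p"
  show ?thesis
  proof (rule that[OF r, of M])
    show "prob_space M" unfolding M_def by (rule N.prob_space_distr[OF pm])
    show "sets M = sets (restrict_space borel \<Lambda>)" by (simp add: M_def)
    fix f :: "'a \<Rightarrow> real" assume f: "continuous_on \<Lambda> f"
    have fm: "f \<in> borel_measurable (restrict_space borel \<Lambda>)"
      using f by (rule borel_measurable_continuous_on_restrict)
    obtain b where b: "\<And>x. x \<in> \<Lambda> \<Longrightarrow> norm (f x) \<le> b"
      using compact_imp_bounded[OF compact_continuous_image[OF f \<Lambda>]] unfolding bounded_iff by blast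
    have b0: "0 \<le> b" using b[OF x0] norm_ge_zero order_trans by blast
    have "continuous_on ?K (\<lambda>r. f (\<pi> r))"
      using f \<pi>(1,2) by (rule continuous_on_compose2)
    \<comment> \<open>\<open>f \<circ> \<pi>\<close> lives on the closure only; its Tietze extension
      with the same bound is an admissible test function on the line.\<close>
    then obtain g where g: "continuous_on UNIV g" "\<And>r. r \<in> ?K \<Longrightarrow> g r = f (\<pi> r)" "\<And>r. norm (g r) \<le> b"
      using Tietze[of ?K "\<lambda>r. f (\<pi> r)" UNIV b] K b0 b \<pi>(2) by (metis UNIV_I closed_closedin image_subset_iff subtopology_UNIV)
    have gm: "g \<in> borel_measurable borel" using g(1) by (rule borel_measurable_continuous_onI)
    have "integral\<^sup>L (\<nu> n) g = integral\<^sup>L (\<mu> n) f" for n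
      unfolding int_\<nu>[OF gm]
    proof (rule Bochner_Integration.integral_cong[OF refl])
      fix x assume "x \<in> space (\<mu> n)"
      then have "x \<in> \<Lambda>" by (simp add: sp)
      moreover from this have "?c x \<in> ?K" using closure_subset[of "?c ` \<Lambda>"] by auto
      ultimately show "g (?c x) = f x" by (simp add: g(2) \<pi>(3))
    qed
    moreover have "integral\<^sup>L M f = integral\<^sup>L N (\<lambda>r. f (p r))"
      unfolding M_def by (rule integral_distr[OF pm fm])
    moreover have "integral\<^sup>L N (\<lambda>r. f (p r)) = integral\<^sup>L N g"
    proof (rule integral_cong_AE)
      show "(\<lambda>r. f (p r)) \<in> borel_measurable N" using measurable_compose[OF pm fm] .
      show "g \<in> borel_measurable N" using gm by simp
      show "AE r in N. f (p r) = g r"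
        using inK by eventually_elim (simp add: p_def g(2))
    qed
    ultimately show "(\<lambda>n. integral\<^sup>L (\<mu> (r n)) f) \<longlonglongrightarrow> integral\<^sup>L M f"
      using conv[OF g(1) g(3)] by simp
  qed
qed

section \<open>Invariant measures of a flow and uniform decay of subadditive cocycles\<close>

locale compact_flow =
  fixes \<Lambda> :: "'a::{t2_space,second_countable_topology} set" and \<psi> :: "real \<Rightarrow> 'a \<Rightarrow> 'a"
  assumes compact: "compact \<Lambda>"
    and maps: "x \<in> \<Lambda> \<Longrightarrow> \<psi> t x \<in> \<Lambda>"
    and zero: "x \<in> \<Lambda> \<Longrightarrow> \<psi> 0 x = x"
    and add: "x \<in> \<Lambda> \<Longrightarrow> \<psi> (s + t) x = \<psi> t (\<psi> s x)"
    and cont_t: "x \<in> \<Lambda> \<Longrightarrow> continuous_on UNIV (\<lambda>t. \<psi> t x)"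
    and cont_x: "continuous_on \<Lambda> (\<psi> t)"
begin

abbreviation average :: "('a \<Rightarrow> real) \<Rightarrow> real \<Rightarrow> 'a \<Rightarrow> real" where
  "average f T x \<equiv> integral {0..T} (\<lambda>s. f (\<psi> s x)) / T"

lemma cont_orbit:
  fixes f :: "'a \<Rightarrow> real"
  assumes "continuous_on \<Lambda> f" "x \<in> \<Lambda>"
  shows "continuous_on S (\<lambda>s. f (\<psi> s x))"
  using continuous_on_compose2[OF assms(1) cont_t[OF assms(2)]] maps[OF assms(2)]
  by (auto intro: continuous_on_subset)

lemma integral_bound_orbit:
  fixes f :: "'a \<Rightarrow> real"
  assumes f: "continuous_on \<Lambda> f" "x \<in> \<Lambda>" and b: "\<And>y. y \<in> \<Lambda> \<Longrightarrow> \<bar>f y\<bar> \<le> b" and uv: "u \<le> v"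
  shows "\<bar>integral {u..v} (\<lambda>s. f (\<psi> s x))\<bar> \<le> b * (v - u)"
  using integral_bound[OF uv cont_orbit[OF f], of b] b maps[OF f(2)] by auto

lemma orbit_measure:
  assumes x: "x \<in> \<Lambda>" and T: "0 < T"
  obtains \<mu> where "prob_space \<mu>" "sets \<mu> = sets (restrict_space borel \<Lambda>)"
    "\<And>f :: 'a \<Rightarrow> real. continuous_on \<Lambda> f \<Longrightarrow> integral\<^sup>L \<mu> f = average f T x"
proof -
  \<comment> \<open>The orbit measure is the push-forward of normalised length on the time
    interval.\<close>
  define U where "U = uniform_measure lborel {0..T}"
  have prob: "prob_space U"
    unfolding U_def by (rule prob_space_uniform_measure) (use T in auto)
  have m: "(\<lambda>s. \<psi> s x) \<in> measurable U (restrict_space borel \<Lambda>)"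
    unfolding U_def using maps[OF x] borel_measurable_continuous_onI[OF cont_t[OF x]]
    by (intro measurable_restrict_space2) auto
  show ?thesis
  proof (rule that[of "distr U (restrict_space borel \<Lambda>) (\<lambda>s. \<psi> s x)"])
    show "prob_space (distr U (restrict_space borel \<Lambda>) (\<lambda>s. \<psi> s x))"
      by (rule prob_space.prob_space_distr[OF prob m])
    fix f :: "'a \<Rightarrow> real" assume f: "continuous_on \<Lambda> f"
    let ?F = "\<lambda>s. f (\<psi> s x)"
    have Fm: "?F \<in> borel_measurable borel"
      by (intro borel_measurable_continuous_onI cont_orbit f x)
    have "integral\<^sup>L (distr U (restrict_space borel \<Lambda>) (\<lambda>s. \<psi> s x)) f = integral\<^sup>L U ?F"
      by (rule integral_distr[OF m borel_measurable_continuous_on_restrict[OF f]])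
    also have "\<dots> = (LINT s|lborel. (indicator {0..T} s / T) *\<^sub>R ?F s)"
    proof -
      have "U = density lborel (\<lambda>s. ennreal (indicator {0..T} s / T))"
        unfolding U_def uniform_measure_def using T
        by (intro arg_cong2[where f=density] ext refl) (auto simp: indicator_def divide_ennreal[symmetric])
      then show ?thesis using Fm T by (simp add: integral_real_density)
    qed
    also have "\<dots> = (LINT s:{0..T}|lborel. ?F s) / T"
      unfolding set_lebesgue_integral_def by (simp add: ac_simps flip: integral_divide_zero)
    also have "(LINT s:{0..T}|lborel. ?F s) = integral {0..T} ?F"
      by (intro set_borel_integral_eq_integral borel_integrable_atLeastAtMost' cont_orbit f x)
    finally show "integral\<^sup>L (distr U (restrict_space borel \<Lambda>) (\<lambda>s. \<psi> s x)) f = average f T x" .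
  qed simp
qed

text \<open>The Krylov-Bogoliubov construction, with starting points that may vary with
  \<open>n\<close>: a time shift by \<open>t\<close> changes the average over a segment of length
  \<open>T\<close> only through the two end pieces, by at most \<open>2 * b * t / T\<close>. The
  lengths \<open>Suc n\<close> never vanish.\<close>

lemma invariant_limit:
  assumes x: "\<And>n::nat. x n \<in> \<Lambda>"
  obtains r \<mu> where "strict_mono (r :: nat \<Rightarrow> nat)" "prob_space \<mu>" "sets \<mu> = sets (restrict_space borel \<Lambda>)"
    "\<And>t. distr \<mu> \<mu> (\<psi> t) = \<mu>" "\<And>t. \<psi> t \<in> measurable \<mu> \<mu>"
    "\<And>f :: 'a \<Rightarrow> real. continuous_on \<Lambda> f \<Longrightarrow>
      (\<lambda>n. average f (real (Suc (r n))) (x (r n))) \<longlonglongrightarrow> integral\<^sup>L \<mu> f"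
proof -
  have "\<forall>n. \<exists>\<mu>. prob_space \<mu> \<and> sets \<mu> = sets (restrict_space borel \<Lambda>) \<and>
      (\<forall>f :: 'a \<Rightarrow> real. continuous_on \<Lambda> f \<longrightarrow> integral\<^sup>L \<mu> f = average f (real (Suc n)) (x n))"
  proof
    fix n
    obtain \<mu> where "prob_space \<mu>" "sets \<mu> = sets (restrict_space borel \<Lambda>)"
      "\<And>f :: 'a \<Rightarrow> real. continuous_on \<Lambda> f \<Longrightarrow> integral\<^sup>L \<mu> f = average f (real (Suc n)) (x n)"
      using orbit_measure[OF x, of "real (Suc n)" n] by auto
    then show "\<exists>\<mu>. prob_space \<mu> \<and> sets \<mu> = sets (restrict_space borel \<Lambda>) \<and>
      (\<forall>f :: 'a \<Rightarrow> real. continuous_on \<Lambda> f \<longrightarrow> integral\<^sup>L \<mu> f = average f (real (Suc n)) (x n))" by blast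
  qed
  from choice[OF this] obtain \<mu> where \<mu>': "\<forall>n. prob_space (\<mu> n) \<and> sets (\<mu> n) = sets (restrict_space borel \<Lambda>) \<and>
      (\<forall>f :: 'a \<Rightarrow> real. continuous_on \<Lambda> f \<longrightarrow> integral\<^sup>L (\<mu> n) f = average f (real (Suc n)) (x n))" ..
  have \<mu>: "\<And>n. prob_space (\<mu> n)" "\<And>n. sets (\<mu> n) = sets (restrict_space borel \<Lambda>)"
    using \<mu>' by (blast, blast)
  have \<mu>3: "integral\<^sup>L (\<mu> n) f = average f (real (Suc n)) (x n)" if "continuous_on \<Lambda> f" for n and f :: "'a \<Rightarrow> real"
    using \<mu>'[rule_format, of n] that by (elim conjE allE impE)
  obtain r M where r: "strict_mono (r :: nat \<Rightarrow> nat)" and M: "prob_space M" "sets M = sets (restrict_space borel \<Lambda>)"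
    and lim0: "\<And>f :: 'a \<Rightarrow> real. continuous_on \<Lambda> f \<Longrightarrow> (\<lambda>n. integral\<^sup>L (\<mu> (r n)) f) \<longlonglongrightarrow> integral\<^sup>L M f"
    by (rule compact_weak_limit[of \<Lambda> \<mu>, OF compact \<mu>(1,2)], rule that)
  have lim: "(\<lambda>n. average f (real (Suc (r n))) (x (r n))) \<longlonglongrightarrow> integral\<^sup>L M f"
    if "continuous_on \<Lambda> f" for f :: "'a \<Rightarrow> real"
    using lim0[OF that] by (simp add: \<mu>3[OF that])
  have spM: "space M = \<Lambda>" using prob_space_nonempty_restrict[OF M] by simp
  have meas: "\<psi> t \<in> measurable M M" for t
  proof -
    have "\<psi> t \<in> measurable (restrict_space borel \<Lambda>) (restrict_space borel \<Lambda>)"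
      using maps by (intro measurable_restrict_space2 borel_measurable_continuous_on_restrict cont_x)
        (auto simp: space_restrict_space)
    then show ?thesis by (subst measurable_cong_sets[OF M(2) M(2)])
  qed
  have inv_pos: "integral\<^sup>L M (\<lambda>y. f (\<psi> t y)) = integral\<^sup>L M f"
    if f: "continuous_on \<Lambda> f" and t: "0 \<le> t" for f :: "'a \<Rightarrow> real" and t
  proof -
    obtain b where b: "\<And>x. x \<in> \<Lambda> \<Longrightarrow> \<bar>f x\<bar> \<le> b"
      using compact_imp_bounded[OF compact_continuous_image[OF f compact]] unfolding bounded_iff by auto
    have fc: "continuous_on \<Lambda> (\<lambda>y. f (\<psi> t y))"
      by (rule continuous_on_compose2[OF f cont_x]) (use maps in auto)
    have est: "\<bar>average (\<lambda>y. f (\<psi> t y)) T z - average f T z\<bar> \<le> 2 * b * t / T"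
      if z: "z \<in> \<Lambda>" and T: "0 < T" for z T
    proof -
      let ?F = "\<lambda>s. f (\<psi> s z)"
      have int: "?F integrable_on {u..v}" for u v
        by (intro integrable_continuous_real cont_orbit f z)
      have "integral {0..T} (\<lambda>s. f (\<psi> t (\<psi> s z))) = integral {0..T} (\<lambda>s. f (\<psi> (s + t) z))"
        by (simp add: add[OF z])
      also have "\<dots> = integral {t..T + t} ?F" using integral_shift_Icc_real[of 0 T ?F t] by (simp add: o_def add.commute)
      also have "\<dots> = integral {0..T} ?F + integral {T..T + t} ?F - integral {0..t} ?F"
        using Henstock_Kurzweil_Integration.integral_combine[OF _ _ int, of 0 t "T + t"] Henstock_Kurzweil_Integration.integral_combine[OF _ _ int, of 0 T "T + t"] t T
        by simp
      finally have "\<bar>integral {0..T} (\<lambda>s. f (\<psi> t (\<psi> s z))) - integral {0..T} ?F\<bar> \<le> 2 * b * t"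
        using integral_bound_orbit[OF f z b, of T "T + t"] integral_bound_orbit[OF f z b, of 0 t] t by simp
      then have "\<bar>integral {0..T} (\<lambda>s. f (\<psi> t (\<psi> s z))) - integral {0..T} ?F\<bar> / T \<le> 2 * b * t / T"
        using T by (intro divide_right_mono) auto
      then show ?thesis using T by (simp add: diff_divide_distrib[symmetric] abs_divide)
    qed
    have "(\<lambda>n. average (\<lambda>y. f (\<psi> t y)) (real (Suc (r n))) (x (r n)) - average f (real (Suc (r n))) (x (r n))) \<longlonglongrightarrow> 0"
    proof (rule Lim_null_comparison)
      show "\<forall>\<^sub>F n in sequentially. norm (average (\<lambda>y. f (\<psi> t y)) (real (Suc (r n))) (x (r n)) -
          average f (real (Suc (r n))) (x (r n))) \<le> 2 * b * t / real (Suc (r n))"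
        using est[OF x] by (intro always_eventually allI) (simp only: real_norm_def of_nat_0_less_iff zero_less_Suc)
      have "(\<lambda>n. 2 * b * t / real (Suc n)) \<longlonglongrightarrow> 0" by real_asymp
      from LIMSEQ_subseq_LIMSEQ[OF this r] show "(\<lambda>n. 2 * b * t / real (Suc (r n))) \<longlonglongrightarrow> 0"
        by (simp add: o_def)
    qed
    moreover have "(\<lambda>n. average (\<lambda>y. f (\<psi> t y)) (real (Suc (r n))) (x (r n)) - average f (real (Suc (r n))) (x (r n)))
        \<longlonglongrightarrow> integral\<^sup>L M (\<lambda>y. f (\<psi> t y)) - integral\<^sup>L M f"
      by (intro tendsto_diff lim f fc)
    ultimately have "integral\<^sup>L M (\<lambda>y. f (\<psi> t y)) - integral\<^sup>L M f = 0"
      by (rule LIMSEQ_unique[rotated])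
    then show ?thesis by simp
  qed
  \<comment> \<open>For negative \<open>t\<close>, invariance under the positive time
    \<open>- t\<close> is applied to \<open>f \<circ> \<psi> t\<close>.\<close>
  have inv: "integral\<^sup>L M (\<lambda>y. f (\<psi> t y)) = integral\<^sup>L M f"
    if f: "continuous_on \<Lambda> f" for f :: "'a \<Rightarrow> real" and t
  proof (cases "0 \<le> t")
    case False
    have fc: "continuous_on \<Lambda> (\<lambda>y. f (\<psi> t y))"
      by (rule continuous_on_compose2[OF f cont_x]) (use maps in auto)
    have "integral\<^sup>L M f = integral\<^sup>L M (\<lambda>y. f (\<psi> t (\<psi> (- t) y)))"
      by (rule Bochner_Integration.integral_cong[OF refl]) (simp add: spM add[symmetric] zero)
    also have "\<dots> = integral\<^sup>L M (\<lambda>y. f (\<psi> t y))" using inv_pos[OF fc, of "- t"] False by simp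
    finally show ?thesis by simp
  qed (use inv_pos f in blast)
  have "distr M M (\<psi> t) = M" for t
  proof (rule compact_measure_eqI[OF compact _ _ M])
    show "prob_space (distr M M (\<psi> t))" by (rule prob_space.prob_space_distr[OF M(1) meas])
    fix f :: "'a \<Rightarrow> real" assume f: "continuous_on \<Lambda> f"
    have "f \<in> borel_measurable M"
      by (subst measurable_cong_sets[OF M(2) refl]) (rule borel_measurable_continuous_on_restrict[OF f])
    then show "integral\<^sup>L (distr M M (\<psi> t)) f = integral\<^sup>L M f"
      using integral_distr[OF meas, of f t] inv[OF f] by simp
  qed (use M in simp)
  with r M meas lim show ?thesis by (intro that[of r M])
qed

text \<open>For every offset \<open>s\<close> in \<open>{0..T}\<close>, the time from 0 to
  \<open>n\<close> is cut into \<open>s\<close>, then \<open>m\<close> blocks of length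
  \<open>T\<close>, and a rest shorter than \<open>2 * T\<close>. Integrating over \<open>s\<close>
  merges the sums over blocks into one integral along the orbit.\<close>

lemma subadditive_average:
  fixes \<phi> :: "real \<Rightarrow> 'a \<Rightarrow> real"
  assumes cont: "\<And>t. 0 \<le> t \<Longrightarrow> continuous_on \<Lambda> (\<phi> t)"
    and sub: "\<And>s t x. 0 \<le> s \<Longrightarrow> 0 \<le> t \<Longrightarrow> x \<in> \<Lambda> \<Longrightarrow> \<phi> (s + t) x \<le> \<phi> s x + \<phi> t (\<psi> s x)"
    and bd: "\<And>t x. 0 \<le> t \<Longrightarrow> x \<in> \<Lambda> \<Longrightarrow> \<bar>\<phi> t x\<bar> \<le> D * (t + 1)"
    and T: "0 < T" and n: "T \<le> n" and x: "x \<in> \<Lambda>"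
  shows "T * \<phi> n x \<le> integral {0..n} (\<lambda>s. \<phi> T (\<psi> s x)) + 6 * D * T * (T + 1)"
proof -
  let ?G = "\<lambda>u. \<phi> T (\<psi> u x)"
  have D: "0 \<le> D" using bd[OF order_refl x] by simp
  have cT: "continuous_on \<Lambda> (\<phi> T)" using cont T by simp
  have int: "?G integrable_on {u..v}" for u v
    by (intro integrable_continuous_real cont_orbit cT x)
  \<comment> \<open>One block fewer than would fit, so that the blocks still end before
    \<open>n\<close> after a shift by any offset up to \<open>T\<close>.\<close>
  define m where "m = nat \<lfloor>n / T\<rfloor> - 1"
  have fl: "1 \<le> nat \<lfloor>n / T\<rfloor>" using T n by (simp add: le_nat_floor le_nat_iff)
  have "real (nat \<lfloor>n / T\<rfloor>) \<le> n / T" "n / T < real (nat \<lfloor>n / T\<rfloor>) + 1"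
    using T n by auto
  then have "real (nat \<lfloor>n / T\<rfloor>) * T \<le> n" "n < (real (nat \<lfloor>n / T\<rfloor>) + 1) * T"
    using T by (auto simp: field_simps)
  moreover have "real (nat \<lfloor>n / T\<rfloor>) = real m + 1" using fl by (simp add: m_def)
  ultimately have m: "real m * T + T \<le> n" "n < real m * T + 2 * T"
    by (simp_all add: algebra_simps)
  have chain: "\<phi> (real k * T) y \<le> (\<Sum>j<k. \<phi> T (\<psi> (real j * T) y)) + D" if y: "y \<in> \<Lambda>" for k y
  proof (induction k)
    case 0
    then show ?case using bd[OF order_refl y] by simp
  next
    case (Suc k)
    have "\<phi> (real k * T + T) y \<le> \<phi> (real k * T) y + \<phi> T (\<psi> (real k * T) y)"
      using T by (intro sub y) auto
    with Suc show ?case by (simp add: algebra_simps)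
  qed
  have pt: "\<phi> n x \<le> (\<Sum>j<m. ?G (s + real j * T)) + 4 * D * (T + 1)" if s: "s \<in> {0..T}" for s
  proof -
    have "0 \<le> real m * T" using T by simp
    moreover have "0 \<le> s" "s \<le> T" using s by auto
    ultimately have "0 \<le> s" "s \<le> n" using m(1) by linarith+
    then have "\<phi> n x \<le> \<phi> s x + \<phi> (n - s) (\<psi> s x)"
      using sub[of s "n - s" x] x by simp
    also have "\<phi> (n - s) (\<psi> s x) \<le> \<phi> (real m * T) (\<psi> s x) + \<phi> (n - s - real m * T) (\<psi> (real m * T) (\<psi> s x))"
      using sub[of "real m * T" "n - s - real m * T" "\<psi> s x"] s m T maps[OF x] by simp
    also have "\<phi> (real m * T) (\<psi> s x) \<le> (\<Sum>j<m. \<phi> T (\<psi> (real j * T) (\<psi> s x))) + D"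
      by (rule chain[OF maps[OF x]])
    also have "\<phi> (n - s - real m * T) (\<psi> (real m * T) (\<psi> s x)) \<le> D * (2 * T + 1)"
    proof -
      have "\<phi> (n - s - real m * T) (\<psi> (real m * T) (\<psi> s x)) \<le> D * (n - s - real m * T + 1)"
        using bd[of "n - s - real m * T" "\<psi> (real m * T) (\<psi> s x)"] s m maps[OF maps[OF x]] by simp
      also have "\<dots> \<le> D * (2 * T + 1)" using s m D by (intro mult_left_mono) auto
      finally show ?thesis .
    qed
    also have "\<phi> s x \<le> D * (T + 1)"
    proof -
      have "\<phi> s x \<le> D * (s + 1)" using bd[of s x] s x by simp
      also have "\<dots> \<le> D * (T + 1)" using s D by (intro mult_left_mono) auto
      finally show ?thesis .
    qed
    finally have "\<phi> n x \<le> D * (T + 1) + ((\<Sum>j<m. \<phi> T (\<psi> (real j * T) (\<psi> s x))) + D + D * (2 * T + 1))"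
      by simp
    moreover have "0 \<le> D * T" "(\<Sum>j<m. \<phi> T (\<psi> (real j * T) (\<psi> s x))) = (\<Sum>j<m. ?G (s + real j * T))"
      using D T by (simp_all add: add[OF x])
    moreover have "D * (T + 1) = D * T + D" "D * (2 * T + 1) = 2 * (D * T) + D" "4 * D * (T + 1) = 4 * (D * T) + 4 * D"
      by (simp_all add: algebra_simps)
    ultimately show ?thesis using D by linarith
  qed
  have ints: "(\<lambda>s. ?G (s + real j * T)) integrable_on {0..T}" for j
    by (rule integrable_continuous_real, rule continuous_on_compose2[OF cont_orbit[OF cT x, of UNIV]])
       (auto intro!: continuous_intros)
  have blocks: "(\<Sum>j<k. integral {0..T} (\<lambda>s. ?G (s + real j * T))) = integral {0..real k * T} ?G" for k
  proof (induction k)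
    case (Suc k)
    have "integral {0..T} (\<lambda>s. ?G (s + real k * T)) = integral {real k * T..T + real k * T} ?G"
      using integral_shift_Icc_real[of 0 T ?G "real k * T"] by (simp add: o_def add.commute)
    with Suc show ?case
      using Henstock_Kurzweil_Integration.integral_combine[OF _ _ int, of 0 "real k * T" "T + real k * T"] T by (simp add: algebra_simps)
  qed simp
  have "T * \<phi> n x = integral {0..T} (\<lambda>s. \<phi> n x)" using T by simp
  also have "\<dots> \<le> integral {0..T} (\<lambda>s. (\<Sum>j<m. ?G (s + real j * T)) + 4 * D * (T + 1))"
    by (intro integral_le Henstock_Kurzweil_Integration.integrable_add Henstock_Kurzweil_Integration.integrable_sum ints pt) auto
  also have "\<dots> = integral {0..T} (\<lambda>s. \<Sum>j<m. ?G (s + real j * T)) + integral {0..T} (\<lambda>s. 4 * D * (T + 1))"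
    by (intro Henstock_Kurzweil_Integration.integral_add Henstock_Kurzweil_Integration.integrable_sum ints) auto
  also have "integral {0..T} (\<lambda>s. \<Sum>j<m. ?G (s + real j * T)) = integral {0..real m * T} ?G"
    using Henstock_Kurzweil_Integration.integral_sum[of "{..<m}" "\<lambda>j s. ?G (s + real j * T)" "{0..T}"] ints blocks[of m] by simp
  also have "\<dots> = integral {0..n} ?G - integral {real m * T..n} ?G"
    using Henstock_Kurzweil_Integration.integral_combine[OF _ _ int, of 0 "real m * T" n] m T by simp
  \<comment> \<open>Extending the integral from \<open>m * T\<close> to \<open>n\<close> costs at
    most this much. With the \<open>4 * D * (T + 1)\<close> of \<open>pt\<close>, integrated over a
    time \<open>T\<close>, it makes up the constant 6.\<close>
  also have "\<dots> \<le> integral {0..n} ?G + D * (T + 1) * (2 * T)"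
  proof -
    have "\<bar>integral {real m * T..n} ?G\<bar> \<le> D * (T + 1) * (n - real m * T)"
      using bd T m by (intro integral_bound_orbit cT x) auto
    also have "\<dots> \<le> D * (T + 1) * (2 * T)" using m D T by (intro mult_left_mono) auto
    finally show ?thesis by simp
  qed
  also have "integral {0..T} (\<lambda>s. 4 * D * (T + 1)) = 4 * D * (T + 1) * T" using T by simp
  finally show ?thesis by (simp add: algebra_simps)
qed

text \<open>Bridges continuous time, in which the exponents are given, and the time-one map, to
  which \<open>subadditive_liminf\<close> applies. Rounding \<open>t\<close> up to \<open>n\<close>
  gives \<open>a n x \<le> a t x + 2 * C\<close>, since the leftover time is at most 1.\<close>

lemma liminf_integer_le_Liminf:
  assumes sub: "\<And>s t x. 0 \<le> s \<Longrightarrow> 0 \<le> t \<Longrightarrow> x \<in> \<Lambda> \<Longrightarrow> a (s + t) x \<le> a s x + a t (\<psi> s x)"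
    and bd: "\<And>t x. 0 \<le> t \<Longrightarrow> x \<in> \<Lambda> \<Longrightarrow> \<bar>a t x\<bar> \<le> C * (t + 1)"
    and x: "x \<in> \<Lambda>"
  shows "\<bar>a (real n) x / real n\<bar> \<le> 2 * C"
    "ereal (real_of_ereal (liminf (\<lambda>n. ereal (a (real n) x / real n)))) \<le> Liminf at_top (\<lambda>t. ereal (a t x / t))"
proof -
  have C: "0 \<le> C" using bd[OF order_refl x] by simp
  have bd1: "\<bar>a (real n) x / real n\<bar> \<le> 2 * C" for n
  proof (cases "n = 0")
    case False
    have "\<bar>a (real n) x\<bar> \<le> C * (real n + 1)" using bd[of "real n" x] x by simp
    also have "\<dots> \<le> C * (2 * real n)" using C False by (intro mult_left_mono) auto
    finally show ?thesis using False by (simp add: abs_divide field_simps)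
  qed (use C in simp)
  then show "\<bar>a (real n) x / real n\<bar> \<le> 2 * C" for n by blast
  define A where "A = real_of_ereal (liminf (\<lambda>n. ereal (a (real n) x / real n)))"
  show "ereal A \<le> Liminf at_top (\<lambda>t. ereal (a t x / t))"
  proof (rule ereal_le_epsilon2)
    fix e :: real assume e: "0 < e"
    have "\<forall>\<^sub>F n in sequentially. A - e/2 < a (real n) x / real n"
      unfolding A_def using e by (intro liminf_bounded_real(3)[OF bd1]) auto
    then obtain N where N: "\<And>n. N \<le> n \<Longrightarrow> A - e/2 < a (real n) x / real n"
      by (auto simp: eventually_sequentially)
    \<comment> \<open>Collects the rounding errors: \<open>2 * C\<close> from subadditivity, and the
      change of \<open>(A - e/2) * t\<close> when \<open>t\<close> moves by at most 1. From
      \<open>2 * B / e\<close> on they are at most \<open>e / 2 * t\<close>.\<close>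
    define B where "B = \<bar>A - e/2\<bar> + 2 * C"
    have "\<forall>\<^sub>F t in at_top. ereal (A - e) \<le> ereal (a t x / t)"
      using eventually_ge_at_top[of "max 1 (max (real N) (2 * B / e))"]
    proof eventually_elim
      case (elim t)
      then have t: "1 \<le> t" "real N \<le> t" "2 * B / e \<le> t" by auto
      define n where "n = nat \<lceil>t\<rceil>"
      have n: "t \<le> real n" "real n - t \<le> 1" "N \<le> n" "0 < n"
        using t by (auto simp: n_def ceiling_le_iff le_nat_iff of_nat_ceiling) linarith+
      have "a (real n) x \<le> a t x + a (real n - t) (\<psi> t x)"
        using sub[of t "real n - t" x] t n x by simp
      also have "a (real n - t) (\<psi> t x) \<le> C * (real n - t + 1)"
        using bd[of "real n - t" "\<psi> t x"] n maps[OF x] by simp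
      also have "\<dots> \<le> C * 2" using C n by (intro mult_left_mono) auto
      finally have "a (real n) x \<le> a t x + 2 * C" by simp
      moreover have "(A - e/2) * real n < a (real n) x" using N[OF n(3)] n(4) by (simp add: field_simps)
      moreover have "(A - e/2) * t - \<bar>A - e/2\<bar> \<le> (A - e/2) * real n"
      proof -
        have "\<bar>(A - e/2) * (real n - t)\<bar> \<le> \<bar>A - e/2\<bar> * 1"
          unfolding abs_mult using n by (intro mult_left_mono) auto
        then have "- \<bar>A - e/2\<bar> \<le> (A - e/2) * (real n - t)"
          using order_trans[OF abs_ge_minus_self] by (simp only: mult_1_right minus_le_iff)
        then show ?thesis by (simp add: right_diff_distrib)
      qed
      moreover have "B \<le> e / 2 * t" using t(3) e by (simp add: field_simps)
      ultimately have "(A - e) * t \<le> a t x" by (simp add: B_def algebra_simps)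
      then show ?case using t by (simp add: field_simps)
    qed
    then have "ereal (A - e) \<le> Liminf at_top (\<lambda>t. ereal (a t x / t))" by (rule Liminf_bounded)
    then have "ereal (A - e) + ereal e \<le> Liminf at_top (\<lambda>t. ereal (a t x / t)) + ereal e" by (rule add_right_mono)
    then show "ereal A \<le> Liminf at_top (\<lambda>t. ereal (a t x / t)) + ereal e" by simp
  qed
qed

theorem uniform_decay:
  fixes a b :: "real \<Rightarrow> 'a \<Rightarrow> real"
  assumes a_cont: "\<And>t. 0 \<le> t \<Longrightarrow> continuous_on \<Lambda> (a t)"
    and a_sub: "\<And>s t x. 0 \<le> s \<Longrightarrow> 0 \<le> t \<Longrightarrow> x \<in> \<Lambda> \<Longrightarrow> a (s + t) x \<le> a s x + a t (\<psi> s x)"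
    and a_bd: "\<And>t x. 0 \<le> t \<Longrightarrow> x \<in> \<Lambda> \<Longrightarrow> \<bar>a t x\<bar> \<le> C * (t + 1)" and a_0: "\<And>x. x \<in> \<Lambda> \<Longrightarrow> a 0 x = 0"
    and b_cont: "\<And>t. 0 \<le> t \<Longrightarrow> continuous_on \<Lambda> (b t)"
    and b_sub: "\<And>s t x. 0 \<le> s \<Longrightarrow> 0 \<le> t \<Longrightarrow> x \<in> \<Lambda> \<Longrightarrow> b (s + t) x \<le> b s x + b t (\<psi> s x)"
    and b_bd: "\<And>t x. 0 \<le> t \<Longrightarrow> x \<in> \<Lambda> \<Longrightarrow> \<bar>b t x\<bar> \<le> C * (t + 1)" and b_0: "\<And>x. x \<in> \<Lambda> \<Longrightarrow> b 0 x = 0"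
    and \<eta>: "\<eta> < 0"
    and Y: "\<And>\<mu>. prob_space \<mu> \<Longrightarrow> sets \<mu> = sets (restrict_space borel \<Lambda>) \<Longrightarrow>
      (\<And>t. \<psi> t \<in> measurable \<mu> \<mu>) \<Longrightarrow> (\<And>t. distr \<mu> \<mu> (\<psi> t) = \<mu>) \<Longrightarrow> AE x in \<mu>. x \<in> Y"
    and exponent: "\<And>x. x \<in> Y \<Longrightarrow> x \<in> \<Lambda> \<Longrightarrow>
      Liminf at_top (\<lambda>t. ereal (a t x / t)) + Liminf at_top (\<lambda>t. ereal (b t x / t)) < ereal \<eta>"
  shows "\<exists>c>0. \<exists>D. \<forall>x\<in>\<Lambda>. \<forall>t\<ge>0. a t x + b t x \<le> D - c * t"
proof -
  define \<phi> where "\<phi> t x = a t x + b t x" for t x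
  have \<phi>_cont: "continuous_on \<Lambda> (\<phi> t)" if "0 \<le> t" for t
    unfolding \<phi>_def by (intro continuous_intros a_cont b_cont that)
  have \<phi>_sub: "\<phi> (s + t) x \<le> \<phi> s x + \<phi> t (\<psi> s x)" if "0 \<le> s" "0 \<le> t" "x \<in> \<Lambda>" for s t x
    using a_sub[OF that] b_sub[OF that] by (simp add: \<phi>_def)
  have \<phi>_bd: "\<bar>\<phi> t x\<bar> \<le> (2 * C) * (t + 1)" if "0 \<le> t" "x \<in> \<Lambda>" for t x
    using a_bd[OF that] b_bd[OF that] by (simp add: \<phi>_def)
  \<comment> \<open>One time at which \<phi> is at most -1 on all of \<Lambda> suffices, as
    subadditivity iterates it. If there is none, the failing points, one for every length, provide
    the orbit segments for \<open>invariant_limit\<close>.\<close>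
  have "\<exists>N. \<forall>x\<in>\<Lambda>. \<phi> (real (Suc N)) x \<le> - 1"
  proof (rule ccontr)
    assume "\<not> ?thesis"
    then have "\<forall>n. \<exists>x. x \<in> \<Lambda> \<and> - 1 < \<phi> (real (Suc n)) x" by (auto simp: not_le)
    then obtain x where x: "\<And>n. x n \<in> \<Lambda>" "\<And>n. - 1 < \<phi> (real (Suc n)) (x n)" by metis
    have C: "0 \<le> C" using a_bd[OF order_refl x(1)[of 0]] by simp
    obtain r \<mu> where r: "strict_mono (r :: nat \<Rightarrow> nat)" and \<mu>: "prob_space \<mu>" "sets \<mu> = sets (restrict_space borel \<Lambda>)"
        "\<And>t. distr \<mu> \<mu> (\<psi> t) = \<mu>" "\<And>t. \<psi> t \<in> measurable \<mu> \<mu>"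
      and lim: "\<And>f :: 'a \<Rightarrow> real. continuous_on \<Lambda> f \<Longrightarrow>
        (\<lambda>n. average f (real (Suc (r n))) (x (r n))) \<longlonglongrightarrow> integral\<^sup>L \<mu> f"
      by (rule invariant_limit[of x, OF x(1)], rule that)
    interpret \<mu>: prob_space \<mu> by fact
    have sp: "space \<mu> = \<Lambda>" using prob_space_nonempty_restrict[OF \<mu>(1,2)] by simp
    have meas: "f \<in> borel_measurable \<mu>" if "continuous_on \<Lambda> f" for f :: "'a \<Rightarrow> real"
      by (subst measurable_cong_sets[OF \<mu>(2) refl]) (rule borel_measurable_continuous_on_restrict[OF that])
    \<comment> \<open>\<open>subadditive_average\<close> is read from right to left: \<phi> exceeds
      -1 over the whole long segment, which bounds the average of \<open>\<phi> T\<close> along it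
      below by \<open>- K\<close> divided by the length.\<close>
    have nonneg: "0 \<le> integral\<^sup>L \<mu> (\<phi> T)" if T: "0 < T" for T
    proof (rule LIMSEQ_le)
      show "(\<lambda>n. average (\<phi> T) (real (Suc (r n))) (x (r n))) \<longlonglongrightarrow> integral\<^sup>L \<mu> (\<phi> T)"
        using T by (intro lim \<phi>_cont) simp
      define K where "K = T + 6 * (2 * C) * T * (T + 1)"
      have "(\<lambda>n. - K / real (Suc n)) \<longlonglongrightarrow> 0" by real_asymp
      from LIMSEQ_subseq_LIMSEQ[OF this r] show "(\<lambda>n. - K / real (Suc (r n))) \<longlonglongrightarrow> 0" by (simp add: o_def)
      have "- K / real (Suc (r n)) \<le> average (\<phi> T) (real (Suc (r n))) (x (r n))" if n: "nat \<lceil>T\<rceil> \<le> n" for n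
      proof -
        have "T \<le> real n" using n by (simp add: nat_le_iff ceiling_le_iff)
        also have "\<dots> \<le> real (Suc (r n))" using strict_mono_imp_increasing[OF r, of n] by linarith
        finally have "T * \<phi> (real (Suc (r n))) (x (r n)) \<le>
            integral {0..real (Suc (r n))} (\<lambda>s. \<phi> T (\<psi> s (x (r n)))) + 6 * (2 * C) * T * (T + 1)"
          by (intro subadditive_average \<phi>_cont \<phi>_sub \<phi>_bd T x)
        moreover have "T * - 1 \<le> T * \<phi> (real (Suc (r n))) (x (r n))"
          using x(2)[of "r n"] T by (intro mult_left_mono) auto
        ultimately have "- K \<le> integral {0..real (Suc (r n))} (\<lambda>s. \<phi> T (\<psi> s (x (r n))))"
          by (simp add: K_def)
        then show ?thesis by (intro divide_right_mono) auto
      qed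
      then show "\<exists>N. \<forall>n\<ge>N. - K / real (Suc (r n)) \<le> average (\<phi> T) (real (Suc (r n))) (x (r n))" by blast
    qed
    define A where "A = (\<lambda>x. real_of_ereal (liminf (\<lambda>n. ereal (a (real n) x / real n))))"
    define B where "B = (\<lambda>x. real_of_ereal (liminf (\<lambda>n. ereal (b (real n) x / real n))))"
    \<comment> \<open>\<open>subadditive_liminf\<close> wants a bound proportional to
      \<open>n\<close>; from \<open>n = 1\<close> on the additive constant is absorbed by doubling,
      and at \<open>n = 0\<close> the cocycles vanish.\<close>
    have bd2: "\<bar>f (real n) y\<bar> \<le> (2 * C) * real n"
      if "\<And>t x. 0 \<le> t \<Longrightarrow> x \<in> \<Lambda> \<Longrightarrow> \<bar>f t x\<bar> \<le> C * (t + 1)" "\<And>x. x \<in> \<Lambda> \<Longrightarrow> f 0 x = 0" "y \<in> \<Lambda>"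
      for f :: "real \<Rightarrow> 'a \<Rightarrow> real" and n :: nat and y
    proof (cases "n = 0")
      case False
      have "\<bar>f (real n) y\<bar> \<le> C * (real n + 1)" using that(1)[of "real n" y] that(3) by simp
      also have "\<dots> \<le> C * (2 * real n)" using C False by (intro mult_left_mono) auto
      finally show ?thesis by simp
    qed (use that in simp)
    \<comment> \<open>Each of the two cocycles loses \<open>- \<eta> / 4\<close>, so the joint
      average is at most \<open>\<eta> - \<eta> / 2\<close>, which is still negative.\<close>
    have e: "0 < - \<eta> / 4" using \<eta> by simp
    have king: "\<forall>\<^sub>F L in sequentially. integral\<^sup>L \<mu> (f (real L)) \<le>
        real L * (integral\<^sup>L \<mu> (\<lambda>x. real_of_ereal (liminf (\<lambda>n. ereal (f (real n) x / real n)))) + - \<eta> / 4)"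
      if "\<And>t. 0 \<le> t \<Longrightarrow> continuous_on \<Lambda> (f t)"
        "\<And>s t x. 0 \<le> s \<Longrightarrow> 0 \<le> t \<Longrightarrow> x \<in> \<Lambda> \<Longrightarrow> f (s + t) x \<le> f s x + f t (\<psi> s x)"
        "\<And>t x. 0 \<le> t \<Longrightarrow> x \<in> \<Lambda> \<Longrightarrow> \<bar>f t x\<bar> \<le> C * (t + 1)" "\<And>x. x \<in> \<Lambda> \<Longrightarrow> f 0 x = 0"
      for f :: "real \<Rightarrow> 'a \<Rightarrow> real"
      by (rule \<mu>.subadditive_liminf[where T="\<lambda>n. \<psi> (real n)" and C="2 * C", OF \<mu>(4) \<mu>(3) _ _ _ _ _ _ e])
        (use that C in \<open>auto simp: sp zero add intro!: meas bd2\<close>)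
    have ka: "\<forall>\<^sub>F L in sequentially. integral\<^sup>L \<mu> (a (real L)) \<le> real L * (integral\<^sup>L \<mu> A + - \<eta> / 4)"
      unfolding A_def by (rule king) (use a_cont a_sub a_bd a_0 in auto)
    have kb: "\<forall>\<^sub>F L in sequentially. integral\<^sup>L \<mu> (b (real L)) \<le> real L * (integral\<^sup>L \<mu> B + - \<eta> / 4)"
      unfolding B_def by (rule king) (use b_cont b_sub b_bd b_0 in auto)
    have "\<forall>\<^sub>F L in sequentially. 0 < L \<and> integral\<^sup>L \<mu> (a (real L)) \<le> real L * (integral\<^sup>L \<mu> A + - \<eta> / 4)
        \<and> integral\<^sup>L \<mu> (b (real L)) \<le> real L * (integral\<^sup>L \<mu> B + - \<eta> / 4)"
      by (intro eventually_conj eventually_gt_at_top ka kb)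
    then obtain L :: nat where L: "0 < L" "integral\<^sup>L \<mu> (a (real L)) \<le> real L * (integral\<^sup>L \<mu> A + - \<eta> / 4)"
        "integral\<^sup>L \<mu> (b (real L)) \<le> real L * (integral\<^sup>L \<mu> B + - \<eta> / 4)"
      by (auto dest!: eventually_happens)
    have intc: "integrable \<mu> f" if "f \<in> borel_measurable \<mu>" "\<And>y. y \<in> \<Lambda> \<Longrightarrow> \<bar>f y\<bar> \<le> K" for f :: "'a \<Rightarrow> real" and K
      by (rule \<mu>.integrable_const_bound[where B=K]) (use that in \<open>auto simp: sp\<close>)
    have [measurable]: "a (real n) \<in> borel_measurable \<mu>" "b (real n) \<in> borel_measurable \<mu>" for n
      by (intro meas a_cont b_cont; simp)+
    have "A \<in> borel_measurable \<mu>" "B \<in> borel_measurable \<mu>"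
      unfolding A_def B_def by measurable
    moreover have "\<bar>A y\<bar> \<le> 2 * C" "\<bar>B y\<bar> \<le> 2 * C" if "y \<in> \<Lambda>" for y
      unfolding A_def B_def
      using liminf_bounded_real(2)[OF liminf_integer_le_Liminf(1)[OF a_sub a_bd that]]
        liminf_bounded_real(2)[OF liminf_integer_le_Liminf(1)[OF b_sub b_bd that]] by auto
    ultimately have int: "integrable \<mu> A" "integrable \<mu> B" by (auto intro: intc)
    have intL: "integrable \<mu> (a (real L))" "integrable \<mu> (b (real L))"
      using bd2[OF a_bd a_0] bd2[OF b_bd b_0] by (auto intro!: intc)
    have "AE y in \<mu>. A y + B y \<le> \<eta>"
    proof -
      have "AE y in \<mu>. y \<in> Y" by (rule Y[OF \<mu>(1,2,4,3)])
      then show ?thesis using AE_space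
      proof eventually_elim
        case (elim y)
        then have y: "y \<in> \<Lambda>" by (simp add: sp)
        have "ereal (A y) + ereal (B y) \<le> Liminf at_top (\<lambda>t. ereal (a t y / t)) + Liminf at_top (\<lambda>t. ereal (b t y / t))"
          unfolding A_def B_def
          by (intro add_mono liminf_integer_le_Liminf(2)[OF a_sub a_bd y] liminf_integer_le_Liminf(2)[OF b_sub b_bd y])
        from le_less_trans[OF this exponent[OF elim(1) y]] show ?case by simp
      qed
    qed
    then have "integral\<^sup>L \<mu> (\<lambda>y. A y + B y) \<le> integral\<^sup>L \<mu> (\<lambda>y. \<eta>)"
      by (intro integral_mono_AE Bochner_Integration.integrable_add int) auto
    then have AB: "integral\<^sup>L \<mu> A + integral\<^sup>L \<mu> B \<le> \<eta>"
      using int by (simp add: \<mu>.prob_space)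
    have "0 \<le> integral\<^sup>L \<mu> (\<phi> (real L))" using L(1) by (intro nonneg) simp
    also have "\<dots> = integral\<^sup>L \<mu> (a (real L)) + integral\<^sup>L \<mu> (b (real L))"
      unfolding \<phi>_def by (rule Bochner_Integration.integral_add[OF intL])
    also have "\<dots> \<le> real L * (integral\<^sup>L \<mu> A + integral\<^sup>L \<mu> B + - \<eta> / 2)"
      using L(2,3) by (simp add: algebra_simps)
    also have "\<dots> \<le> real L * (\<eta> / 2)"
      using AB by (intro mult_left_mono) auto
    also have "\<dots> < 0" using L(1) \<eta> by (simp add: mult_pos_neg)
    finally show False by simp
  qed
  then obtain N where N: "\<And>x. x \<in> \<Lambda> \<Longrightarrow> \<phi> (real (Suc N)) x \<le> - 1" by blast
  define n where "n = real (Suc N)"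
  have n: "0 < n" by (simp add: n_def)
  have decay: "\<phi> (real k * n) x \<le> 2 * C - real k" if x: "x \<in> \<Lambda>" for k x
  proof (induction k)
    case 0
    then show ?case using \<phi>_bd[OF order_refl x] by simp
  next
    case (Suc k)
    have "\<phi> (real k * n + n) x \<le> \<phi> (real k * n) x + \<phi> n (\<psi> (real k * n) x)"
      using n by (intro \<phi>_sub x) auto
    moreover have "\<phi> n (\<psi> (real k * n) x) \<le> - 1"
      unfolding n_def by (rule N[OF maps[OF x]])
    ultimately show ?case using Suc by (simp add: algebra_simps)
  qed
  \<comment> \<open>With \<open>k\<close> the number of full periods \<open>n\<close> in
    \<open>t\<close>, \<open>decay\<close> contributes \<open>2 * C - k\<close>; the 1 pays for
    \<open>k > t / n - 1\<close> and the last constant for the incomplete period.\<close>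
  have "\<phi> t x \<le> (2 * C + 1 + 2 * C * (n + 1)) - 1 / n * t" if x: "x \<in> \<Lambda>" and t: "0 \<le> t" for t x
  proof -
    have C: "0 \<le> C" using a_bd[OF order_refl x] by simp
    define k where "k = nat \<lfloor>t / n\<rfloor>"
    have k: "real k \<le> t / n" "t / n < real k + 1" using t n by (auto simp: k_def)
    then have k': "real k * n \<le> t" "t < real k * n + n" using n by (auto simp: field_simps)
    have "\<phi> t x \<le> \<phi> (real k * n) x + \<phi> (t - real k * n) (\<psi> (real k * n) x)"
      using \<phi>_sub[of "real k * n" "t - real k * n" x] k' n x by simp
    also have "\<phi> (real k * n) x \<le> 2 * C - real k" by (rule decay[OF x])
    also have "\<phi> (t - real k * n) (\<psi> (real k * n) x) \<le> 2 * C * (t - real k * n + 1)"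
      using \<phi>_bd[of "t - real k * n" "\<psi> (real k * n) x"] k' maps[OF x] by simp
    also have "\<dots> \<le> 2 * C * (n + 1)" using k' C by (intro mult_left_mono) auto
    finally show ?thesis using k by simp
  qed
  then show ?thesis using n
    by (intro exI[of _ "1/n"] conjI exI[of _ "2 * C + 1 + 2 * C * (n + 1)"]) (auto simp: \<phi>_def)
qed

end

section \<open>Derivatives in charts\<close>

lemma inner_normal_Basis: "(inner_normal :: 'e::euclidean_space) \<in> Basis"
  unfolding inner_normal_def by (rule someI_ex) (use nonempty_Basis in blast)

text \<open>Because \<open>inner_normal\<close> belongs to \<open>Basis\<close>, adding a positive
  multiple of any basis vector never leaves the half-space. So derivatives within it are determined
  at boundary points too, and the choice hidden in \<open>frechet_derivative\<close> is
  unambiguous.\<close>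

lemma half_space_derivative_unique:
  fixes f :: "'e::euclidean_space \<Rightarrow> 'b::real_normed_vector"
  assumes "(f has_derivative f') (at z within half_space)" "(f has_derivative f'') (at z within half_space)"
    and z: "z \<in> half_space"
  shows "f' = f''"
proof (rule frechet_derivative_unique_within[OF assms(1,2)])
  fix i :: 'e and e :: real assume i: "i \<in> Basis" and e: "0 < e"
  have "0 \<le> i \<bullet> inner_normal" using inner_Basis[OF i inner_normal_Basis] by simp
  then have "z + (e/2) *\<^sub>R i \<in> half_space"
    using z e by (auto simp: half_space_def inner_add_left)
  then show "\<exists>d. 0 < \<bar>d\<bar> \<and> \<bar>d\<bar> < e \<and> z + d *\<^sub>R i \<in> half_space"
    using e by (intro exI[of _ "e/2"]) auto
qed

text \<open>Chart images and overlaps are relatively open, so all derivatives can be taken within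
  the one set \<open>half_space\<close>, whatever the chart.\<close>

lemma at_within_openin_half_space:
  assumes "openin (top_of_set half_space) S" "z \<in> S"
  shows "at z within S = at z within half_space"
proof -
  obtain W where W: "open W" "S = half_space \<inter> W" using assms(1) by (auto simp: openin_open)
  show ?thesis
    by (rule at_within_nhd[OF _ W(1)]) (use assms W in auto)
qed

lemma Ck_on_tendsto_derivative:
  assumes "Ck_on 1 U g" "open U" "z \<in> U"
  shows "((\<lambda>z. frechet_derivative g (at z) v) \<longlongrightarrow> frechet_derivative g (at z) v) (nhds z)"
proof -
  have "isCont (\<lambda>z. frechet_derivative g (at z) v) z"
    using assms continuous_on_eq_continuous_at[of U "\<lambda>z. frechet_derivative g (at z) v"] by simp
  then show ?thesis
    unfolding isCont_def
    by (rule tendsto_at_iff_tendsto_nhds[of "\<lambda>z. frechet_derivative g (at z) v" z, THEN iffD1])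
qed

text \<open>Smoothness enters to first order only. The bound \<open>1 \<le> k\<close> covers both
  the class \<infinity> of atlas and metric and the class 1 of the field.\<close>

lemma diff_class_onD:
  fixes f :: "'a::euclidean_space \<Rightarrow> 'b::euclidean_space"
  assumes "diff_class_on k S f" "1 \<le> k" "z \<in> S"
  obtains U g where "open U" "z \<in> U" "Ck_on 1 U g" "\<And>y. y \<in> S \<Longrightarrow> y \<in> U \<Longrightarrow> g y = f y"
    "\<And>y. y \<in> S \<Longrightarrow> y \<in> U \<Longrightarrow> (f has_derivative frechet_derivative g (at y)) (at y within S)"
proof -
  have "\<exists>U g. open U \<and> z \<in> U \<and> (\<forall>j::nat. enat j \<le> k \<longrightarrow> Ck_on j U g) \<and> (\<forall>y\<in>S \<inter> U. g y = f y)"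
    by (rule assms(1)[unfolded diff_class_on_def, THEN bspec, OF assms(3)])
  then show ?thesis
  proof (elim exE conjE)
    fix U :: "'a set" and g :: "'a \<Rightarrow> 'b"
    assume U: "open U" "z \<in> U" "\<forall>j::nat. enat j \<le> k \<longrightarrow> Ck_on j U g" "\<forall>y\<in>S \<inter> U. g y = f y"
    have "enat 1 \<le> k" using assms(2) by (simp only: one_enat_def)
    with spec[OF U(3), of 1] have C1: "Ck_on 1 U g" by (rule mp)
    show ?thesis
    proof (rule that[OF U(1,2) C1])
      fix y assume y: "y \<in> S" "y \<in> U"
      show "g y = f y" using U(4) y by simp
      have "g differentiable at y"
        using C1 y(2) unfolding One_nat_def Ck_on.simps(2) by (elim conjE bspec)
      from has_derivative_at_withinI[OF frechet_derivative_works[THEN iffD1, OF this]]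
      have d: "(g has_derivative frechet_derivative g (at y)) (at y within S)" .
      obtain e where e: "0 < e" "ball y e \<subseteq> U" by (rule openE[OF U(1) y(2)])
      show "(f has_derivative frechet_derivative g (at y)) (at y within S)"
      proof (rule has_derivative_transform_within[OF d e(1) y(1)])
        fix x' assume "x' \<in> S" "dist x' y < e"
        then have "x' \<in> S \<inter> U" using e(2) by (auto simp: dist_commute)
        with U(4) show "g x' = f x'" by (rule bspec)
      qed
    qed
  qed
qed

lemma diff_class_on_imp_continuous_on:
  fixes f :: "'a::euclidean_space \<Rightarrow> 'b::euclidean_space"
  assumes "diff_class_on k S f" "1 \<le> k"
  shows "continuous_on S f"
  unfolding continuous_on_eq_continuous_within
proof
  fix z assume "z \<in> S"
  show "continuous (at z within S) f"
  proof (rule diff_class_onD[OF assms \<open>z \<in> S\<close>])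
    fix U g assume "z \<in> U" "\<And>y. y \<in> S \<Longrightarrow> y \<in> U \<Longrightarrow> (f has_derivative frechet_derivative g (at y)) (at y within S)"
    then show ?thesis using has_derivative_continuous \<open>z \<in> S\<close> by blast
  qed
qed

text \<open>A linear map is a finite sum over its values on \<open>Basis\<close>, so convergence
  there gives convergence at moving vectors as well.\<close>

lemma tendsto_linear_family:
  fixes A :: "'k \<Rightarrow> 'e::euclidean_space \<Rightarrow> 'b::real_normed_vector"
  assumes "\<forall>\<^sub>F k in F. linear (A k)" "linear A0" "\<And>b. b \<in> Basis \<Longrightarrow> ((\<lambda>k. A k b) \<longlongrightarrow> A0 b) F" "(v \<longlongrightarrow> w) F"
  shows "((\<lambda>k. A k (v k)) \<longlongrightarrow> A0 w) F"
proof -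
  have rep: "L u = (\<Sum>b\<in>Basis. (u \<bullet> b) *\<^sub>R L b)" if "linear L" for L :: "'e \<Rightarrow> 'b" and u
    using linear_sum[OF that, of "\<lambda>b. (u \<bullet> b) *\<^sub>R b" Basis] linear_scale[OF that]
    by (simp add: euclidean_representation)
  have "((\<lambda>k. \<Sum>b\<in>Basis. (v k \<bullet> b) *\<^sub>R A k b) \<longlongrightarrow> (\<Sum>b\<in>Basis. (w \<bullet> b) *\<^sub>R A0 b)) F"
    by (intro tendsto_intros assms)
  then have "((\<lambda>k. \<Sum>b\<in>Basis. (v k \<bullet> b) *\<^sub>R A k b) \<longlongrightarrow> A0 w) F"
    by (simp add: rep[OF assms(2), of w])
  then show ?thesis
    by (rule Lim_transform_eventually) (use assms(1) in \<open>eventually_elim, simp add: rep[symmetric]\<close>)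
qed

section \<open>Charts, coordinate changes and the metric\<close>

locale riemannian =
  fixes M :: "('m::{t2_space,second_countable_topology}, 'e::euclidean_space) manifold_data"
  assumes riemannian: "riemannian_manifold M"
begin

abbreviation "cdom \<equiv> chart_dom M"
abbreviation "ch \<equiv> chart_map M"
abbreviation "ich \<equiv> chart_inv M"
abbreviation "cc \<equiv> coord_change M"
abbreviation "H \<equiv> half_space :: 'e set"

lemma smooth: "smooth_manifold M"
  using riemannian unfolding riemannian_manifold_def by (rule conjunct1)

lemma open_dom: "open (cdom p)" and mem_dom [simp]: "p \<in> cdom p"
  and openin_image: "openin (top_of_set H) (chart_image M p)"
  and homeo: "homeomorphism (cdom p) (chart_image M p) (ch p) (ich p)"
  using smooth unfolding smooth_manifold_def by blast+

lemma ich_ch [simp]: "y \<in> cdom p \<Longrightarrow> ich p (ch p y) = y"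
  by (rule homeomorphism_apply1[OF homeo])

lemma ch_ich [simp]: "z \<in> chart_image M p \<Longrightarrow> ch p (ich p z) = z"
  by (rule homeomorphism_apply2[OF homeo])

lemma ch_mem [simp]: "y \<in> cdom p \<Longrightarrow> ch p y \<in> chart_image M p"
  by (simp add: chart_image_def)

lemma ich_mem [simp]: "z \<in> chart_image M p \<Longrightarrow> ich p z \<in> cdom p"
  using homeomorphism_image2[OF homeo[of p]] by blast

lemma image_sub_half_space: "chart_image M p \<subseteq> H"
  using openin_image[of p] openin_imp_subset by blast

lemma ch_mem_half_space [simp]: "y \<in> cdom p \<Longrightarrow> ch p y \<in> H"
  using ch_mem image_sub_half_space by blast

lemma isCont_ch: "y \<in> cdom p \<Longrightarrow> isCont (ch p) y"
  using homeomorphism_cont1[OF homeo] continuous_on_eq_continuous_at[OF open_dom] by blast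

lemma tendsto_ich:
  assumes "x \<in> cdom p"
  shows "(ich p \<longlongrightarrow> x) (at (ch p x) within H)"
proof -
  have "continuous_on (chart_image M p) (ich p)" by (rule homeomorphism_cont2[OF homeo])
  then have "(ich p \<longlongrightarrow> ich p (ch p x)) (at (ch p x) within chart_image M p)"
    using ch_mem[OF assms] unfolding continuous_on_def by blast
  then show ?thesis
    using assms at_within_openin_half_space[OF openin_image ch_mem[OF assms]] by simp
qed

lemma eventually_chart_image:
  assumes "x \<in> cdom p"
  shows "\<forall>\<^sub>F z in at (ch p x) within H. z \<in> chart_image M p"
proof -
  have "\<forall>\<^sub>F z in at (ch p x) within chart_image M p. z \<in> chart_image M p"
    by (simp add: eventually_at_filter)
  then show ?thesis
    using at_within_openin_half_space[OF openin_image ch_mem[OF assms]] by simp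
qed

lemma eventually_nhds_imp_chart:
  assumes "x \<in> cdom p" "\<forall>\<^sub>F y in nhds x. P y"
  shows "\<forall>\<^sub>F z in at (ch p x) within H. P (ich p z)"
  using tendsto_ich[OF assms(1)] assms(2) by (simp add: filterlim_iff)

lemma openin_overlap: "openin (top_of_set H) (ch p ` (cdom p \<inter> U))" if "open U"
proof -
  have "openin (top_of_set (chart_image M p)) (ch p ` (cdom p \<inter> U))"
    by (rule homeomorphism_imp_open_map[OF homeo]) (use that in \<open>auto simp: openin_open\<close>)
  then show ?thesis using openin_image openin_trans by blast
qed

text \<open>Continuity of \<open>h\<close> as a map of the manifold is included so that values near
  \<open>x\<close> stay in the domain of the chart \<open>q\<close>; the chain rule
  \<open>mderiv_comp\<close> depends on this.\<close>

definition mderiv :: "'m \<Rightarrow> 'm \<Rightarrow> ('m \<Rightarrow> 'm) \<Rightarrow> ('e \<Rightarrow> 'e) \<Rightarrow> 'm \<Rightarrow> bool" where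
  "mderiv p q h D x \<longleftrightarrow> x \<in> cdom p \<and> h x \<in> cdom q \<and> isCont h x \<and>
     ((\<lambda>z. ch q (h (ich p z))) has_derivative D) (at (ch p x) within H)"

lemma mderiv_linear: "mderiv p q h D x \<Longrightarrow> linear D"
  by (auto simp: mderiv_def has_derivative_def intro: bounded_linear.linear)

lemma mderiv_unique: "mderiv p q h D x \<Longrightarrow> mderiv p q h D' x \<Longrightarrow> D = D'"
  by (auto simp: mderiv_def intro: half_space_derivative_unique)

lemma mderiv_comp:
  assumes h: "mderiv p q h D x" and g: "mderiv q r g D' (h x)"
  shows "mderiv p r (\<lambda>y. g (h y)) (\<lambda>v. D' (D v)) x"
proof -
  have x: "x \<in> cdom p" "h x \<in> cdom q" "isCont h x"
    "((\<lambda>z. ch q (h (ich p z))) has_derivative D) (at (ch p x) within H)"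
    using h by (auto simp: mderiv_def)
  have y: "g (h x) \<in> cdom r" "isCont g (h x)"
    "((\<lambda>z. ch r (g (ich q z))) has_derivative D') (at (ch q (h x)) within H)"
    using g by (auto simp: mderiv_def)
  have "\<forall>\<^sub>F y in nhds x. h y \<in> cdom q"
    using x(3)[unfolded isCont_def, THEN tendsto_at_iff_tendsto_nhds[THEN iffD1], THEN topological_tendstoD, OF open_dom x(2)] .
  from eventually_nhds_imp_chart[OF x(1) this]
  have "\<forall>\<^sub>F z in at (ch p x) within H. h (ich p z) \<in> cdom q" .
  then obtain d where d: "0 < d" "\<And>z. z \<in> H \<Longrightarrow> z \<noteq> ch p x \<Longrightarrow> dist z (ch p x) < d \<Longrightarrow> h (ich p z) \<in> cdom q"
    unfolding eventually_at by blast
  have d': "h (ich p z) \<in> cdom q" if "z \<in> H" "dist z (ch p x) < d" for z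
    using d(2)[OF that(1) _ that(2)] x by (cases "z = ch p x") auto
  let ?S = "H \<inter> ball (ch p x) d"
  have at: "at (ch p x) within ?S = at (ch p x) within H"
    by (rule at_within_nhd[of _ "ball (ch p x) d"]) (use d(1) in auto)
  have "((\<lambda>z. ch r (g (ich q z))) \<circ> (\<lambda>z. ch q (h (ich p z))) has_derivative D' \<circ> D) (at (ch p x) within ?S)"
  proof (rule diff_chain_within)
    show "((\<lambda>z. ch q (h (ich p z))) has_derivative D) (at (ch p x) within ?S)" using x(4) at by simp
    show "((\<lambda>z. ch r (g (ich q z))) has_derivative D') (at (ch q (h (ich p (ch p x)))) within (\<lambda>z. ch q (h (ich p z))) ` ?S)"
    proof (rule has_derivative_subset)
      show "((\<lambda>z. ch r (g (ich q z))) has_derivative D') (at (ch q (h (ich p (ch p x)))) within H)"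
        using y(3) x(1) by simp
      show "(\<lambda>z. ch q (h (ich p z))) ` ?S \<subseteq> H"
        using d' by (auto simp: dist_commute)
    qed
  qed
  then have "((\<lambda>z. ch r (g (h (ich p z)))) has_derivative D' \<circ> D) (at (ch p x) within ?S)"
    by (rule has_derivative_transform[rotated 2]) (use d' d(1) x(1) in \<open>auto simp: dist_commute\<close>)
  moreover have "isCont (\<lambda>y. g (h y)) x" using isCont_o2[OF x(3) y(2)] .
  ultimately show ?thesis using x(1) y(1) at by (simp add: mderiv_def o_def)
qed

lemma mderiv_cong:
  assumes h: "mderiv p q h D x" and eq: "\<forall>\<^sub>F y in nhds x. h y = g y"
  shows "mderiv p q g D x"
proof -
  have x: "x \<in> cdom p" "h x \<in> cdom q" "isCont h x"
    "((\<lambda>z. ch q (h (ich p z))) has_derivative D) (at (ch p x) within H)"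
    using h by (auto simp: mderiv_def)
  have gx: "g x = h x" using eventually_nhds_x_imp_x[OF eq] by simp
  have "isCont g x" using x(3) isCont_cong[OF eq] by simp
  moreover have "((\<lambda>z. ch q (g (ich p z))) has_derivative D) (at (ch p x) within H)"
  proof (rule has_derivative_transform_eventually[OF x(4)])
    show "\<forall>\<^sub>F z in at (ch p x) within H. ch q (h (ich p z)) = ch q (g (ich p z))"
      using eventually_nhds_imp_chart[OF x(1) eq] by eventually_elim simp
  qed (use x gx in auto)
  ultimately show ?thesis using x gx by (simp add: mderiv_def)
qed

text \<open>Near a point of the overlap the transition map is the restriction of a C1 map
  \<open>g\<close> on an open set. Uniqueness within the half-space identifies its derivative with
  \<open>coord_change\<close>, which thereby inherits continuity in the base point.\<close>

lemma coord_change_eq_D: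
  assumes "x \<in> cdom p" "x \<in> cdom q"
  obtains U g where "open U" "ch p x \<in> U" "Ck_on 1 U g"
    "\<And>y. y \<in> cdom p \<Longrightarrow> y \<in> cdom q \<Longrightarrow> ch p y \<in> U \<Longrightarrow>
      cc p q y = frechet_derivative g (at (ch p y)) \<and> mderiv p q (\<lambda>y. y) (cc p q y) y"
proof -
  let ?S = "ch p ` (cdom p \<inter> cdom q)" and ?f = "\<lambda>z. ch q (ich p z)"
  have S: "openin (top_of_set H) ?S" by (rule openin_overlap[OF open_dom])
  have "diff_class_on \<infinity> ?S ?f" 
    by (rule smooth[unfolded smooth_manifold_def, THEN conjunct2, THEN spec, THEN spec])
  then show ?thesis
  proof (rule diff_class_onD)
    show "1 \<le> (\<infinity>::enat)" "ch p x \<in> ?S" using assms by auto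
    fix U g assume U: "open U" "ch p x \<in> U" "Ck_on 1 U g"
      "\<And>z. z \<in> ?S \<Longrightarrow> z \<in> U \<Longrightarrow> (?f has_derivative frechet_derivative g (at z)) (at z within ?S)"
    show ?thesis
    proof (rule that[OF U(1-3)])
      fix y assume y: "y \<in> cdom p" "y \<in> cdom q" "ch p y \<in> U"
      then have S': "ch p y \<in> ?S" by blast
      have at: "at (ch p y) within ?S = at (ch p y) within H"
        by (rule at_within_openin_half_space[OF S S'])
      have d: "(?f has_derivative frechet_derivative g (at (ch p y))) (at (ch p y) within H)"
        using U(4)[OF S' y(3)] unfolding at .
      have "\<exists>D. (?f has_derivative D) (at (ch p y) within H)"
        by (rule exI[where x="frechet_derivative g (at (ch p y))"]) (rule d)
      then have d': "(?f has_derivative cc p q y) (at (ch p y) within H)"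
        unfolding coord_change_def at frechet_derivative_def by (rule someI_ex)
      have "cc p q y = frechet_derivative g (at (ch p y))"
        by (rule half_space_derivative_unique[OF d' d]) (use y in simp)
      then show "cc p q y = frechet_derivative g (at (ch p y)) \<and> mderiv p q (\<lambda>y. y) (cc p q y) y"
        using y d' by (simp add: mderiv_def)
    qed
  qed
qed

lemma mderiv_id: "x \<in> cdom p \<Longrightarrow> x \<in> cdom q \<Longrightarrow> mderiv p q (\<lambda>y. y) (cc p q x) x"
  by (rule coord_change_eq_D[of x p q]) blast+

lemma linear_cc: "x \<in> cdom p \<Longrightarrow> x \<in> cdom q \<Longrightarrow> linear (cc p q x)"
  using mderiv_id mderiv_linear by blast

lemma cc_cc: "x \<in> cdom p \<Longrightarrow> x \<in> cdom q \<Longrightarrow> x \<in> cdom r \<Longrightarrow> cc q r x (cc p q x v) = cc p r x v"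
  using fun_cong[OF mderiv_unique[OF mderiv_comp[OF mderiv_id mderiv_id] mderiv_id, of x p q r]] by blast

lemma cc_self [simp]: "x \<in> cdom p \<Longrightarrow> cc p p x = (\<lambda>v. v)"
proof -
  assume x: "x \<in> cdom p"
  have "((\<lambda>z. ch p (ich p z)) has_derivative (\<lambda>v. v)) (at (ch p x) within H)"
  proof (rule has_derivative_transform_eventually[of "\<lambda>z. z"])
    show "\<forall>\<^sub>F z in at (ch p x) within H. z = ch p (ich p z)"
      using eventually_chart_image[OF x] by eventually_elim simp
  qed (use x in \<open>auto intro!: derivative_intros\<close>)
  then have "mderiv p p (\<lambda>y. y) (\<lambda>v. v) x" using x by (simp add: mderiv_def)
  then show ?thesis using mderiv_unique mderiv_id x by blast
qed

lemma eventually_mem_dom: "(y \<longlongrightarrow> x) F \<Longrightarrow> x \<in> cdom p \<Longrightarrow> \<forall>\<^sub>F k in F. y k \<in> cdom p"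
  using open_dom[of p] by (simp add: tendsto_def)

lemma tendsto_cc:
  assumes y: "(y \<longlongrightarrow> x) F" and x: "x \<in> cdom p" "x \<in> cdom q" and v: "(v \<longlongrightarrow> w) F"
  shows "((\<lambda>k. cc p q (y k) (v k)) \<longlongrightarrow> cc p q x w) F"
proof -
  obtain U g where U: "open U" "ch p x \<in> U" "Ck_on 1 U g"
    "\<And>y. y \<in> cdom p \<Longrightarrow> y \<in> cdom q \<Longrightarrow> ch p y \<in> U \<Longrightarrow> cc p q y = frechet_derivative g (at (ch p y))"
    by (rule coord_change_eq_D[OF x]) blast
  have chy: "((\<lambda>k. ch p (y k)) \<longlongrightarrow> ch p x) F"
    using isCont_tendsto_compose[OF isCont_ch[OF x(1)] y] .
  have ev: "\<forall>\<^sub>F k in F. y k \<in> cdom p \<and> y k \<in> cdom q \<and> ch p (y k) \<in> U"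
    using eventually_mem_dom[OF y x(1)] eventually_mem_dom[OF y x(2)] topological_tendstoD[OF chy U(1,2)]
    by eventually_elim blast
  show ?thesis
  proof (rule tendsto_linear_family[OF _ linear_cc[OF x] _ v])
    show "\<forall>\<^sub>F k in F. linear (cc p q (y k))" using ev by eventually_elim (simp add: linear_cc)
    fix b :: 'e
    have "((\<lambda>k. frechet_derivative g (at (ch p (y k))) b) \<longlongrightarrow> frechet_derivative g (at (ch p x)) b) F"
      using filterlim_compose[OF Ck_on_tendsto_derivative[OF U(3,1,2)] chy] .
    then show "((\<lambda>k. cc p q (y k) b) \<longlongrightarrow> cc p q x b) F"
      unfolding U(4)[OF x U(2)]
      by (rule Lim_transform_eventually) (use ev in \<open>eventually_elim, simp add: U(4)\<close>)
  qed
qed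

text \<open>Convergence in the tangent bundle. The vector \<open>v k\<close> is given in the chart
  of its own base point, which jumps with \<open>k\<close>, so it is first moved to the chart at the
  limit \<open>x\<close>.\<close>

definition tb_lim :: "('k \<Rightarrow> 'm) \<Rightarrow> ('k \<Rightarrow> 'e) \<Rightarrow> 'm \<Rightarrow> 'e \<Rightarrow> 'k filter \<Rightarrow> bool" where
  "tb_lim y v x w F \<longleftrightarrow> (y \<longlongrightarrow> x) F \<and> ((\<lambda>k. cc (y k) x (y k) (v k)) \<longlongrightarrow> w) F"

lemma tb_lim_chart:
  assumes "x \<in> cdom p"
  shows "tb_lim y v x w F \<longleftrightarrow> (y \<longlongrightarrow> x) F \<and> ((\<lambda>k. cc (y k) p (y k) (v k)) \<longlongrightarrow> cc x p x w) F"
proof safe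
  assume y: "tb_lim y v x w F"
  then have yx: "(y \<longlongrightarrow> x) F" by (simp add: tb_lim_def)
  then show "(y \<longlongrightarrow> x) F" .
  have "((\<lambda>k. cc x p (y k) (cc (y k) x (y k) (v k))) \<longlongrightarrow> cc x p x w) F"
    using y by (intro tendsto_cc assms mem_dom) (auto simp: tb_lim_def)
  then show "((\<lambda>k. cc (y k) p (y k) (v k)) \<longlongrightarrow> cc x p x w) F"
    by (rule Lim_transform_eventually)
      (use eventually_mem_dom[OF yx assms] eventually_mem_dom[OF yx mem_dom] in \<open>eventually_elim, simp add: cc_cc\<close>)
next
  assume yx: "(y \<longlongrightarrow> x) F" and v: "((\<lambda>k. cc (y k) p (y k) (v k)) \<longlongrightarrow> cc x p x w) F"
  have "((\<lambda>k. cc p x (y k) (cc (y k) p (y k) (v k))) \<longlongrightarrow> cc p x x (cc x p x w)) F"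
    by (intro tendsto_cc assms mem_dom yx v)
  then have "((\<lambda>k. cc (y k) x (y k) (v k)) \<longlongrightarrow> cc p x x (cc x p x w)) F"
    by (rule Lim_transform_eventually)
      (use eventually_mem_dom[OF yx assms] eventually_mem_dom[OF yx mem_dom] in \<open>eventually_elim, simp add: cc_cc\<close>)
  then show "tb_lim y v x w F" using yx assms by (simp add: tb_lim_def cc_cc)
qed

lemma rmetric_facts: "bilinear (rmetric M x)" "rmetric M x u v = rmetric M x v u" "v \<noteq> 0 \<Longrightarrow> 0 < rmetric M x v v"
  using riemannian[unfolded riemannian_manifold_def, THEN conjunct2, THEN conjunct1, THEN spec, of x] by blast+

lemma tendsto_rmetric:
  assumes y: "(y \<longlongrightarrow> x) F"
  shows "((\<lambda>k. rmetric M (y k) (cc x (y k) (y k) u) (cc x (y k) (y k) v)) \<longlongrightarrow> rmetric M x u v) F"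
proof -
  let ?f = "\<lambda>z. let x' = ich x z in rmetric M x' (cc x x' x' u) (cc x x' x' v)"
  have "continuous_on (chart_image M x) ?f"
  proof (rule diff_class_on_imp_continuous_on)
    show "diff_class_on \<infinity> (chart_image M x) ?f"
      by (rule riemannian[unfolded riemannian_manifold_def, THEN conjunct2, THEN conjunct2, THEN spec, THEN spec, THEN spec])
  qed simp
  then have "continuous_on (cdom x) (\<lambda>y. ?f (ch x y))"
    by (rule continuous_on_compose2[OF _ homeomorphism_cont1[OF homeo]]) auto
  then have "isCont (\<lambda>y. ?f (ch x y)) x"
    using continuous_on_eq_continuous_at[OF open_dom] mem_dom by blast
  from isCont_tendsto_compose[OF this y]
  have "((\<lambda>k. ?f (ch x (y k))) \<longlongrightarrow> rmetric M x u v) F" by (simp add: Let_def)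
  then show ?thesis
    by (rule Lim_transform_eventually)
      (use eventually_mem_dom[OF y mem_dom] in \<open>eventually_elim, simp add: Let_def\<close>)
qed

lemma tangent_norm_tendsto:
  assumes "tb_lim y v x w F"
  shows "((\<lambda>k. tangent_norm M (y k) (v k)) \<longlongrightarrow> tangent_norm M x w) F"
proof -
  have y: "(y \<longlongrightarrow> x) F" and v: "((\<lambda>k. cc (y k) x (y k) (v k)) \<longlongrightarrow> w) F"
    using assms by (auto simp: tb_lim_def)
  define u where "u = (\<lambda>k. cc (y k) x (y k) (v k))"
  define B where "B k a b = rmetric M (y k) (cc x (y k) (y k) a) (cc x (y k) (y k) b)" for k a b
  have cdom: "\<forall>\<^sub>F k in F. y k \<in> cdom x" using eventually_mem_dom[OF y mem_dom] .
  have lin: "linear (\<lambda>a. B k a b)" "linear (B k b)" if "y k \<in> cdom x" for k b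
    using rmetric_facts(1)[of "y k"] linear_compose[OF linear_cc[OF that mem_dom]]
    unfolding B_def bilinear_def by (auto simp: o_def)
  have lin': "linear (\<lambda>a. rmetric M x a b)" "linear (rmetric M x b)" for b
    using rmetric_facts(1)[of x] by (auto simp: bilinear_def)
  \<comment> \<open>Convergence of the metric is known for fixed vectors only. Bilinearity upgrades
    it to moving ones, one argument at a time.\<close>
  have 1: "((\<lambda>k. B k (u k) b) \<longlongrightarrow> rmetric M x w b) F" for b
  proof (rule tendsto_linear_family[where A="\<lambda>k a. B k a b" and ?A0.0="\<lambda>a. rmetric M x a b"])
    show "\<forall>\<^sub>F k in F. linear (\<lambda>a. B k a b)" using cdom by eventually_elim (rule lin)
    show "(u \<longlongrightarrow> w) F" using v by (simp add: u_def)
    show "((\<lambda>k. B k a b) \<longlongrightarrow> rmetric M x a b) F" for a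
      unfolding B_def by (rule tendsto_rmetric[OF y])
  qed (rule lin')
  have "((\<lambda>k. B k (u k) (u k)) \<longlongrightarrow> rmetric M x w w) F"
  proof (rule tendsto_linear_family[where A="\<lambda>k. B k (u k)" and v=u and ?A0.0="rmetric M x w"])
    show "\<forall>\<^sub>F k in F. linear (B k (u k))" using cdom by eventually_elim (rule lin)
    show "(u \<longlongrightarrow> w) F" using v by (simp add: u_def)
  qed (rule lin' 1)+
  then have "((\<lambda>k. sqrt (B k (u k) (u k))) \<longlongrightarrow> sqrt (rmetric M x w w)) F" by (rule tendsto_real_sqrt)
  then show ?thesis unfolding tangent_norm_def
    by (rule Lim_transform_eventually) (use cdom in \<open>eventually_elim, simp add: B_def u_def cc_cc\<close>)
qed

lemma tangent_norm_scaleR: "tangent_norm M x (c *\<^sub>R v) = \<bar>c\<bar> * tangent_norm M x v"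
proof -
  have "rmetric M x (c *\<^sub>R v) (c *\<^sub>R v) = c\<^sup>2 * rmetric M x v v"
    using bilinear_lmul[OF rmetric_facts(1)] bilinear_rmul[OF rmetric_facts(1)]
    by (simp add: power2_eq_square)
  then show ?thesis by (simp add: tangent_norm_def real_sqrt_mult)
qed

lemma tangent_norm_pos: "v \<noteq> 0 \<Longrightarrow> 0 < tangent_norm M x v"
  using rmetric_facts(3) by (simp add: tangent_norm_def)

lemma tangent_norm_nonneg: "0 \<le> tangent_norm M x v"
  using tangent_norm_pos[of v x] tangent_norm_scaleR[of x 0 v] by (cases "v = 0") auto

end

section \<open>Integral curves\<close>

lemma integral_curve_subset_shift:
  assumes \<gamma>: "integral_curve M X J \<gamma>" and I: "\<And>s. s \<in> I \<Longrightarrow> s + a \<in> J"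
  shows "integral_curve M X I (\<lambda>s. \<gamma> (s + a))"
  unfolding integral_curve_def
proof (intro conjI ballI)
  show "continuous_on I (\<lambda>s. \<gamma> (s + a))"
    using \<gamma> I by (intro continuous_on_compose2[of J \<gamma> I "\<lambda>s. s + a"] continuous_intros) (auto simp: integral_curve_def)
  fix t assume t: "t \<in> I"
  have "((\<lambda>s. chart_map M (\<gamma> (t + a)) (\<gamma> s)) has_vector_derivative X (\<gamma> (t + a))) (at (t + a) within J)"
    using \<gamma> I[OF t] by (simp add: integral_curve_def)
  then have "((\<lambda>s. chart_map M (\<gamma> (t + a)) (\<gamma> s)) has_vector_derivative X (\<gamma> (t + a))) (at (t + a) within (\<lambda>s. s + a) ` I)"
    by (rule has_vector_derivative_within_subset) (use I in auto)
  then have "((\<lambda>s. chart_map M (\<gamma> (t + a)) (\<gamma> s)) \<circ> (\<lambda>s. s + a) has_vector_derivative 1 *\<^sub>R X (\<gamma> (t + a))) (at t within I)"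
    by (intro vector_diff_chain_within) (auto intro!: derivative_eq_intros)
  then show "((\<lambda>s. chart_map M (\<gamma> (t + a)) (\<gamma> (s + a))) has_vector_derivative X (\<gamma> (t + a))) (at t within I)"
    by (simp add: o_def)
qed

lemma integral_curve_subset: "integral_curve M X J \<gamma> \<Longrightarrow> I \<subseteq> J \<Longrightarrow> integral_curve M X I \<gamma>"
  using integral_curve_subset_shift[of M X J \<gamma> I 0] by (simp add: subset_iff)

lemma integral_curve_cong:
  assumes "integral_curve M X J \<gamma>" "\<And>s. s \<in> J \<Longrightarrow> \<gamma> s = \<gamma>' s"
  shows "integral_curve M X J \<gamma>'"
  unfolding integral_curve_def
proof (intro conjI ballI)
  show "continuous_on J \<gamma>'"
    using assms(1) unfolding integral_curve_def by (elim conjE continuous_on_eq) (rule assms(2))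
  fix t assume t: "t \<in> J"
  have *: "((\<lambda>s. chart_map M (\<gamma> t) (\<gamma> s)) has_vector_derivative X (\<gamma> t)) (at t within J)"
    using assms(1) t by (simp add: integral_curve_def)
  show "((\<lambda>s. chart_map M (\<gamma>' t) (\<gamma>' s)) has_vector_derivative X (\<gamma>' t)) (at t within J)"
    unfolding assms(2)[OF t, symmetric]
    by (rule has_vector_derivative_transform[OF t _ *]) (simp add: assms(2))
qed

lemma integral_curve_Un:
  assumes "integral_curve M X I \<gamma>" "integral_curve M X J \<gamma>" "closed I" "closed J"
  shows "integral_curve M X (I \<union> J) \<gamma>"
  unfolding integral_curve_def
proof (intro conjI ballI)
  show "continuous_on (I \<union> J) \<gamma>"
    using assms by (intro continuous_on_closed_Un) (auto simp: integral_curve_def)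
  fix t assume t: "t \<in> I \<union> J"
  let ?f = "\<lambda>s. chart_map M (\<gamma> t) (\<gamma> s)"
  have *: "(?f has_vector_derivative X (\<gamma> t)) (at t within K)"
    if "integral_curve M X K \<gamma>" "closed K" for K
  proof (cases "t \<in> K")
    case True
    then show ?thesis using that by (simp add: integral_curve_def)
  next
    case False
    \<comment> \<open>A point outside a closed piece is no limit point of it, so the derivative
      condition within that piece is vacuous.\<close>
    then have "at t within K = bot"
      using that(2) by (simp add: at_within_eq_bot_iff closure_closed)
    then show ?thesis by (simp add: has_vector_derivative_def has_derivative_def bounded_linear_scaleR_left)
  qed
  have "(?f has_vector_derivative X (\<gamma> t)) (at t within I)" "(?f has_vector_derivative X (\<gamma> t)) (at t within J)"
    using * assms by auto
  then show "(?f has_vector_derivative X (\<gamma> t)) (at t within I \<union> J)"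
    unfolding has_vector_derivative_def has_derivative_within Lim_within_Un by simp
qed

context riemannian
begin

lemma curve_change_chart:
  assumes cont: "continuous (at t within J) \<gamma>" and t: "t \<in> J" "\<gamma> t \<in> cdom p" "\<gamma> t \<in> cdom q"
    and d: "((\<lambda>s. ch p (\<gamma> s)) has_vector_derivative v) (at t within J)"
  shows "((\<lambda>s. ch q (\<gamma> s)) has_vector_derivative cc p q (\<gamma> t) v) (at t within J)"
proof -
  have "(\<gamma> \<longlongrightarrow> \<gamma> t) (at t within J)" using cont by (simp add: continuous_within)
  then have "\<forall>\<^sub>F s in at t within J. \<gamma> s \<in> cdom p" by (rule topological_tendstoD[OF _ open_dom t(2)])
  then obtain e where e: "0 < e" "\<And>s. s \<in> J \<Longrightarrow> s \<noteq> t \<Longrightarrow> dist s t < e \<Longrightarrow> \<gamma> s \<in> cdom p"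
    unfolding eventually_at by blast
  have e': "\<gamma> s \<in> cdom p" if "s \<in> J" "dist s t < e" for s
    using e(2)[OF that(1) _ that(2)] t by (cases "s = t") auto
  let ?S = "J \<inter> ball t e"
  have at: "at t within ?S = at t within J"
    by (rule at_within_nhd[of _ "ball t e"]) (use e(1) in auto)
  have m: "((\<lambda>z. ch q (ich p z)) has_derivative cc p q (\<gamma> t)) (at (ch p (\<gamma> t)) within H)"
    using mderiv_id[OF t(2,3)] by (simp add: mderiv_def)
  have "((\<lambda>z. ch q (ich p z)) \<circ> (\<lambda>s. ch p (\<gamma> s)) has_derivative cc p q (\<gamma> t) \<circ> (\<lambda>h. h *\<^sub>R v)) (at t within ?S)"
  proof (rule diff_chain_within)
    show "((\<lambda>s. ch p (\<gamma> s)) has_derivative (\<lambda>h. h *\<^sub>R v)) (at t within ?S)"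
      using d unfolding at has_vector_derivative_def .
    show "((\<lambda>z. ch q (ich p z)) has_derivative cc p q (\<gamma> t)) (at (ch p (\<gamma> t)) within (\<lambda>s. ch p (\<gamma> s)) ` ?S)"
      by (rule has_derivative_subset[OF m]) (use e' in \<open>auto simp: dist_commute\<close>)
  qed
  then have "((\<lambda>s. ch q (\<gamma> s)) has_derivative cc p q (\<gamma> t) \<circ> (\<lambda>h. h *\<^sub>R v)) (at t within ?S)"
    by (rule has_derivative_transform[rotated 2]) (use e' e(1) t(1) in \<open>auto simp: dist_commute\<close>)
  moreover have "cc p q (\<gamma> t) \<circ> (\<lambda>h. h *\<^sub>R v) = (\<lambda>h. h *\<^sub>R cc p q (\<gamma> t) v)"
    using linear_scale[OF linear_cc[OF t(2,3)]] by (simp add: o_def)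
  ultimately show ?thesis unfolding at has_vector_derivative_def by simp
qed

text \<open>The definition differentiates at each time in the chart of the current point. In a fixed
  chart the curve becomes a solution of an ordinary differential equation, with the field written in
  that chart.\<close>

lemma integral_curve_in_chart:
  assumes "integral_curve M X J \<gamma>" "t \<in> J" "\<gamma> t \<in> cdom p"
  shows "((\<lambda>s. ch p (\<gamma> s)) has_vector_derivative cc (\<gamma> t) p (\<gamma> t) (X (\<gamma> t))) (at t within J)"
  using assms by (intro curve_change_chart) (auto simp: integral_curve_def continuous_on_eq_continuous_within)

lemma integral_curve_from_chart:
  assumes \<gamma>: "continuous_on J \<gamma>" "\<And>t. t \<in> J \<Longrightarrow> \<gamma> t \<in> cdom p"
    and d: "\<And>t. t \<in> J \<Longrightarrow> ((\<lambda>s. ch p (\<gamma> s)) has_vector_derivative cc (\<gamma> t) p (\<gamma> t) (X (\<gamma> t))) (at t within J)"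
  shows "integral_curve M X J \<gamma>"
  unfolding integral_curve_def
proof (intro conjI ballI \<gamma>)
  fix t assume t: "t \<in> J"
  have "continuous (at t within J) \<gamma>" using \<gamma>(1) t by (simp add: continuous_on_eq_continuous_within)
  from curve_change_chart[OF this t \<gamma>(2)[OF t] mem_dom d[OF t]]
  show "((\<lambda>s. ch (\<gamma> t) (\<gamma> s)) has_vector_derivative X (\<gamma> t)) (at t within J)"
    using \<gamma>(2)[OF t] by (simp add: cc_cc)
qed

text \<open>Any chart may witness interiority: what the existence and uniqueness proofs use is one
  chart whose image contains a full ball around the point.\<close>

definition interior_points :: "'m set" where
  "interior_points = {x. \<exists>p. x \<in> cdom p \<and> 0 < ch p x \<bullet> inner_normal}"

end

section \<open>Uniqueness of integral curves and partial flow laws\<close>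

locale riemannian_field = riemannian M
  for M :: "('m::{t2_space,second_countable_topology}, 'e::euclidean_space) manifold_data" +
  fixes X :: "'m \<Rightarrow> 'e"
  assumes field: "C1_vector_field M X"
begin

abbreviation local_field :: "'m \<Rightarrow> 'e \<Rightarrow> 'e" where
  "local_field p z \<equiv> cc (ich p z) p (ich p z) (X (ich p z))"

text \<open>In a small ball off the boundary hyperplane, the extension provided by
  \<open>diff_class_on\<close> is the field itself, so the Euclidean theory applies in all
  directions around the point.\<close>

lemma local_field_C1:
  assumes x: "x \<in> cdom p" "0 < ch p x \<bullet> inner_normal"
  obtains R f f' where "0 < R" "ball (ch p x) R \<subseteq> chart_image M p"
    "\<And>z. z \<in> ball (ch p x) R \<Longrightarrow> 0 < z \<bullet> inner_normal"
    "\<And>z. z \<in> ball (ch p x) R \<Longrightarrow> f z = local_field p z"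
    "\<And>z. z \<in> ball (ch p x) R \<Longrightarrow> (f has_derivative blinfun_apply (f' z)) (at z)"
    "continuous_on (ball (ch p x) R) (f' :: 'e \<Rightarrow> 'e \<Rightarrow>\<^sub>L 'e)"
proof -
  have "diff_class_on 1 (chart_image M p) (\<lambda>z. let y = ich p z in cc y p y (X y))"
    by (rule field[unfolded C1_vector_field_def, THEN spec])
  then show ?thesis
  proof (rule diff_class_onD)
    show "ch p x \<in> chart_image M p" using x(1) by simp
    fix U f assume U: "open U" "ch p x \<in> U" "Ck_on 1 U f"
      "\<And>z. z \<in> chart_image M p \<Longrightarrow> z \<in> U \<Longrightarrow> f z = (let y = ich p z in cc y p y (X y))"
    obtain W where W: "open W" "chart_image M p = H \<inter> W" using openin_image[of p] by (auto simp: openin_open)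
    have "open {z :: 'e. 0 < z \<bullet> inner_normal}" by (intro open_Collect_less continuous_intros)
    then have "open (U \<inter> W \<inter> {z. 0 < z \<bullet> inner_normal})" using U(1) W(1) by (intro open_Int)
    moreover have "ch p x \<in> U \<inter> W \<inter> {z. 0 < z \<bullet> inner_normal}"
      using U(2) x W(2) ch_mem[OF x(1)] by auto
    ultimately obtain R where R: "0 < R" "ball (ch p x) R \<subseteq> U \<inter> W \<inter> {z. 0 < z \<bullet> inner_normal}" by (rule openE)
    have sub: "ball (ch p x) R \<subseteq> chart_image M p"
      using R(2) unfolding W(2) by (auto simp: half_space_def)
    have df: "\<And>z. z \<in> U \<Longrightarrow> f differentiable at z" "\<And>v. continuous_on U (\<lambda>z. frechet_derivative f (at z) v)"
      using U(3) unfolding One_nat_def Ck_on.simps by auto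
    define f' where "f' z = Blinfun (frechet_derivative f (at z))" for z
    have f': "blinfun_apply (f' z) = frechet_derivative f (at z)" if "z \<in> U" for z
      unfolding f'_def
      using has_derivative_bounded_linear[OF frechet_derivative_works[THEN iffD1, OF df(1)[OF that]]]
      by (rule bounded_linear_Blinfun_apply)
    show ?thesis
    proof (rule that[OF R(1) sub])
      show "0 < z \<bullet> inner_normal" if "z \<in> ball (ch p x) R" for z using R(2) that by blast
      show "f z = local_field p z" if "z \<in> ball (ch p x) R" for z
      proof -
        have "z \<in> chart_image M p" "z \<in> U" using sub R(2) that by blast+
        then show ?thesis using U(4)[of z] by (simp add: Let_def)
      qed
      show "(f has_derivative blinfun_apply (f' z)) (at z)" if "z \<in> ball (ch p x) R" for z
      proof -
        have "z \<in> U" using R(2) that by blast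
        then show ?thesis using frechet_derivative_works[THEN iffD1, OF df(1)] by (simp add: f')
      qed
      have "continuous_on U f'"
      proof (rule continuous_on_blinfun_componentwise)
        fix i :: 'e
        show "continuous_on U (\<lambda>z. blinfun_apply (f' z) i)"
          using df(2)[of i] by (rule continuous_on_eq) (simp add: f')
      qed
      then show "continuous_on (ball (ch p x) R) f'" by (rule continuous_on_subset) (use R(2) in blast)
    qed
  qed simp
qed

lemma local_unique:
  assumes \<gamma>: "integral_curve M X J \<gamma>" "integral_curve M X J \<gamma>'" and J: "convex J" "compact J" "s \<in> J"
    and eq: "\<gamma> s = \<gamma>' s" and inner: "\<gamma> s \<in> interior_points"
  shows "\<exists>d>0. \<forall>u\<in>J. \<bar>u - s\<bar> < d \<longrightarrow> \<gamma> u = \<gamma>' u"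
proof -
  obtain p where p: "\<gamma> s \<in> cdom p" "0 < ch p (\<gamma> s) \<bullet> inner_normal" using inner by (auto simp: interior_points_def)
  show ?thesis
  proof (rule local_field_C1[OF p])
    fix R f and f' :: "'e \<Rightarrow> 'e \<Rightarrow>\<^sub>L 'e"
    assume R: "0 < R" "ball (ch p (\<gamma> s)) R \<subseteq> chart_image M p"
      "\<And>z. z \<in> ball (ch p (\<gamma> s)) R \<Longrightarrow> f z = local_field p z"
      "\<And>z. z \<in> ball (ch p (\<gamma> s)) R \<Longrightarrow> (f has_derivative blinfun_apply (f' z)) (at z)"
      "continuous_on (ball (ch p (\<gamma> s)) R) f'"
    let ?C = "cball (ch p (\<gamma> s)) (R/2)"
    show ?thesis
    proof (rule C1_ball_bounds[OF R(1,4,5)])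
      fix L assume L: "1 \<le> L" "\<And>z z'. z \<in> ?C \<Longrightarrow> z' \<in> ?C \<Longrightarrow> norm (f z - f z') \<le> L * norm (z - z')"
      have near: "\<exists>d>0. \<forall>u\<in>J. \<bar>u - s\<bar> < d \<longrightarrow> \<sigma> u \<in> cdom p \<and> ch p (\<sigma> u) \<in> ball (ch p (\<gamma> s)) (R/2)"
        if "integral_curve M X J \<sigma>" "\<sigma> s = \<gamma> s" for \<sigma>
      proof -
        have lim: "(\<sigma> \<longlongrightarrow> \<gamma> s) (at s within J)" using that J(3) by (auto simp: integral_curve_def continuous_on_def)
        have "((\<lambda>u. ch p (\<sigma> u)) \<longlongrightarrow> ch p (\<gamma> s)) (at s within J)"
          using isCont_tendsto_compose[OF isCont_ch[OF p(1)] lim] .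
        then have "\<forall>\<^sub>F u in at s within J. ch p (\<sigma> u) \<in> ball (ch p (\<gamma> s)) (R/2)"
          by (rule topological_tendstoD) (use R(1) in auto)
        moreover have "\<forall>\<^sub>F u in at s within J. \<sigma> u \<in> cdom p" by (rule topological_tendstoD[OF lim open_dom p(1)])
        ultimately have "\<forall>\<^sub>F u in at s within J. \<sigma> u \<in> cdom p \<and> ch p (\<sigma> u) \<in> ball (ch p (\<gamma> s)) (R/2)"
          by (rule eventually_conj[rotated])
        then obtain d where d: "0 < d" "\<And>u. u \<in> J \<Longrightarrow> u \<noteq> s \<Longrightarrow> dist u s < d \<Longrightarrow> \<sigma> u \<in> cdom p \<and> ch p (\<sigma> u) \<in> ball (ch p (\<gamma> s)) (R/2)"
          unfolding eventually_at by blast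
        have "\<sigma> u \<in> cdom p \<and> ch p (\<sigma> u) \<in> ball (ch p (\<gamma> s)) (R/2)" if "u \<in> J" "\<bar>u - s\<bar> < d" for u
          using d(2)[of u] that p R(1) \<open>\<sigma> s = \<gamma> s\<close> by (cases "u = s") (auto simp: dist_real_def)
        then show ?thesis using d(1) by blast
      qed
      obtain d1 where d1: "0 < d1" "\<And>u. u \<in> J \<Longrightarrow> \<bar>u - s\<bar> < d1 \<Longrightarrow> \<gamma> u \<in> cdom p \<and> ch p (\<gamma> u) \<in> ball (ch p (\<gamma> s)) (R/2)"
        using near[OF \<gamma>(1) refl] by blast
      obtain d2 where d2: "0 < d2" "\<And>u. u \<in> J \<Longrightarrow> \<bar>u - s\<bar> < d2 \<Longrightarrow> \<gamma>' u \<in> cdom p \<and> ch p (\<gamma>' u) \<in> ball (ch p (\<gamma> s)) (R/2)"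
        using near[OF \<gamma>(2) eq[symmetric]] by blast
      \<comment> \<open>Small enough for both curves to stay in the half-radius ball, where
        \<open>f\<close> is Lipschitz, and for \<open>d * L \<le> 1/2\<close>; with equal initial
        values \<open>short_time_bound\<close> then gives distance 0.\<close>
      define d where "d = min (min d1 d2) (1 / L) / 2"
      have d: "0 < d" "d < d1" "d < d2"
        using d1(1) d2(1) L(1) by (auto simp: d_def)
      have "d * L \<le> (1 / L / 2) * L"
        unfolding d_def using L(1) by (intro mult_right_mono divide_right_mono) auto
      then have dL: "d * L \<le> 1/2" using L(1) by simp
      let ?I = "J \<inter> cball s d"
      have "\<gamma> u = \<gamma>' u" if u: "u \<in> J" "\<bar>u - s\<bar> < d" for u
      proof -
        have I: "\<gamma> u \<in> cdom p" "\<gamma>' u \<in> cdom p" "ch p (\<gamma> u) \<in> ball (ch p (\<gamma> s)) (R/2)" "ch p (\<gamma>' u) \<in> ball (ch p (\<gamma> s)) (R/2)"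
          if "u \<in> ?I" for u
          using d1(2)[of u] d2(2)[of u] that d by (auto simp: dist_real_def abs_minus_commute)
        have der: "((\<lambda>s. ch p (\<sigma> s)) has_vector_derivative f (ch p (\<sigma> u))) (at u within ?I)"
          if "integral_curve M X J \<sigma>" "u \<in> ?I" "\<sigma> u \<in> cdom p" "ch p (\<sigma> u) \<in> ball (ch p (\<gamma> s)) (R/2)" for \<sigma> u
        proof -
          have "((\<lambda>s. ch p (\<sigma> s)) has_vector_derivative cc (\<sigma> u) p (\<sigma> u) (X (\<sigma> u))) (at u within ?I)"
            by (rule has_vector_derivative_within_subset[OF integral_curve_in_chart[OF that(1) _ that(3)]]) (use that(2) in auto)
          moreover have "f (ch p (\<sigma> u)) = cc (\<sigma> u) p (\<sigma> u) (X (\<sigma> u))"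
            using R(1,3) that by (subst R(3)) auto
          ultimately show ?thesis by simp
        qed
        have "norm (ch p (\<gamma> u) - ch p (\<gamma>' u)) \<le> 2 * (norm (ch p (\<gamma> s) - ch p (\<gamma>' s)) + d * 0)"
        proof (rule short_time_bound[where I="?I" and L=L and u="\<lambda>u. ch p (\<gamma> u) - ch p (\<gamma>' u)"])
          show "convex ?I" "compact ?I" using J by (auto intro: convex_Int compact_Int_closed)
          fix t assume t: "t \<in> ?I"
          show "((\<lambda>u. ch p (\<gamma> u) - ch p (\<gamma>' u)) has_vector_derivative f (ch p (\<gamma> t)) - f (ch p (\<gamma>' t))) (at t within ?I)"
            by (intro has_vector_derivative_diff der \<gamma> t I)
          show "norm (f (ch p (\<gamma> t)) - f (ch p (\<gamma>' t))) \<le> L * norm (ch p (\<gamma> t) - ch p (\<gamma>' t)) + 0"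
            using L(2)[of "ch p (\<gamma> t)" "ch p (\<gamma>' t)"] I(3,4)[OF t] by auto
        qed (use J d dL L u in \<open>auto simp: dist_real_def abs_minus_commute\<close>)
        then have *: "ch p (\<gamma> u) = ch p (\<gamma>' u)" unfolding eq by simp
        have "u \<in> ?I" using u by (simp add: dist_real_def abs_minus_commute)
        have "\<gamma> u = ich p (ch p (\<gamma> u))" using I(1)[OF \<open>u \<in> ?I\<close>] by simp
        also have "\<dots> = \<gamma>' u" unfolding * using I(2)[OF \<open>u \<in> ?I\<close>] by simp
        finally show ?thesis .
      qed
      then show ?thesis using d(1) by blast
    qed
  qed
qed

text \<open>The set of agreement is open by \<open>local_unique\<close> and closed because the
  diagonal of a Hausdorff space is closed. Interiority is asked of one curve only: where the curves
  agree it holds for the other.\<close>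

lemma global_unique:
  assumes \<gamma>: "integral_curve M X J \<gamma>" "integral_curve M X J \<gamma>'" and J: "convex J" "compact J" "s \<in> J"
    and eq: "\<gamma> s = \<gamma>' s" and inner: "\<And>u. u \<in> J \<Longrightarrow> \<gamma> u \<in> interior_points" and u: "u \<in> J"
  shows "\<gamma> u = \<gamma>' u"
proof -
  define T where "T = {u\<in>J. \<gamma> u = \<gamma>' u}"
  have "openin (top_of_set J) T"
    unfolding openin_euclidean_subtopology_iff
  proof (intro conjI ballI)
    fix v assume v: "v \<in> T"
    have "\<exists>d>0. \<forall>u\<in>J. \<bar>u - v\<bar> < d \<longrightarrow> \<gamma> u = \<gamma>' u"
      by (rule local_unique[OF \<gamma> J(1,2)]) (use v inner[of v] in \<open>auto simp: T_def\<close>)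
    then show "\<exists>e>0. \<forall>x'\<in>J. dist x' v < e \<longrightarrow> x' \<in> T"
      by (auto simp: T_def dist_real_def)
  qed (auto simp: T_def)
  moreover have "closedin (top_of_set J) T"
  proof -
    have "continuous_on J (\<lambda>u. (\<gamma> u, \<gamma>' u))"
      using \<gamma> by (intro continuous_on_Pair) (auto simp: integral_curve_def)
    from continuous_closedin_preimage[OF this closed_diagonal]
    have "closedin (top_of_set J) (J \<inter> (\<lambda>u. (\<gamma> u, \<gamma>' u)) -` {y. \<exists>x. y = (x, x)})" .
    also have "J \<inter> (\<lambda>u. (\<gamma> u, \<gamma>' u)) -` {y. \<exists>x. y = (x, x)} = T" by (auto simp: T_def)
    finally show ?thesis .
  qed
  moreover have "T \<noteq> {}" using J eq by (auto simp: T_def)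
  ultimately have "T = J" using convex_connected[OF J(1)] by (auto simp: connected_clopen)
  then show ?thesis using u by (auto simp: T_def)
qed

lemma flow_eq:
  assumes \<gamma>: "integral_curve M X (closed_segment 0 t) \<gamma>" "\<gamma> 0 = y" "\<And>s. s \<in> closed_segment 0 t \<Longrightarrow> \<gamma> s \<in> interior_points"
  shows "flow M X t y = \<gamma> t"
  unfolding flow_def
proof (rule the_equality)
  show "\<exists>\<sigma>. integral_curve M X (closed_segment 0 t) \<sigma> \<and> \<sigma> 0 = y \<and> \<sigma> t = \<gamma> t" using \<gamma> by blast
  fix z assume "\<exists>\<sigma>. integral_curve M X (closed_segment 0 t) \<sigma> \<and> \<sigma> 0 = y \<and> \<sigma> t = z"
  then obtain \<sigma> where \<sigma>: "integral_curve M X (closed_segment 0 t) \<sigma>" "\<sigma> 0 = y" "\<sigma> t = z" by blast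
  have "\<gamma> t = \<sigma> t"
    by (rule global_unique[OF \<gamma>(1) \<sigma>(1), of 0]) (use \<gamma> \<sigma> in auto)
  then show "z = \<gamma> t" using \<sigma> by simp
qed

text \<open>Interiority along the whole segment makes the end point unique, so that the definite
  description in \<open>flow\<close> denotes it.\<close>

definition good :: "real \<Rightarrow> 'm \<Rightarrow> bool" where
  "good t y \<longleftrightarrow> (\<exists>\<gamma>. integral_curve M X (closed_segment 0 t) \<gamma> \<and> \<gamma> 0 = y \<and> (\<forall>s\<in>closed_segment 0 t. \<gamma> s \<in> interior_points))"

lemma goodE:
  assumes "good t y"
  obtains \<gamma> where "integral_curve M X (closed_segment 0 t) \<gamma>" "\<gamma> 0 = y"
    "\<And>s. s \<in> closed_segment 0 t \<Longrightarrow> \<gamma> s \<in> interior_points" "flow M X t y = \<gamma> t"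
proof -
  obtain \<gamma> where "integral_curve M X (closed_segment 0 t) \<gamma>" "\<gamma> 0 = y"
    "\<forall>s\<in>closed_segment 0 t. \<gamma> s \<in> interior_points"
    using assms unfolding good_def by blast
  then show ?thesis using flow_eq[of t \<gamma> y] by (intro that[of \<gamma>]) auto
qed

text \<open>Concatenation of two curves. The sign condition makes the segments meet only at
  \<open>s\<close>, so that the pieces fit together; mixed signs are treated on \<Lambda>, where
  reversal is always available.\<close>

lemma good_add:
  assumes g: "good s y" "good t (flow M X s y)" and st: "0 \<le> s * t"
  shows "good (s + t) y" "flow M X (s + t) y = flow M X t (flow M X s y)"
proof -
  obtain \<gamma> where \<gamma>: "integral_curve M X (closed_segment 0 s) \<gamma>" "\<gamma> 0 = y"
    "\<And>u. u \<in> closed_segment 0 s \<Longrightarrow> \<gamma> u \<in> interior_points" "flow M X s y = \<gamma> s" by (rule goodE[OF g(1)]) blast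
  obtain \<sigma> where \<sigma>: "integral_curve M X (closed_segment 0 t) \<sigma>" "\<sigma> 0 = \<gamma> s"
    "\<And>u. u \<in> closed_segment 0 t \<Longrightarrow> \<sigma> u \<in> interior_points" "flow M X t (\<gamma> s) = \<sigma> t"
    by (rule goodE[OF g(2)[unfolded \<gamma>(4)]]) blast
  let ?J1 = "closed_segment 0 s" and ?J2 = "closed_segment s (s + t)"
  have signs: "0 \<le> s \<and> 0 \<le> t \<or> s \<le> 0 \<and> t \<le> 0"
    using st by (auto simp: zero_le_mult_iff)
  have J: "closed_segment 0 (s + t) = ?J1 \<union> ?J2"
    using signs by (auto simp: closed_segment_eq_real_ivl)
  have overlap: "u = s" if "u \<in> ?J1" "u \<in> ?J2" for u
    using signs that by (auto simp: closed_segment_eq_real_ivl split: if_splits)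
  have shift: "u - s \<in> closed_segment 0 t \<longleftrightarrow> u \<in> ?J2" for u
    by (auto simp: closed_segment_eq_real_ivl)
  define \<rho> where "\<rho> u = (if u \<in> ?J1 then \<gamma> u else \<sigma> (u - s))" for u
  have \<rho>2: "\<rho> u = \<sigma> (u - s)" if "u \<in> ?J2" for u
    using overlap[OF _ that] \<sigma>(2) by (auto simp: \<rho>_def)
  have c1: "integral_curve M X ?J1 \<rho>"
    by (rule integral_curve_cong[OF \<gamma>(1)]) (simp add: \<rho>_def)
  have "integral_curve M X ?J2 (\<lambda>u. \<sigma> (u + - s))"
    by (rule integral_curve_subset_shift[OF \<sigma>(1)]) (use shift in auto)
  then have c2: "integral_curve M X ?J2 \<rho>"
    by (rule integral_curve_cong) (simp add: \<rho>2)
  have c: "integral_curve M X (closed_segment 0 (s + t)) \<rho>"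
    unfolding J by (rule integral_curve_Un[OF c1 c2]) auto
  have \<rho>0: "\<rho> 0 = y" using \<gamma>(2) by (simp add: \<rho>_def)
  have \<rho>in: "\<rho> u \<in> interior_points" if "u \<in> closed_segment 0 (s + t)" for u
    using that \<gamma>(3) \<sigma>(3) shift \<rho>2 unfolding J by (auto simp: \<rho>_def)
  show "good (s + t) y" using c \<rho>0 \<rho>in by (auto simp: good_def)
  have "flow M X (s + t) y = \<rho> (s + t)" by (rule flow_eq[OF c \<rho>0 \<rho>in])
  also have "\<dots> = \<sigma> t" using \<rho>2[of "s + t"] by simp
  finally show "flow M X (s + t) y = flow M X t (flow M X s y)" using \<gamma>(4) \<sigma>(4) by simp
qed

lemma good_reverse:
  assumes "good t y"
  shows "good (- t) (flow M X t y)" "flow M X (- t) (flow M X t y) = y"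
proof -
  obtain \<gamma> where \<gamma>: "integral_curve M X (closed_segment 0 t) \<gamma>" "\<gamma> 0 = y"
    "\<And>u. u \<in> closed_segment 0 t \<Longrightarrow> \<gamma> u \<in> interior_points" "flow M X t y = \<gamma> t" by (rule goodE[OF assms]) blast
  have I: "s + t \<in> closed_segment 0 t" if "s \<in> closed_segment 0 (- t)" for s
    using that by (auto simp: closed_segment_eq_real_ivl split: if_splits)
  have c: "integral_curve M X (closed_segment 0 (- t)) (\<lambda>s. \<gamma> (s + t))"
    by (rule integral_curve_subset_shift[OF \<gamma>(1) I])
  show "good (- t) (flow M X t y)"
    unfolding good_def by (intro exI[of _ "\<lambda>s. \<gamma> (s + t)"]) (use c \<gamma> I in auto)
  show "flow M X (- t) (flow M X t y) = y"
    using flow_eq[OF c, of "flow M X t y"] \<gamma> I by simp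
qed

end

section \<open>The derivative of the flow\<close>

context riemannian_field
begin

abbreviation "fl \<equiv> flow M X"
abbreviation "Dfl \<equiv> Dflow M X"

text \<open>\<open>good\<close> is required in a neighbourhood because the flow identities are
  differentiated at \<open>x\<close> and must hold near it.\<close>

definition reg :: "real \<Rightarrow> 'm \<Rightarrow> bool" where
  "reg t x \<longleftrightarrow> (\<forall>\<^sub>F y in nhds x. good t y) \<and> (\<exists>D. mderiv x (fl t x) (fl t) D x)"

lemma Dflow_eq:
  assumes "mderiv x (fl t x) (fl t) D x"
  shows "Dfl t x = D"
proof -
  let ?f = "\<lambda>z. ch (fl t x) (fl t (ich x z))"
  have d: "(?f has_derivative D) (at (ch x x) within H)"
    using assms by (simp add: mderiv_def)
  have "\<exists>D. (?f has_derivative D) (at (ch x x) within H)"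
    by (rule exI[where x=D]) (rule d)
  then have "(?f has_derivative Dfl t x) (at (ch x x) within H)"
    unfolding Dflow_def at_within_openin_half_space[OF openin_image ch_mem[OF mem_dom]] frechet_derivative_def
    by (rule someI_ex)
  then show ?thesis by (rule half_space_derivative_unique[OF _ d]) simp
qed

lemma reg_mderiv: "reg t x \<Longrightarrow> mderiv x (fl t x) (fl t) (Dfl t x) x"
  using Dflow_eq by (auto simp: reg_def)

lemma reg_linear: "reg t x \<Longrightarrow> linear (Dfl t x)"
  using reg_mderiv mderiv_linear by blast

lemma isCont_flow: "reg t x \<Longrightarrow> isCont (fl t) x"
  using reg_mderiv by (auto simp: mderiv_def)

lemma eventually_good_flow:
  assumes "reg s x" "reg t (fl s x)"
  shows "\<forall>\<^sub>F y in nhds x. good s y \<and> good t (fl s y)"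
proof -
  have "(fl s \<longlongrightarrow> fl s x) (nhds x)"
    using isCont_flow[OF assms(1)] unfolding isCont_def by (rule tendsto_at_iff_tendsto_nhds[THEN iffD1])
  moreover have "\<forall>\<^sub>F z in nhds (fl s x). good t z" using assms(2) by (simp add: reg_def)
  ultimately have "\<forall>\<^sub>F y in nhds x. good t (fl s y)" by (simp add: filterlim_iff)
  moreover have "\<forall>\<^sub>F y in nhds x. good s y" using assms(1) by (simp add: reg_def)
  ultimately show ?thesis by (rule eventually_conj[rotated])
qed

lemma reg_add:
  assumes r: "reg s x" "reg t (fl s x)" and st: "0 \<le> s * t"
  shows "reg (s + t) x" "Dfl (s + t) x v = Dfl t (fl s x) (Dfl s x v)"
proof -
  note ev = eventually_good_flow[OF r]
  have eq: "\<forall>\<^sub>F y in nhds x. fl t (fl s y) = fl (s + t) y"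
    using ev by eventually_elim (simp add: good_add(2)[OF _ _ st])
  have "mderiv x (fl t (fl s x)) (\<lambda>y. fl t (fl s y)) (\<lambda>v. Dfl t (fl s x) (Dfl s x v)) x"
    by (rule mderiv_comp[OF reg_mderiv[OF r(1)] reg_mderiv[OF r(2)]])
  from mderiv_cong[OF this eq]
  have d: "mderiv x (fl (s + t) x) (fl (s + t)) (\<lambda>v. Dfl t (fl s x) (Dfl s x v)) x"
    using eventually_nhds_x_imp_x[OF eq] by simp
  have "\<forall>\<^sub>F y in nhds x. good (s + t) y"
    using ev by eventually_elim (simp add: good_add(1)[OF _ _ st])
  with d show "reg (s + t) x" by (auto simp: reg_def)
  show "Dfl (s + t) x v = Dfl t (fl s x) (Dfl s x v)" using Dflow_eq[OF d] by simp
qed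

lemma reg_reverse:
  assumes r: "reg t x" "reg (- t) (fl t x)"
  shows "Dfl (- t) (fl t x) (Dfl t x v) = v"
proof -
  have eq: "\<forall>\<^sub>F y in nhds x. fl (- t) (fl t y) = y"
    using r(1) unfolding reg_def by (auto elim!: eventually_mono simp: good_reverse)
  have "mderiv x (fl (- t) (fl t x)) (\<lambda>y. fl (- t) (fl t y)) (\<lambda>v. Dfl (- t) (fl t x) (Dfl t x v)) x"
    by (rule mderiv_comp[OF reg_mderiv[OF r(1)] reg_mderiv[OF r(2)]])
  from mderiv_cong[OF this eq] have "mderiv x x (\<lambda>y. y) (\<lambda>v. Dfl (- t) (fl t x) (Dfl t x v)) x"
    using eventually_nhds_x_imp_x[OF eq] by simp
  from fun_cong[OF mderiv_unique[OF this mderiv_id], of v] show ?thesis by simp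
qed

text \<open>The chart version of \<open>local_C1_flow\<close>, for a two-sided time interval. Joint
  continuity of \<open>A\<close> in time and position is the source of the later continuity
  statements for \<open>Dflow\<close>.\<close>

definition flow_box :: "'m \<Rightarrow> 'm set \<Rightarrow> real \<Rightarrow> (real \<Rightarrow> 'e \<Rightarrow> 'e) \<Rightarrow> (real \<Rightarrow> 'e \<Rightarrow> 'e \<Rightarrow>\<^sub>L 'e) \<Rightarrow> bool" where
  "flow_box p W \<delta> \<Phi> A \<longleftrightarrow> open W \<and> W \<subseteq> cdom p \<and> 0 < \<delta> \<and>
     (\<forall>y\<in>W. \<forall>t\<in>{-\<delta>..\<delta>}. \<Phi> t (ch p y) \<in> chart_image M p \<and> good t y \<and> fl t y = ich p (\<Phi> t (ch p y)) \<and>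
       (\<Phi> t has_derivative blinfun_apply (A t (ch p y))) (at (ch p y))) \<and>
     continuous_on ({-\<delta>..\<delta>} \<times> ch p ` W) (\<lambda>(t, z). \<Phi> t z) \<and>
     continuous_on ({-\<delta>..\<delta>} \<times> ch p ` W) (\<lambda>(t, z). A t z)"

lemma flow_boxD:
  assumes "flow_box p W \<delta> \<Phi> A"
  shows "open W" "W \<subseteq> cdom p" "0 < \<delta>"
    "\<And>y t. y \<in> W \<Longrightarrow> t \<in> {-\<delta>..\<delta>} \<Longrightarrow> \<Phi> t (ch p y) \<in> chart_image M p"
    "\<And>y t. y \<in> W \<Longrightarrow> t \<in> {-\<delta>..\<delta>} \<Longrightarrow> good t y"
    "\<And>y t. y \<in> W \<Longrightarrow> t \<in> {-\<delta>..\<delta>} \<Longrightarrow> fl t y = ich p (\<Phi> t (ch p y))"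
    "\<And>y t. y \<in> W \<Longrightarrow> t \<in> {-\<delta>..\<delta>} \<Longrightarrow> (\<Phi> t has_derivative blinfun_apply (A t (ch p y))) (at (ch p y))"
    "continuous_on ({-\<delta>..\<delta>} \<times> ch p ` W) (\<lambda>(t, z). \<Phi> t z)"
    "continuous_on ({-\<delta>..\<delta>} \<times> ch p ` W) (\<lambda>(t, z). A t z)"
  using assms unfolding flow_box_def by blast+

lemma interior_pointsI: "x \<in> cdom p \<Longrightarrow> 0 < ch p x \<bullet> inner_normal \<Longrightarrow> x \<in> interior_points"
  by (auto simp: interior_points_def)

lemma flow_box_exists:
  assumes "x \<in> interior_points"
  shows "\<exists>p W \<delta> \<Phi> A. flow_box p W \<delta> \<Phi> A \<and> x \<in> W"
proof -
  obtain p where p: "x \<in> cdom p" "0 < ch p x \<bullet> inner_normal" using assms by (auto simp: interior_points_def)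
  show ?thesis
  proof (rule local_field_C1[OF p])
    fix R f and f' :: "'e \<Rightarrow> 'e \<Rightarrow>\<^sub>L 'e"
    assume R: "0 < R" "ball (ch p x) R \<subseteq> chart_image M p"
      "\<And>z. z \<in> ball (ch p x) R \<Longrightarrow> 0 < z \<bullet> inner_normal"
      "\<And>z. z \<in> ball (ch p x) R \<Longrightarrow> f z = local_field p z"
      "\<And>z. z \<in> ball (ch p x) R \<Longrightarrow> (f has_derivative blinfun_apply (f' z)) (at z)"
      "continuous_on (ball (ch p x) R) f'"
    show ?thesis
    proof (rule local_C1_flow[OF R(1,5,6)])
      fix \<delta> r \<Phi> A
      assume L: "0 < (\<delta>::real)" "0 < r" "r \<le> R"
        "\<And>t y. t \<in> {-\<delta>..\<delta>} \<Longrightarrow> y \<in> ball (ch p x) r \<Longrightarrow> \<Phi> t y \<in> ball (ch p x) R"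
        "\<And>y. y \<in> ball (ch p x) r \<Longrightarrow> \<Phi> 0 y = y"
        "\<And>t y. t \<in> {-\<delta>..\<delta>} \<Longrightarrow> y \<in> ball (ch p x) r \<Longrightarrow>
          ((\<lambda>t. \<Phi> t y) has_vector_derivative f (\<Phi> t y)) (at t within {-\<delta>..\<delta>})"
        "\<And>t y. t \<in> {-\<delta>..\<delta>} \<Longrightarrow> y \<in> ball (ch p x) r \<Longrightarrow> (\<Phi> t has_derivative blinfun_apply (A t y)) (at y)"
        "continuous_on ({-\<delta>..\<delta>} \<times> ball (ch p x) r) (\<lambda>(t, y). \<Phi> t y)"
        "continuous_on ({-\<delta>..\<delta>} \<times> ball (ch p x) r) (\<lambda>(t, y). A t y)"
      let ?I = "{-\<delta>..\<delta>}"
      define W where "W = cdom p \<inter> ch p -` ball (ch p x) r"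
      have W: "open W"
        unfolding W_def by (rule continuous_open_preimage[OF homeomorphism_cont1[OF homeo] open_dom open_ball])
      have chW: "ch p ` W \<subseteq> ball (ch p x) r" by (auto simp: W_def)
      \<comment> \<open>The Euclidean solution, pulled back by the chart, is an integral curve
        inside the interior; uniqueness identifies its end point with the flow.\<close>
      have fl: "good t y \<and> fl t y = ich p (\<Phi> t (ch p y))" if y: "y \<in> W" and t: "t \<in> ?I" for y t
      proof -
        let ?z = "ch p y"
        have z: "?z \<in> ball (ch p x) r" "y \<in> cdom p" using y by (auto simp: W_def)
        define \<gamma> where "\<gamma> s = ich p (\<Phi> s ?z)" for s
        have im: "\<Phi> s ?z \<in> ball (ch p x) R" "\<Phi> s ?z \<in> chart_image M p" if "s \<in> ?I" for s
          using L(4)[OF that z(1)] R(2) by auto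
        have c\<Phi>: "continuous_on ?I (\<lambda>s. \<Phi> s ?z)"
          using L(6)[OF _ z(1)] by (meson continuous_on_eq_continuous_within has_vector_derivative_continuous)
        have "integral_curve M X ?I \<gamma>"
        proof (rule integral_curve_from_chart)
          show "continuous_on ?I \<gamma>"
            unfolding \<gamma>_def by (rule continuous_on_compose2[OF homeomorphism_cont2[OF homeo] c\<Phi>]) (use im in auto)
          show "\<gamma> s \<in> cdom p" if "s \<in> ?I" for s using im[OF that] by (simp add: \<gamma>_def)
          fix s assume s: "s \<in> ?I"
          have "f (\<Phi> s ?z) = cc (\<gamma> s) p (\<gamma> s) (X (\<gamma> s))" using R(4)[OF im(1)[OF s]] by (simp add: \<gamma>_def)
          then have "((\<lambda>s. \<Phi> s ?z) has_vector_derivative cc (\<gamma> s) p (\<gamma> s) (X (\<gamma> s))) (at s within ?I)"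
            using L(6)[OF s z(1)] by simp
          then show "((\<lambda>s. ch p (\<gamma> s)) has_vector_derivative cc (\<gamma> s) p (\<gamma> s) (X (\<gamma> s))) (at s within ?I)"
            by (rule has_vector_derivative_transform[OF s, rotated]) (use im in \<open>simp add: \<gamma>_def\<close>)
        qed
        then have c: "integral_curve M X (closed_segment 0 t) \<gamma>"
          by (rule integral_curve_subset) (use t L(1) in \<open>auto simp: closed_segment_eq_real_ivl split: if_splits\<close>)
        have \<gamma>0: "\<gamma> 0 = y" using L(5)[OF z(1)] z(2) by (simp add: \<gamma>_def)
        have \<gamma>in: "\<gamma> s \<in> interior_points" if "s \<in> closed_segment 0 t" for s
        proof -
          have s: "s \<in> ?I" using that t L(1) by (auto simp: closed_segment_eq_real_ivl split: if_splits)
          then have "0 < ch p (\<gamma> s) \<bullet> inner_normal" "\<gamma> s \<in> cdom p"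
            using R(3)[OF im(1)[OF s]] im(2)[OF s] by (auto simp: \<gamma>_def)
          then show ?thesis by (intro interior_pointsI)
        qed
        have "fl t y = \<gamma> t" by (rule flow_eq[OF c \<gamma>0 \<gamma>in])
        moreover have "good t y" unfolding good_def using c \<gamma>0 \<gamma>in by blast
        ultimately show ?thesis by (simp add: \<gamma>_def)
      qed
      have "flow_box p W \<delta> \<Phi> A"
        unfolding flow_box_def
      proof (intro conjI ballI)
        show "continuous_on (?I \<times> ch p ` W) (\<lambda>(t, z). \<Phi> t z)"
          by (rule continuous_on_subset[OF L(8)]) (use chW in blast)
        show "continuous_on (?I \<times> ch p ` W) (\<lambda>(t, z). A t z)"
          by (rule continuous_on_subset[OF L(9)]) (use chW in blast)
        fix y t assume yt: "y \<in> W" "t \<in> ?I"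
        then have z: "ch p y \<in> ball (ch p x) r" using chW by blast
        show "\<Phi> t (ch p y) \<in> chart_image M p" using L(4)[OF yt(2) z] R(2) by blast
        show "(\<Phi> t has_derivative blinfun_apply (A t (ch p y))) (at (ch p y))" by (rule L(7)[OF yt(2) z])
      qed (use W L(1) fl in \<open>auto simp: W_def\<close>)
      moreover have "x \<in> W" using p L(2) by (simp add: W_def)
      ultimately show ?thesis by blast
    qed
  qed
qed

lemma flow_box_flow_tendsto:
  assumes b: "flow_box p W \<delta> \<Phi> A" and x: "x \<in> W" and y: "(y \<longlongrightarrow> x) F"
    and t: "(\<tau> \<longlongrightarrow> t) F" "\<forall>\<^sub>F k in F. \<tau> k \<in> {-\<delta>..\<delta>}" "t \<in> {-\<delta>..\<delta>}"
  shows "((\<lambda>k. fl (\<tau> k) (y k)) \<longlongrightarrow> fl t x) F" "((\<lambda>k. A (\<tau> k) (ch p (y k))) \<longlongrightarrow> A t (ch p x)) F"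
    "\<forall>\<^sub>F k in F. y k \<in> W"
proof -
  let ?I = "{-\<delta>..\<delta>}"
  note D = flow_boxD[OF b]
  have W: "open W" "W \<subseteq> cdom p" by (fact D)+
  show ev: "\<forall>\<^sub>F k in F. y k \<in> W" by (rule topological_tendstoD[OF y W(1) x])
  have chy: "((\<lambda>k. ch p (y k)) \<longlongrightarrow> ch p x) F"
    using isCont_tendsto_compose[OF isCont_ch y] x W(2) by blast
  have pair: "((\<lambda>k. (\<tau> k, ch p (y k))) \<longlongrightarrow> (t, ch p x)) F" by (rule tendsto_Pair[OF t(1) chy])
  have ev2: "\<forall>\<^sub>F k in F. (\<tau> k, ch p (y k)) \<in> ?I \<times> ch p ` W"
    using ev t(2) by eventually_elim auto
  have mem: "(t, ch p x) \<in> ?I \<times> ch p ` W" using t(3) x by auto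
  from continuous_on_tendsto_compose[OF D(9) pair mem ev2]
  show "((\<lambda>k. A (\<tau> k) (ch p (y k))) \<longlongrightarrow> A t (ch p x)) F" by simp
  from continuous_on_tendsto_compose[OF D(8) pair mem ev2]
  have \<Phi>: "((\<lambda>k. \<Phi> (\<tau> k) (ch p (y k))) \<longlongrightarrow> \<Phi> t (ch p x)) F" by simp
  have "((\<lambda>k. ich p (\<Phi> (\<tau> k) (ch p (y k)))) \<longlongrightarrow> ich p (\<Phi> t (ch p x))) F"
  proof (rule continuous_on_tendsto_compose[OF homeomorphism_cont2[OF homeo] \<Phi>])
    show "\<Phi> t (ch p x) \<in> chart_image M p" by (rule D(4)[OF x t(3)])
    show "\<forall>\<^sub>F k in F. \<Phi> (\<tau> k) (ch p (y k)) \<in> chart_image M p"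
      using ev t(2) by eventually_elim (rule D(4))
  qed
  then have "((\<lambda>k. fl (\<tau> k) (y k)) \<longlongrightarrow> ich p (\<Phi> t (ch p x))) F"
    by (rule Lim_transform_eventually) (use ev t(2) in \<open>eventually_elim, simp only: D(6)\<close>)
  then show "((\<lambda>k. fl (\<tau> k) (y k)) \<longlongrightarrow> fl t x) F" unfolding D(6)[OF x t(3)] .
qed

lemma flow_box_reg:
  assumes b: "flow_box p W \<delta> \<Phi> A" and y: "y \<in> W" and t: "t \<in> {-\<delta>..\<delta>}"
  shows "reg t y" "fl t y \<in> cdom p" "cc (fl t y) p (fl t y) (Dfl t y v) = A t (ch p y) (cc y p y v)"
proof -
  note D = flow_boxD[OF b]
  have W: "open W" "W \<subseteq> cdom p" by (fact D)+
  have yp: "y \<in> cdom p" using W y by blast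
  show flp: "fl t y \<in> cdom p" unfolding D(6)[OF y t] by (rule ich_mem[OF D(4)[OF y t]])
  have evW: "\<forall>\<^sub>F z in nhds y. z \<in> W" using W(1) y by (simp add: eventually_nhds_in_open)
  have cont: "isCont (fl t) y"
    unfolding isCont_def by (rule flow_box_flow_tendsto(1)[OF b y]) (use t in auto)
  have d: "(\<Phi> t has_derivative blinfun_apply (A t (ch p y))) (at (ch p y) within H)"
    by (rule has_derivative_at_withinI[OF D(7)[OF y t]])
  have "((\<lambda>z. ch p (fl t (ich p z))) has_derivative blinfun_apply (A t (ch p y))) (at (ch p y) within H)"
  proof (rule has_derivative_transform_eventually[OF d])
    show "\<forall>\<^sub>F z in at (ch p y) within H. \<Phi> t z = ch p (fl t (ich p z))"
      using eventually_chart_image[OF yp] eventually_nhds_imp_chart[OF yp evW]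
    proof eventually_elim
      case (elim z)
      show ?case using D(4)[OF elim(2) t] elim(1) unfolding D(6)[OF elim(2) t] by simp
    qed
    show "\<Phi> t (ch p y) = ch p (fl t (ich p (ch p y)))"
      using D(4)[OF y t] yp by (simp add: D(6)[OF y t])
  qed (use yp in simp)
  then have m: "mderiv p p (fl t) (blinfun_apply (A t (ch p y))) y" using yp flp cont by (simp add: mderiv_def)
  have "mderiv y p (fl t) (\<lambda>v. A t (ch p y) (cc y p y v)) y"
    using mderiv_comp[OF mderiv_id[OF mem_dom yp] m] .
  from mderiv_comp[OF this mderiv_id[OF flp mem_dom]]
  have m2: "mderiv y (fl t y) (fl t) (\<lambda>v. cc p (fl t y) (fl t y) (A t (ch p y) (cc y p y v))) y" .
  have "\<forall>\<^sub>F z in nhds y. good t z"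
    using evW by eventually_elim (rule D(5)[OF _ t])
  then show "reg t y" using m2 by (auto simp: reg_def)
  show "cc (fl t y) p (fl t y) (Dfl t y v) = A t (ch p y) (cc y p y v)"
    using flp by (simp add: Dflow_eq[OF m2] cc_cc)
qed

text \<open>\<open>A\<close> is jointly continuous and is applied bilinearly; by
  \<open>tb_lim_chart\<close> both the given and the image vectors may be read in the chart
  \<open>p\<close> of the box.\<close>

lemma flow_box_tb_lim:
  assumes b: "flow_box p W \<delta> \<Phi> A" and x: "x \<in> W" and y: "tb_lim y v x w F"
    and t: "(\<tau> \<longlongrightarrow> t) F" "\<forall>\<^sub>F k in F. \<tau> k \<in> {-\<delta>..\<delta>}" "t \<in> {-\<delta>..\<delta>}"
  shows "tb_lim (\<lambda>k. fl (\<tau> k) (y k)) (\<lambda>k. Dfl (\<tau> k) (y k) (v k)) (fl t x) (Dfl t x w) F"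
proof -
  have yx: "(y \<longlongrightarrow> x) F" using y by (simp add: tb_lim_def)
  note L = flow_box_flow_tendsto[OF b x yx t]
  have xp: "x \<in> cdom p" using flow_boxD(2)[OF b] x by blast
  have "((\<lambda>k. cc (y k) p (y k) (v k)) \<longlongrightarrow> cc x p x w) F" using y tb_lim_chart[OF xp] by blast
  from bounded_bilinear.tendsto[OF bounded_bilinear_blinfun_apply L(2) this]
  have "((\<lambda>k. cc (fl (\<tau> k) (y k)) p (fl (\<tau> k) (y k)) (Dfl (\<tau> k) (y k) (v k))) \<longlongrightarrow> A t (ch p x) (cc x p x w)) F"
    by (rule Lim_transform_eventually) (use L(3) t(2) in \<open>eventually_elim, simp add: flow_box_reg(3)[OF b]\<close>)
  then show ?thesis
    unfolding tb_lim_chart[OF flow_box_reg(2)[OF b x t(3)]] flow_box_reg(3)[OF b x t(3)] using L(1) by blast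
qed

end

section \<open>The flow and its derivative over the invariant set\<close>

locale flow_system = riemannian_field M X
  for M :: "('m::{t2_space,second_countable_topology}, 'e::euclidean_space) manifold_data" and X +
  fixes \<Lambda> :: "'m set"
  assumes inward: "inwardly_transverse M X" and compact: "compact \<Lambda>" and invariant: "invariant_set M X \<Lambda>"
begin

text \<open>An integral curve cannot reach the boundary in positive time: there it would have come from outside
  the half-space.\<close>

lemma curve_end_interior:
  assumes \<gamma>: "integral_curve M X J \<gamma>" and J: "{s - e..s} \<subseteq> J" "0 < e"
  shows "\<gamma> s \<in> interior_points"
proof (rule ccontr)
  assume "\<gamma> s \<notin> interior_points"
  then have "\<not> 0 < ch (\<gamma> s) (\<gamma> s) \<bullet> inner_normal" using interior_pointsI[OF mem_dom] by blast
  moreover have "ch (\<gamma> s) (\<gamma> s) \<in> H" by simp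
  ultimately have zero: "ch (\<gamma> s) (\<gamma> s) \<bullet> inner_normal = 0" by (simp add: half_space_def)
  then have pos: "0 < X (\<gamma> s) \<bullet> inner_normal"
    using inward by (simp add: inwardly_transverse_def boundary_points_def)
  let ?J = "{s - e..s}"
  have c: "integral_curve M X ?J \<gamma>" by (rule integral_curve_subset[OF \<gamma> J(1)])
  have "((\<lambda>u. ch (\<gamma> s) (\<gamma> u)) has_vector_derivative X (\<gamma> s)) (at s within ?J)"
    using c J(2) by (simp add: integral_curve_def)
  then have "((\<lambda>u. ch (\<gamma> s) (\<gamma> u) \<bullet> inner_normal) has_vector_derivative X (\<gamma> s) \<bullet> inner_normal) (at s within ?J)"
    by (rule bounded_linear.has_vector_derivative[OF bounded_linear_inner_left])
  then have "((\<lambda>u. ch (\<gamma> s) (\<gamma> u) \<bullet> inner_normal) has_real_derivative X (\<gamma> s) \<bullet> inner_normal) (at s within ?J)"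
    by (simp add: has_real_derivative_iff_has_vector_derivative)
  from has_real_derivative_pos_inc_left[OF this pos] obtain d where d: "0 < d"
    "\<And>h. 0 < h \<Longrightarrow> s - h \<in> ?J \<Longrightarrow> h < d \<Longrightarrow> ch (\<gamma> s) (\<gamma> (s - h)) \<bullet> inner_normal < 0"
    unfolding zero by blast
  have "(\<gamma> \<longlongrightarrow> \<gamma> s) (at s within ?J)" using c J(2) by (auto simp: integral_curve_def continuous_on_def)
  from topological_tendstoD[OF this open_dom[of "\<gamma> s"] mem_dom]
  obtain d' where d': "0 < d'" "\<And>u. u \<in> ?J \<Longrightarrow> u \<noteq> s \<Longrightarrow> dist u s < d' \<Longrightarrow> \<gamma> u \<in> cdom (\<gamma> s)"
    unfolding eventually_at by blast
  define h where "h = min (min d d') e / 2"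
  have h: "0 < h" "h < d" "h < d'" "h \<le> e" using d(1) d'(1) J(2) by (auto simp: h_def)
  have sh: "s - h \<in> ?J" using h by simp
  have "\<gamma> (s - h) \<in> cdom (\<gamma> s)" using d'(2)[OF sh] h by (simp add: dist_real_def)
  then have "ch (\<gamma> s) (\<gamma> (s - h)) \<in> H" by simp
  then show False using d(2)[OF h(1) sh h(2)] by (simp add: half_space_def)
qed

lemma defined: "x \<in> \<Lambda> \<Longrightarrow> \<exists>\<gamma>. integral_curve M X (closed_segment 0 t) \<gamma> \<and> \<gamma> 0 = x"
  using invariant by (auto simp: invariant_set_def flow_defined_def)

lemma fl_mem [simp]: "x \<in> \<Lambda> \<Longrightarrow> fl t x \<in> \<Lambda>"
  using invariant unfolding invariant_set_def by blast

text \<open>Invariance provides a past: a curve on \<open>{-1..0}\<close> ends at \<open>x\<close>,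
  and such end points are interior.\<close>

lemma \<Lambda>_interior: "x \<in> \<Lambda> \<Longrightarrow> x \<in> interior_points"
proof -
  assume "x \<in> \<Lambda>"
  then obtain \<gamma> where "integral_curve M X (closed_segment 0 (- 1)) \<gamma>" "\<gamma> 0 = x" using defined by blast
  then show ?thesis using curve_end_interior[of _ \<gamma> 0 1] by (auto simp: closed_segment_eq_real_ivl)
qed

lemma good_\<Lambda>: assumes x: "x \<in> \<Lambda>" shows "good t x"
proof (cases "0 \<le> t")
  case True
  obtain \<gamma> where \<gamma>: "integral_curve M X (closed_segment 0 t) \<gamma>" "\<gamma> 0 = x" using defined[OF x] by blast
  have "\<gamma> s \<in> interior_points" if s: "s \<in> closed_segment 0 t" for s
  proof (cases "s = 0")
    case False
    then show ?thesis
      using s True by (intro curve_end_interior[OF \<gamma>(1), of s s]) (auto simp: closed_segment_eq_real_ivl)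
  qed (use \<gamma>(2) \<Lambda>_interior[OF x] in simp)
  with \<gamma> show ?thesis unfolding good_def by blast
next
  case False
  \<comment> \<open>One unit more of the past than required, so that the earliest time
    \<open>t\<close> too is the right end of a nondegenerate interval of definition.\<close>
  obtain \<gamma> where \<gamma>: "integral_curve M X (closed_segment 0 (t - 1)) \<gamma>" "\<gamma> 0 = x" using defined[OF x] by blast
  have "integral_curve M X (closed_segment 0 t) \<gamma>"
    by (rule integral_curve_subset[OF \<gamma>(1)]) (use False in \<open>auto simp: closed_segment_eq_real_ivl\<close>)
  moreover have "\<gamma> s \<in> interior_points" if s: "s \<in> closed_segment 0 t" for s
    using s False by (intro curve_end_interior[OF \<gamma>(1), of s 1]) (auto simp: closed_segment_eq_real_ivl)
  ultimately show ?thesis using \<gamma>(2) unfolding good_def by blast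
qed

lemma fl_0 [simp]: "x \<in> \<Lambda> \<Longrightarrow> fl 0 x = x"
  using good_\<Lambda>[of x 0] by (auto elim!: goodE)

lemma fl_minus [simp]: "x \<in> \<Lambda> \<Longrightarrow> fl (- t) (fl t x) = x"
  using good_reverse(2)[OF good_\<Lambda>] .

lemma fl_add: assumes x: "x \<in> \<Lambda>" shows "fl (s + t) x = fl t (fl s x)"
proof -
  have same: "fl (s + t) x = fl t (fl s x)" if "0 \<le> s * t" "x \<in> \<Lambda>" for s t x
    using good_add(2)[OF good_\<Lambda> good_\<Lambda> that(1)] that(2) by simp
  show ?thesis
  proof (cases "0 \<le> s * t")
    case False
    show ?thesis
    \<comment> \<open>Here \<open>s\<close> and \<open>t\<close> have opposite signs. Either
      \<open>s = (s + t) + (- t)\<close> or \<open>t = (- s) + (s + t)\<close> is a sum of numbers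
      of equal sign; the law for that sum is combined with \<open>fl_minus\<close>.\<close>
    proof (cases "0 \<le> (s + t) * (- t)")
      case True
      from same[OF this x] have "fl s x = fl (- t) (fl (s + t) x)" by simp
      then show ?thesis using fl_minus[of "fl (s + t) x" "- t"] x by simp
    next
      case F2: False
      have "0 \<le> (- s) * (s + t)"
      proof -
        have "s * t < 0" using False by linarith
        then have a: "(0 < s \<and> t < 0) \<or> (s < 0 \<and> 0 < t)" by (simp only: mult_less_0_iff)
        have "(s + t) * (- t) < 0" using F2 by linarith
        then have b: "(0 < s + t \<and> - t < 0) \<or> (s + t < 0 \<and> 0 < - t)" by (simp only: mult_less_0_iff)
        from a show ?thesis
        proof
          assume "0 < s \<and> t < 0"
          then show ?thesis using b by (intro mult_nonpos_nonpos) auto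
        next
          assume "s < 0 \<and> 0 < t"
          then show ?thesis using b by (intro mult_nonneg_nonneg) auto
        qed
      qed
      from same[OF this, of "fl s x"] show ?thesis using x by simp
    qed
  qed (use same x in simp)
qed

text \<open>Compactness gives one time step that works at every point of \<Lambda>; since orbits
  stay in \<Lambda>, any time is reached by repeating it.\<close>

lemma uniform_box:
  "\<exists>\<delta>>0. \<forall>x\<in>\<Lambda>. \<exists>p W \<delta>' \<Phi> A. flow_box p W \<delta>' \<Phi> A \<and> x \<in> W \<and> \<delta> \<le> \<delta>'"
proof -
  have "\<forall>x\<in>\<Lambda>. \<exists>q. open (fst q) \<and> x \<in> fst q \<and> 0 < snd q \<and> (\<exists>p \<Phi> A. flow_box p (fst q) (snd q) \<Phi> A)"
  proof
    fix x assume "x \<in> \<Lambda>"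
    then obtain p W \<delta> \<Phi> A where "flow_box p W \<delta> \<Phi> A" "x \<in> W" using flow_box_exists \<Lambda>_interior by blast
    then show "\<exists>q. open (fst q) \<and> x \<in> fst q \<and> 0 < snd q \<and> (\<exists>p \<Phi> A. flow_box p (fst q) (snd q) \<Phi> A)"
      by (intro exI[of _ "(W, \<delta>)"]) (auto dest: flow_boxD(1,3))
  qed
  from bchoice[OF this] obtain q where "\<forall>x\<in>\<Lambda>. open (fst (q x)) \<and> x \<in> fst (q x) \<and> 0 < snd (q x) \<and>
      (\<exists>p \<Phi> A. flow_box p (fst (q x)) (snd (q x)) \<Phi> A)" by (rule exE)
  then have q: "\<And>x. x \<in> \<Lambda> \<Longrightarrow> open (fst (q x))" "\<And>x. x \<in> \<Lambda> \<Longrightarrow> x \<in> fst (q x)"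
    "\<And>x. x \<in> \<Lambda> \<Longrightarrow> 0 < snd (q x)" "\<And>x. x \<in> \<Lambda> \<Longrightarrow> \<exists>p \<Phi> A. flow_box p (fst (q x)) (snd (q x)) \<Phi> A" by fast+
  have "\<Lambda> \<subseteq> (\<Union>c\<in>\<Lambda>. fst (q c))" using q(2) by blast
  with q(1) obtain C where C: "C \<subseteq> \<Lambda>" "finite C" "\<Lambda> \<subseteq> (\<Union>c\<in>C. fst (q c))"
    by (rule compactE_image[OF compact])
  \<comment> \<open>Inserting 1 keeps the set nonempty when \<Lambda>, and with it \<open>C\<close>,
    is empty.\<close>
  define \<delta> where "\<delta> = Min (insert 1 ((\<lambda>c. snd (q c)) ` C))"
  have "0 < a" if "a \<in> insert 1 ((\<lambda>c. snd (q c)) ` C)" for a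
    using that
  proof
    assume "a \<in> (\<lambda>c. snd (q c)) ` C"
    then show ?thesis using C(1) q(3) by blast
  qed simp
  moreover have "finite (insert 1 ((\<lambda>c. snd (q c)) ` C))" using C(2) by simp
  ultimately have "0 < \<delta>" unfolding \<delta>_def by (subst Min_gr_iff) simp_all
  moreover have "\<exists>p W \<delta>' \<Phi> A. flow_box p W \<delta>' \<Phi> A \<and> x \<in> W \<and> \<delta> \<le> \<delta>'" if x: "x \<in> \<Lambda>" for x
  proof -
    have "\<exists>c\<in>C. x \<in> fst (q c)" using subsetD[OF C(3) x] by (simp only: UN_iff)
    then obtain c where c: "c \<in> C" "x \<in> fst (q c)" by (rule bexE)
    have le: "\<delta> \<le> snd (q c)" unfolding \<delta>_def using C(2) c(1) by (intro Min_le) auto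
    have "c \<in> \<Lambda>" using c(1) C(1) by (rule subsetD[rotated])
    from q(4)[OF this] show ?thesis
    proof (elim exE)
      fix p \<Phi> A assume "flow_box p (fst (q c)) (snd (q c)) \<Phi> A"
      then show ?thesis using c(2) le
        by (intro exI[of _ p] exI[of _ "fst (q c)"] exI[of _ "snd (q c)"] exI[of _ \<Phi>] exI[of _ A] conjI)
    qed
  qed
  ultimately show ?thesis by (intro exI[of _ \<delta>] conjI ballI)
qed

lemma reg_\<Lambda>: assumes x: "x \<in> \<Lambda>" shows "reg t x"
proof -
  obtain \<delta> where \<delta>': "0 < \<delta> \<and> (\<forall>x\<in>\<Lambda>. \<exists>p W \<delta>' \<Phi> A. flow_box p W \<delta>' \<Phi> A \<and> x \<in> W \<and> \<delta> \<le> \<delta>')"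
    using uniform_box by (rule exE)
  note \<delta> = \<delta>'[THEN conjunct1] \<delta>'[THEN conjunct2, rule_format]
  have small: "reg s y" if y: "y \<in> \<Lambda>" and s: "\<bar>s\<bar> \<le> \<delta>" for s y
  proof -
    obtain p W \<delta>' \<Phi> A where b: "flow_box p W \<delta>' \<Phi> A" "y \<in> W" "\<delta> \<le> \<delta>'" using \<delta>(2)[OF y] by (elim exE conjE)
    show ?thesis by (rule flow_box_reg(1)[OF b(1,2)]) (use b(3) s in auto)
  qed
  obtain n :: nat where n: "\<bar>t\<bar> < real n * \<delta>" using reals_Archimedean3[OF \<delta>(1)] by blast
  then have n0: "0 < n" by (cases n) auto
  define \<tau> where "\<tau> = t / real n"
  have \<tau>: "\<bar>\<tau>\<bar> \<le> \<delta>" using n n0 by (simp add: \<tau>_def abs_divide field_simps)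
  have "reg (real j * \<tau>) x" for j
  proof (induction j)
    case (Suc j)
    have "0 \<le> real j * \<tau> * \<tau>" by (simp add: mult.assoc)
    from reg_add(1)[OF Suc small[OF fl_mem[OF x] \<tau>] this] show ?case by (simp add: algebra_simps)
  qed (use small[OF x, of 0] \<delta>(1) in simp)
  from this[of n] show ?thesis using n0 by (simp add: \<tau>_def)
qed

lemma Dfl_add: "x \<in> \<Lambda> \<Longrightarrow> 0 \<le> s * t \<Longrightarrow> Dfl (s + t) x v = Dfl t (fl s x) (Dfl s x v)"
  using reg_add(2)[OF reg_\<Lambda> reg_\<Lambda>] by simp

lemma Dfl_minus: "x \<in> \<Lambda> \<Longrightarrow> Dfl (- t) (fl t x) (Dfl t x v) = v"
  using reg_reverse[OF reg_\<Lambda> reg_\<Lambda>] by simp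

lemma Dfl_linear: "x \<in> \<Lambda> \<Longrightarrow> linear (Dfl t x)"
  using reg_linear[OF reg_\<Lambda>] .

lemma Dfl_0: "x \<in> \<Lambda> \<Longrightarrow> Dfl 0 x v = v"
  using Dfl_add[of x 0 0 v] Dfl_minus[of x 0 v] by simp

text \<open>Joint continuity of the tangent flow. The number \<open>n\<close> of steps depends only
  on the limit time \<open>t\<close>; every \<open>\<tau> k\<close> is cut into this same number of
  steps, whose lengths tend to \<open>t / n\<close>, within the uniform box time.\<close>

lemma tb_lim_flow:
  assumes y: "tb_lim y v x w F" "\<forall>\<^sub>F k in F. y k \<in> \<Lambda>" "x \<in> \<Lambda>" and t: "(\<tau> \<longlongrightarrow> t) F"
  shows "tb_lim (\<lambda>k. fl (\<tau> k) (y k)) (\<lambda>k. Dfl (\<tau> k) (y k) (v k)) (fl t x) (Dfl t x w) F"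
proof -
  obtain \<delta> where \<delta>': "0 < \<delta> \<and> (\<forall>x\<in>\<Lambda>. \<exists>p W \<delta>' \<Phi> A. flow_box p W \<delta>' \<Phi> A \<and> x \<in> W \<and> \<delta> \<le> \<delta>')"
    using uniform_box by (rule exE)
  note \<delta> = \<delta>'[THEN conjunct1] \<delta>'[THEN conjunct2, rule_format]
  have small: "tb_lim (\<lambda>k. fl (\<sigma> k) (y k)) (\<lambda>k. Dfl (\<sigma> k) (y k) (v k)) (fl s x) (Dfl s x w) F"
    if y: "tb_lim y v x w F" "x \<in> \<Lambda>" and s: "(\<sigma> \<longlongrightarrow> s) F" "\<bar>s\<bar> < \<delta>" for y v x w \<sigma> s
  proof -
    obtain p W \<delta>' \<Phi> A where b: "flow_box p W \<delta>' \<Phi> A" "x \<in> W" "\<delta> \<le> \<delta>'" using \<delta>(2)[OF y(2)] by (elim exE conjE)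
    have "s \<in> {-\<delta><..<\<delta>}" using s(2) by auto
    from topological_tendstoD[OF s(1) open_greaterThanLessThan this]
    have "\<forall>\<^sub>F k in F. \<sigma> k \<in> {-\<delta>'..\<delta>'}" by eventually_elim (use b(3) in auto)
    then show ?thesis by (rule flow_box_tb_lim[OF b(1,2) y(1) s(1)]) (use s(2) b(3) in auto)
  qed
  obtain n :: nat where n: "\<bar>t\<bar> < real n * \<delta>" using reals_Archimedean3[OF \<delta>(1)] by blast
  then have n0: "0 < n" by (cases n) auto
  have t': "\<bar>t / real n\<bar> < \<delta>" using n n0 by (simp add: abs_divide field_simps)
  have \<tau>': "((\<lambda>k. \<tau> k / real n) \<longlongrightarrow> t / real n) F" using t by (intro tendsto_intros) (use n0 in auto)
  have step: "fl (real (Suc j) * s) z = fl s (fl (real j * s) z) \<and>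
      Dfl (real (Suc j) * s) z u = Dfl s (fl (real j * s) z) (Dfl (real j * s) z u)" if "z \<in> \<Lambda>" for j s z u
  proof -
    have eq: "real (Suc j) * s = real j * s + s" by (simp add: algebra_simps)
    have "0 \<le> real j * s * s" by (simp add: mult.assoc)
    then show ?thesis unfolding eq using fl_add[OF that] Dfl_add[OF that] by blast
  qed
  have "tb_lim (\<lambda>k. fl (real j * (\<tau> k / real n)) (y k)) (\<lambda>k. Dfl (real j * (\<tau> k / real n)) (y k) (v k))
      (fl (real j * (t / real n)) x) (Dfl (real j * (t / real n)) x w) F" for j
  proof (induction j)
    case 0
    have e: "\<forall>\<^sub>F k in F. fl 0 (y k) = y k \<and> Dfl 0 (y k) (v k) = v k"
      using y(2) by eventually_elim (simp add: Dfl_0)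
    have a: "((\<lambda>k. fl 0 (y k)) \<longlongrightarrow> x) F"
      by (rule Lim_transform_eventually[of y]) (use y(1) e in \<open>auto simp: tb_lim_def elim: eventually_mono\<close>)
    have "((\<lambda>k. cc (y k) x (y k) (v k)) \<longlongrightarrow> w) F" using y(1) by (simp add: tb_lim_def)
    then have "((\<lambda>k. cc (fl 0 (y k)) x (fl 0 (y k)) (Dfl 0 (y k) (v k))) \<longlongrightarrow> w) F"
      by (rule Lim_transform_eventually) (use e in \<open>eventually_elim, simp\<close>)
    with a show ?case using y(3) by (simp add: tb_lim_def Dfl_0)
  next
    case (Suc j)
    let ?y = "\<lambda>k. fl (real j * (\<tau> k / real n)) (y k)" and ?v = "\<lambda>k. Dfl (real j * (\<tau> k / real n)) (y k) (v k)"
    let ?x = "fl (real j * (t / real n)) x" and ?w = "Dfl (real j * (t / real n)) x w"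
    have L: "tb_lim (\<lambda>k. fl (\<tau> k / real n) (?y k)) (\<lambda>k. Dfl (\<tau> k / real n) (?y k) (?v k))
        (fl (t / real n) ?x) (Dfl (t / real n) ?x ?w) F"
      by (rule small[OF Suc fl_mem[OF y(3)] \<tau>' t'])
    have e: "\<forall>\<^sub>F k in F. fl (\<tau> k / real n) (?y k) = fl (real (Suc j) * (\<tau> k / real n)) (y k) \<and>
        Dfl (\<tau> k / real n) (?y k) (?v k) = Dfl (real (Suc j) * (\<tau> k / real n)) (y k) (v k)"
      using y(2) by eventually_elim (simp only: step)
    have z: "fl (real (Suc j) * (t / real n)) x = fl (t / real n) ?x"
      "Dfl (real (Suc j) * (t / real n)) x w = Dfl (t / real n) ?x ?w" using step[OF y(3)] by blast+
    show ?case
      unfolding z tb_lim_def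
    proof
      show "((\<lambda>k. fl (real (Suc j) * (\<tau> k / real n)) (y k)) \<longlongrightarrow> fl (t / real n) ?x) F"
        by (rule Lim_transform_eventually[of "\<lambda>k. fl (\<tau> k / real n) (?y k)"])
          (use L[unfolded tb_lim_def, THEN conjunct1] e in \<open>blast intro: eventually_mono\<close>)+
      from L[unfolded tb_lim_def, THEN conjunct2]
      show "((\<lambda>k. cc (fl (real (Suc j) * (\<tau> k / real n)) (y k)) (fl (t / real n) ?x)
          (fl (real (Suc j) * (\<tau> k / real n)) (y k)) (Dfl (real (Suc j) * (\<tau> k / real n)) (y k) (v k))) \<longlongrightarrow>
          Dfl (t / real n) ?x ?w) F"
        by (rule Lim_transform_eventually) (use e in \<open>eventually_elim, metis\<close>)
    qed
  qed
  from this[of n] show ?thesis using n0 by simp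
qed

lemma continuous_fl_time: assumes x: "x \<in> \<Lambda>" shows "continuous_on UNIV (\<lambda>t. fl t x)"
  unfolding continuous_on_def
proof
  fix t :: real
  \<comment> \<open>The zero vector is carried along only to read off the base points.\<close>
  have "tb_lim (\<lambda>_. x) (\<lambda>_. 0) x 0 (at t)" using linear_0[OF linear_cc[of x x x]] by (simp add: tb_lim_def)
  from tb_lim_flow[OF this _ x, of "\<lambda>s. s" t] x show "((\<lambda>s. fl s x) \<longlongrightarrow> fl t x) (at t)"
    by (simp add: tb_lim_def)
qed

lemma continuous_fl_space: "continuous_on \<Lambda> (fl t)"
  using isCont_flow[OF reg_\<Lambda>] by (simp add: continuous_at_imp_continuous_on)

end

section \<open>Invariant subbundles\<close>

lemma filterlim_subseq_comp:
  fixes f :: "nat \<Rightarrow> 'a"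
  shows "strict_mono r \<Longrightarrow> filterlim f F sequentially \<Longrightarrow> filterlim (\<lambda>k. f (r k)) F sequentially"
  using filterlim_compose[OF _ filterlim_subseq] by blast

lemma infinite_imp_subseq:
  assumes "\<not> (\<forall>\<^sub>F k in sequentially. P k)"
  obtains r where "strict_mono (r :: nat \<Rightarrow> nat)" "\<And>k. \<not> P (r k)"
proof -
  have "\<exists>\<^sub>\<infinity>k. \<not> P k" using assms by (simp add: frequently_def cofinite_eq_sequentially)
  then have inf: "infinite {k. \<not> P k}" by (simp add: frequently_cofinite)
  show ?thesis
    by (rule that[of "enumerate {k. \<not> P k}"])
      (use strict_mono_enumerate[OF inf] enumerate_in_set[OF inf] in auto)
qed

lemma divide_inverse_mult_cancel:
  fixes c n :: real
  assumes "c \<noteq> 0"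
  shows "c / (inverse n * c) = n"
  by (rule trans[OF nonzero_divide_mult_cancel_right[OF assms]])
     (simp only: divide_inverse mult_1_left inverse_inverse_eq)

context flow_system
begin

lemma seq_compact_\<Lambda>:
  assumes "\<And>k::nat. y k \<in> \<Lambda>"
  obtains x r where "x \<in> \<Lambda>" "strict_mono (r :: nat \<Rightarrow> nat)" "(\<lambda>k. y (r k)) \<longlonglongrightarrow> x"
proof -
  have "seq_compact \<Lambda>" using compact by (rule compact_imp_seq_compact)
  moreover have "\<forall>k. y k \<in> \<Lambda>" using assms by blast
  ultimately obtain x r where "x \<in> \<Lambda>" "strict_mono (r :: nat \<Rightarrow> nat)" "(y \<circ> r) \<longlonglongrightarrow> x"
    by (rule seq_compactE)
  then show ?thesis by (intro that[of x r]) (simp_all add: o_def)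
qed

text \<open>No bound on the coordinates of the unit vectors is needed: their norms converge because the
  normalized coordinates subconverge.\<close>

lemma unit_vectors_subconverge:
  assumes y: "y \<longlonglongrightarrow> x" and v: "\<And>k::nat. tangent_norm M (y k) (v k) = 1"
  obtains r w where "strict_mono (r :: nat \<Rightarrow> nat)" "tb_lim (\<lambda>k. y (r k)) (\<lambda>k. v (r k)) x w sequentially"
    "tangent_norm M x w = 1"
proof -
  define u where "u k = cc (y k) x (y k) (v k)" for k
  have dom: "\<forall>\<^sub>F k in sequentially. y k \<in> cdom x" by (rule eventually_mem_dom[OF y mem_dom])
  have u0: "\<forall>\<^sub>F k in sequentially. u k \<noteq> 0"
    using dom
  proof eventually_elim
    case (elim k)
    have lin: "linear (cc x (y k) (y k))" by (rule linear_cc[OF elim mem_dom])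
    have "v k \<noteq> 0" using v[of k] tangent_norm_scaleR[of "y k" 0 "v k"] by auto
    moreover have "cc x (y k) (y k) (u k) = v k" using elim by (simp add: u_def cc_cc)
    ultimately show ?case using linear_0[OF lin] by auto
  qed
  have "seq_compact (cball (0::'e) 1)" by (intro compact_imp_seq_compact compact_cball)
  moreover have "\<forall>k. sgn (u k) \<in> cball 0 1" by (simp add: norm_sgn)
  ultimately obtain z r where z: "strict_mono (r :: nat \<Rightarrow> nat)" "((\<lambda>k. sgn (u k)) \<circ> r) \<longlonglongrightarrow> z"
    by (rule seq_compactE) (rule that)
  have sz: "(\<lambda>k. sgn (u (r k))) \<longlonglongrightarrow> z" using z(2) by (simp add: o_def)
  have yr: "(\<lambda>k. y (r k)) \<longlonglongrightarrow> x" using filterlim_subseq_comp[OF z(1) y] .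
  have u0r: "\<forall>\<^sub>F k in sequentially. u (r k) \<noteq> 0" using eventually_compose_filterlim[OF u0 filterlim_subseq[OF z(1)]] .
  have domr: "\<forall>\<^sub>F k in sequentially. y (r k) \<in> cdom x" using eventually_compose_filterlim[OF dom filterlim_subseq[OF z(1)]] .
  have "(\<lambda>k. norm (sgn (u (r k)))) \<longlonglongrightarrow> norm z" using sz by (rule tendsto_norm)
  moreover have "(\<lambda>k. norm (sgn (u (r k)))) \<longlonglongrightarrow> 1"
    by (rule tendsto_eventually) (use u0r in \<open>eventually_elim, simp add: norm_sgn\<close>)
  ultimately have "norm z = 1" by (rule LIMSEQ_unique)
  then have "z \<noteq> 0" by auto
  then have c: "0 < tangent_norm M x z" by (rule tangent_norm_pos)
  have "tb_lim (\<lambda>k. y (r k)) (\<lambda>k. (1 / norm (u (r k))) *\<^sub>R v (r k)) x z sequentially"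
    unfolding tb_lim_def
  proof (intro conjI yr Lim_transform_eventually[OF sz])
    show "\<forall>\<^sub>F k in sequentially. sgn (u (r k)) = cc (y (r k)) x (y (r k)) ((1 / norm (u (r k))) *\<^sub>R v (r k))"
      using domr by eventually_elim
        (simp add: u_def sgn_div_norm linear_scale[OF linear_cc] divide_inverse)
  qed
  from tangent_norm_tendsto[OF this]
  have inv: "(\<lambda>k. 1 / norm (u (r k))) \<longlonglongrightarrow> tangent_norm M x z" by (simp add: tangent_norm_scaleR v)
  have "(\<lambda>k. inverse (1 / norm (u (r k))) *\<^sub>R sgn (u (r k))) \<longlonglongrightarrow> inverse (tangent_norm M x z) *\<^sub>R z"
    using c by (intro tendsto_intros inv sz) auto
  then have "(\<lambda>k. u (r k)) \<longlonglongrightarrow> inverse (tangent_norm M x z) *\<^sub>R z"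
    by (rule Lim_transform_eventually) (use u0r in \<open>eventually_elim, simp add: sgn_div_norm\<close>)
  then have lim: "tb_lim (\<lambda>k. y (r k)) (\<lambda>k. v (r k)) x (inverse (tangent_norm M x z) *\<^sub>R z) sequentially"
    using yr by (simp add: tb_lim_def u_def)
  have "tangent_norm M x (inverse (tangent_norm M x z) *\<^sub>R z) = 1"
    using c by (simp add: tangent_norm_scaleR)
  with z(1) lim show ?thesis by (rule that)
qed

text \<open>Compactness by contradiction: given unit vectors stretched by more than
  \<open>k\<close>, successive subsequences make base points, times and vectors converge, and then
  the stretched norms converge as well.\<close>

lemma flow_norm_bounded:
  fixes T :: real
  obtains K where "\<And>x t v. x \<in> \<Lambda> \<Longrightarrow> \<bar>t\<bar> \<le> T \<Longrightarrow> tangent_norm M x v = 1 \<Longrightarrow> tangent_norm M (fl t x) (Dfl t x v) \<le> K"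
proof (rule ccontr)
  assume no: "\<not> thesis"
  have "\<forall>k::nat. \<exists>q. fst q \<in> \<Lambda> \<and> \<bar>fst (snd q)\<bar> \<le> T \<and> tangent_norm M (fst q) (snd (snd q)) = 1 \<and>
      real k < tangent_norm M (fl (fst (snd q)) (fst q)) (Dfl (fst (snd q)) (fst q) (snd (snd q)))"
  proof (rule allI, rule ccontr)
    fix k :: nat assume none: "\<not> (\<exists>q. fst q \<in> \<Lambda> \<and> \<bar>fst (snd q)\<bar> \<le> T \<and> tangent_norm M (fst q) (snd (snd q)) = 1 \<and>
      real k < tangent_norm M (fl (fst (snd q)) (fst q)) (Dfl (fst (snd q)) (fst q) (snd (snd q))))"
    have "tangent_norm M (fl t x) (Dfl t x v) \<le> real k"
      if q: "x \<in> \<Lambda>" "\<bar>t\<bar> \<le> T" "tangent_norm M x v = 1" for x t v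
    proof (rule ccontr)
      assume "\<not> ?thesis"
      then have "fst (x, t, v) \<in> \<Lambda> \<and> \<bar>fst (snd (x, t, v))\<bar> \<le> T \<and> tangent_norm M (fst (x, t, v)) (snd (snd (x, t, v))) = 1 \<and>
        real k < tangent_norm M (fl (fst (snd (x, t, v))) (fst (x, t, v))) (Dfl (fst (snd (x, t, v))) (fst (x, t, v)) (snd (snd (x, t, v))))"
        using q by simp
      with none show False by (rule notE[OF _ exI])
    qed
    then have thesis by (rule that)
    with no show False by contradiction
  qed
  from choice[OF this] obtain q where q: "\<forall>k::nat. fst (q k) \<in> \<Lambda> \<and> \<bar>fst (snd (q k))\<bar> \<le> T \<and>
      tangent_norm M (fst (q k)) (snd (snd (q k))) = 1 \<and>
      real k < tangent_norm M (fl (fst (snd (q k))) (fst (q k))) (Dfl (fst (snd (q k))) (fst (q k)) (snd (snd (q k))))"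
    by (rule exE)
  define y t v where "y k = fst (q k)" and "t k = fst (snd (q k))" and "v k = snd (snd (q k))" for k
  have yt: "y k \<in> \<Lambda>" "t k \<in> {-T..T}" "tangent_norm M (y k) (v k) = 1"
    "real k < tangent_norm M (fl (t k) (y k)) (Dfl (t k) (y k) (v k))" for k
    using q[THEN spec, of k] by (auto simp: y_def t_def v_def)
  obtain x r1 where x: "x \<in> \<Lambda>" "strict_mono (r1 :: nat \<Rightarrow> nat)" "(\<lambda>k. y (r1 k)) \<longlonglongrightarrow> x"
    by (rule seq_compact_\<Lambda>[OF yt(1)])
  have "seq_compact {-T..T}" by (intro compact_imp_seq_compact compact_Icc)
  moreover have "\<forall>k. t (r1 k) \<in> {-T..T}" using yt(2) by simp
  ultimately obtain s r2 where s: "strict_mono (r2 :: nat \<Rightarrow> nat)" "((\<lambda>k. t (r1 k)) \<circ> r2) \<longlonglongrightarrow> s"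
    by (rule seq_compactE) (rule that)
  let ?r = "\<lambda>k. r1 (r2 k)"
  have "(\<lambda>k. y (?r k)) \<longlonglongrightarrow> x" using filterlim_subseq_comp[OF s(1) x(3)] .
  then obtain r3 w where w: "strict_mono (r3 :: nat \<Rightarrow> nat)"
      "tb_lim (\<lambda>k. y (?r (r3 k))) (\<lambda>k. v (?r (r3 k))) x w sequentially"
    by (rule unit_vectors_subconverge[where v="\<lambda>k. v (?r k)"]) (rule yt(3))
  have t: "(\<lambda>k. t (?r (r3 k))) \<longlonglongrightarrow> s" using filterlim_subseq_comp[OF w(1)] s(2) by (simp add: o_def)
  have "tb_lim (\<lambda>k. fl (t (?r (r3 k))) (y (?r (r3 k)))) (\<lambda>k. Dfl (t (?r (r3 k))) (y (?r (r3 k))) (v (?r (r3 k))))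
      (fl s x) (Dfl s x w) sequentially"
    by (rule tb_lim_flow[OF w(2) _ x(1) t]) (simp add: yt(1))
  from tangent_norm_tendsto[OF this]
  have lim: "(\<lambda>k. tangent_norm M (fl (t (?r (r3 k))) (y (?r (r3 k)))) (Dfl (t (?r (r3 k))) (y (?r (r3 k))) (v (?r (r3 k)))))
    \<longlonglongrightarrow> tangent_norm M (fl s x) (Dfl s x w)" .
  have mono: "strict_mono (\<lambda>k. ?r (r3 k))" using x(2) s(1) w(1) by (simp add: strict_mono_def)
  have "filterlim (\<lambda>k. real (?r (r3 k))) at_top sequentially"
    using filterlim_subseq_comp[OF mono filterlim_real_sequentially] .
  then have top: "filterlim (\<lambda>k. tangent_norm M (fl (t (?r (r3 k))) (y (?r (r3 k)))) (Dfl (t (?r (r3 k))) (y (?r (r3 k))) (v (?r (r3 k)))))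
    at_top sequentially"
    by (rule filterlim_at_top_mono) (intro always_eventually allI less_imp_le yt(4))
  show False
    by (rule not_tendsto_and_filterlim_at_infinity[OF sequentially_bot lim filterlim_at_top_imp_at_infinity[OF top]])
qed

text \<open>\<open>A k\<close> moves the fibre over the limit point to the fibre over \<open>y k\<close>, in the coordinates of
  the chart at the limit point.\<close>

lemma subbundle_trivialization:
  assumes E: "continuous_subbundle M \<Lambda> E" and x: "x \<in> \<Lambda>" and y: "\<And>k::nat. y k \<in> \<Lambda>" "y \<longlonglongrightarrow> x"
  obtains A where "\<And>k. linear (A k)" "\<And>u. (\<lambda>k. A k u) \<longlonglongrightarrow> u"
    "\<forall>\<^sub>F k in sequentially. y k \<in> cdom x \<and> A k ` E x = cc (y k) x (y k) ` E (y k)"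
proof -
  from E[unfolded continuous_subbundle_def, THEN bspec, OF x]
  obtain V n s where V: "open V \<and> x \<in> V \<and> (\<forall>i<(n::nat). continuous_section M (\<Lambda> \<inter> V) (s i)) \<and>
        (\<forall>y\<in>\<Lambda> \<inter> V. inj_on (\<lambda>i. s i y) {..<n} \<and>
           independent ((\<lambda>i. s i y) ` {..<n}) \<and> span ((\<lambda>i. s i y) ` {..<n}) = E y)"
    by (elim exE)
  let ?S = "(\<lambda>i. s i x) ` {..<n}"
  have Vx: "open V" "x \<in> V" "\<And>i. i < n \<Longrightarrow> continuous_section M (\<Lambda> \<inter> V) (s i)"
    and fr: "\<And>y. y \<in> \<Lambda> \<Longrightarrow> y \<in> V \<Longrightarrow> span ((\<lambda>i. s i y) ` {..<n}) = E y"
    and S: "inj_on (\<lambda>i. s i x) {..<n}" "independent ?S"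
    using V x by auto
  \<comment> \<open>The frame at \<open>x\<close> is completed to a basis. \<open>A k\<close> will
    send it to the frame at \<open>y k\<close>, read in the chart at \<open>x\<close>, and fix the
    added vectors, so it tends to the identity on a basis.\<close>
  obtain B where B: "?S \<subseteq> B" "independent B" "UNIV \<subseteq> span B"
    by (rule maximal_independent_subset_extend[OF subset_UNIV S(2)])
  define g where "g k b = (if b \<in> ?S then cc (y k) x (y k) (s (the_inv_into {..<n} (\<lambda>i. s i x) b) (y k)) else b)" for k b
  have gs: "g k (s i x) = cc (y k) x (y k) (s i (y k))" if "i < n" for k i
    using that by (simp add: g_def the_inv_into_f_f[OF S(1)])
  define A where "A k = (SOME L. linear L \<and> (\<forall>b\<in>B. L b = g k b))" for k
  have A: "linear (A k) \<and> (\<forall>b\<in>B. A k b = g k b)" for k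
    unfolding A_def by (rule someI_ex[OF linear_independent_extend[OF B(2)]])
  then have linA: "linear (A k)" for k by blast
  have evV: "\<forall>\<^sub>F k in sequentially. y k \<in> V" by (rule topological_tendstoD[OF y(2) Vx(1,2)])
  have evD: "\<forall>\<^sub>F k in sequentially. y k \<in> cdom x" by (rule eventually_mem_dom[OF y(2) mem_dom])
  have conv: "(\<lambda>k. A k b) \<longlonglongrightarrow> b" if b: "b \<in> B" for b
  proof (cases "b \<in> ?S")
    case True
    then obtain i where i: "i < n" "b = s i x" by blast
    have c: "continuous_on (\<Lambda> \<inter> V \<inter> cdom x) (\<lambda>z. cc z x z (s i z))"
      using Vx(3)[OF i(1)] by (simp add: continuous_section_def)
    have "(\<lambda>k. cc (y k) x (y k) (s i (y k))) \<longlonglongrightarrow> cc x x x (s i x)"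
      by (rule continuous_on_tendsto_compose[OF c y(2)])
        (use x Vx(2) evV evD y(1) in \<open>auto elim: eventually_elim2\<close>)
    then show ?thesis using A b gs[OF i(1)] i(2) by simp
  next
    case False
    then show ?thesis using A b by (simp add: g_def)
  qed
  have lim: "(\<lambda>k. A k u) \<longlonglongrightarrow> u" for u
  proof -
    have "u \<in> span B" using B(3) by blast
    then show ?thesis
    proof (induction rule: span_induct_alt)
      case base
      show ?case using linear_0[OF linA] by simp
    next
      case (step c b u)
      then show ?case using conv[OF step(1)]
        by (simp add: linear_add[OF linA] linear_scale[OF linA] tendsto_add tendsto_scaleR)
    qed
  qed
  have "\<forall>\<^sub>F k in sequentially. y k \<in> cdom x \<and> A k ` E x = cc (y k) x (y k) ` E (y k)"
    using evV evD
  proof eventually_elim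
    case (elim k)
    have "A k ` E x = A k ` span ?S" using fr[OF x Vx(2)] by simp
    also have "\<dots> = span (A k ` ?S)" by (simp add: linear_span_image[OF linA])
    also have "A k ` ?S = cc (y k) x (y k) ` (\<lambda>i. s i (y k)) ` {..<n}"
    proof -
      have "A k (s i x) = cc (y k) x (y k) (s i (y k))" if "i < n" for i
        using A[of k] B(1) gs[OF that, of k] that by auto
      then show ?thesis by (auto simp: image_image)
    qed
    also have "span \<dots> = cc (y k) x (y k) ` span ((\<lambda>i. s i (y k)) ` {..<n})"
      by (rule linear_span_image[OF linear_cc[OF mem_dom elim(2)]])
    also have "\<dots> = cc (y k) x (y k) ` E (y k)" using fr[OF y(1) elim(1)] by simp
    finally show ?case using elim(2) by simp
  qed
  with linA lim show ?thesis by (rule that)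
qed

text \<open>\<open>A k w\<close> tends to \<open>w\<close> and is eventually the coordinate vector
  of some element of the fibre over \<open>y k\<close>. This is the half of continuity that bounds
  the growth at nearby points from below.\<close>

lemma subbundle_approx:
  assumes E: "continuous_subbundle M \<Lambda> E" and x: "x \<in> \<Lambda>" and y: "\<And>k::nat. y k \<in> \<Lambda>" "y \<longlonglongrightarrow> x" and w: "w \<in> E x"
  obtains v where "\<forall>\<^sub>F k in sequentially. v k \<in> E (y k)" "tb_lim y v x w sequentially"
proof -
  obtain A where A: "\<And>k. linear (A k)" "\<And>u. (\<lambda>k. A k u) \<longlonglongrightarrow> u"
    "\<forall>\<^sub>F k in sequentially. y k \<in> cdom x \<and> A k ` E x = cc (y k) x (y k) ` E (y k)"
    by (rule subbundle_trivialization[OF E x y]) (rule that)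
  define v where "v k = cc x (y k) (y k) (A k w)" for k
  have ev: "\<forall>\<^sub>F k in sequentially. v k \<in> E (y k) \<and> cc (y k) x (y k) (v k) = A k w"
    using A(3)
  proof eventually_elim
    case (elim k)
    then obtain u where u: "u \<in> E (y k)" "A k w = cc (y k) x (y k) u" using w by blast
    have "v k = u" using elim u(2) by (simp add: v_def cc_cc)
    then show ?case using u by simp
  qed
  show ?thesis
  proof (rule that[of v])
    show "\<forall>\<^sub>F k in sequentially. v k \<in> E (y k)" using ev by eventually_elim blast
    have "(\<lambda>k. cc (y k) x (y k) (v k)) \<longlonglongrightarrow> w"
      by (rule Lim_transform_eventually[OF A(2)]) (use ev in \<open>eventually_elim, simp\<close>)
    then show "tb_lim y v x w sequentially" using y(2) by (simp add: tb_lim_def)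
  qed
qed

text \<open>The vectors are pulled back by \<open>A k\<close> to \<open>u k\<close> in the closed
  subspace \<open>E x\<close>. No bound on \<open>u k\<close> is known at first, so the directions
  are made to converge before the lengths.\<close>

lemma subbundle_closed:
  assumes E: "continuous_subbundle M \<Lambda> E" and sub: "subspace (E x)" and x: "x \<in> \<Lambda>"
    and y: "\<And>k::nat. y k \<in> \<Lambda>" and v: "\<And>k. v k \<in> E (y k)" "tb_lim y v x w sequentially"
  shows "w \<in> E x"
proof (cases "w = 0")
  case False
  have yx: "y \<longlonglongrightarrow> x" using v(2) by (simp add: tb_lim_def)
  obtain A where A: "\<And>k. linear (A k)" "\<And>u. (\<lambda>k. A k u) \<longlonglongrightarrow> u"
    "\<forall>\<^sub>F k in sequentially. y k \<in> cdom x \<and> A k ` E x = cc (y k) x (y k) ` E (y k)"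
    by (rule subbundle_trivialization[OF E x y yx]) (rule that)
  have cw: "(\<lambda>k. cc (y k) x (y k) (v k)) \<longlonglongrightarrow> w" using v(2) by (simp add: tb_lim_def)
  define u where "u k = (SOME u. u \<in> E x \<and> A k u = cc (y k) x (y k) (v k))" for k
  have u: "\<forall>\<^sub>F k in sequentially. u k \<in> E x \<and> A k (u k) = cc (y k) x (y k) (v k)"
    using A(3)
  proof eventually_elim
    case (elim k)
    then have "\<exists>u. u \<in> E x \<and> A k u = cc (y k) x (y k) (v k)" using v(1)[of k] by (metis imageE imageI)
    then show ?case unfolding u_def by (rule someI_ex)
  qed
  have Au: "(\<lambda>k. A k (u k)) \<longlonglongrightarrow> w"
    by (rule Lim_transform_eventually[OF cw]) (use u in \<open>eventually_elim, simp\<close>)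
  have "\<forall>\<^sub>F k in sequentially. A k (u k) \<noteq> 0" using tendsto_imp_eventually_ne[OF Au False] .
  then have u0: "\<forall>\<^sub>F k in sequentially. u k \<noteq> 0" by eventually_elim (use linear_0[OF A(1)] in auto)
  have "seq_compact (cball (0::'e) 1)" by (intro compact_imp_seq_compact compact_cball)
  moreover have "\<forall>k. sgn (u k) \<in> cball 0 1" by (simp add: norm_sgn)
  ultimately obtain z r where z: "strict_mono (r :: nat \<Rightarrow> nat)" "((\<lambda>k. sgn (u k)) \<circ> r) \<longlonglongrightarrow> z"
    by (rule seq_compactE) (rule that)
  have sz: "(\<lambda>k. sgn (u (r k))) \<longlonglongrightarrow> z" using z(2) by (simp add: o_def)
  have u0r: "\<forall>\<^sub>F k in sequentially. u (r k) \<noteq> 0" using eventually_compose_filterlim[OF u0 filterlim_subseq[OF z(1)]] .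
  have ur: "\<forall>\<^sub>F k in sequentially. u (r k) \<in> E x \<and> A (r k) (u (r k)) = cc (y (r k)) x (y (r k)) (v (r k))"
    using eventually_compose_filterlim[OF u filterlim_subseq[OF z(1)]] .
  have "(\<lambda>k. norm (sgn (u (r k)))) \<longlonglongrightarrow> norm z" using sz by (rule tendsto_norm)
  moreover have "(\<lambda>k. norm (sgn (u (r k)))) \<longlonglongrightarrow> 1"
    by (rule tendsto_eventually) (use u0r in \<open>eventually_elim, simp add: norm_sgn\<close>)
  ultimately have nz: "norm z = 1" by (rule LIMSEQ_unique)
  have "closed (E x)" by (rule closed_subspace[OF sub])
  moreover have "\<forall>\<^sub>F k in sequentially. sgn (u (r k)) \<in> E x"
    using ur by eventually_elim (simp add: sgn_div_norm subspace_scale[OF sub])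
  ultimately have zE: "z \<in> E x" by (rule Lim_in_closed_set[OF _ _ sequentially_bot sz])
  have Az: "(\<lambda>k. A (r k) (sgn (u (r k)))) \<longlonglongrightarrow> z"
  proof (rule tendsto_linear_family[where A="\<lambda>k. A (r k)" and v="\<lambda>k. sgn (u (r k))" and ?A0.0="\<lambda>u. u"])
    show "(\<lambda>k. A (r k) b) \<longlonglongrightarrow> b" for b by (rule filterlim_subseq_comp[OF z(1) A(2)])
    show "\<forall>\<^sub>F k in sequentially. linear (A (r k))" using A(1) by (intro always_eventually allI)
    show "linear (\<lambda>u::'e. u)" by (rule linear_ident)
  qed (rule sz)
  have Aur: "(\<lambda>k. A (r k) (u (r k))) \<longlonglongrightarrow> w" by (rule filterlim_subseq_comp[OF z(1) Au])
  \<comment> \<open>The quotient equals \<open>norm (u (r k))\<close> by linearity, while numerator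
    and denominator tend to \<open>norm w\<close> and to \<open>norm z = 1\<close>; so the lengths
    converge.\<close>
  have "(\<lambda>k. norm (A (r k) (u (r k))) / norm (A (r k) (sgn (u (r k))))) \<longlonglongrightarrow> norm w / norm z"
    using nz by (intro tendsto_intros Aur Az) auto
  then have ratio: "(\<lambda>k. norm (A (r k) (u (r k))) / norm (A (r k) (sgn (u (r k))))) \<longlonglongrightarrow> norm w"
    by (simp only: nz div_by_1)
  have n: "(\<lambda>k. norm (u (r k))) \<longlonglongrightarrow> norm w"
  proof (rule Lim_transform_eventually[OF ratio])
    show "\<forall>\<^sub>F k in sequentially. norm (A (r k) (u (r k))) / norm (A (r k) (sgn (u (r k)))) = norm (u (r k))"
      using tendsto_imp_eventually_ne[OF Aur False] u0r
    proof eventually_elim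
      case (elim k)
      have "A (r k) (sgn (u (r k))) = inverse (norm (u (r k))) *\<^sub>R A (r k) (u (r k))"
        by (simp only: sgn_div_norm linear_scale[OF A(1)])
      then have 1: "norm (A (r k) (sgn (u (r k)))) = inverse (norm (u (r k))) * norm (A (r k) (u (r k)))"
        by (simp only: norm_scaleR norm_inverse abs_inverse abs_norm_cancel real_norm_def)
      have "norm (A (r k) (u (r k))) \<noteq> 0" using elim(1) by (simp only: norm_eq_zero not_False_eq_True)
      then show ?case unfolding 1 by (rule divide_inverse_mult_cancel)
    qed
  qed
  have "(\<lambda>k. norm (u (r k)) *\<^sub>R A (r k) (sgn (u (r k)))) \<longlonglongrightarrow> norm w *\<^sub>R z" by (intro tendsto_intros n Az)
  then have "(\<lambda>k. A (r k) (u (r k))) \<longlonglongrightarrow> norm w *\<^sub>R z"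
  proof (rule Lim_transform_eventually)
    show "\<forall>\<^sub>F k in sequentially. norm (u (r k)) *\<^sub>R A (r k) (sgn (u (r k))) = A (r k) (u (r k))"
      using u0r
    proof eventually_elim
      case (elim k)
      have "norm (u (r k)) *\<^sub>R A (r k) (sgn (u (r k))) = A (r k) (norm (u (r k)) *\<^sub>R sgn (u (r k)))"
        by (simp only: linear_scale[OF A(1)])
      also have "norm (u (r k)) *\<^sub>R sgn (u (r k)) = u (r k)" using elim by (simp add: sgn_div_norm)
      finally show ?case .
    qed
  qed
  from LIMSEQ_unique[OF Aur this] show ?thesis
    using subspace_scale[OF sub zE, of "norm w"] by (rule ssubst)
qed (use subspace_0[OF sub] in simp)

end

section \<open>Growth of the flow on an invariant subbundle\<close>

context flow_system
begin

abbreviation "nrm \<equiv> tangent_norm M"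

definition inv_bundle :: "('m \<Rightarrow> 'e set) \<Rightarrow> bool" where
  "inv_bundle E \<longleftrightarrow> continuous_subbundle M \<Lambda> E \<and>
     (\<forall>x\<in>\<Lambda>. subspace (E x) \<and> E x \<noteq> {0} \<and> (\<forall>t. Dfl t x ` E x = E (fl t x)))"

text \<open>Used with both signs of \<open>t\<close>: at \<open>- t\<close> and the point
  \<open>fl t x\<close> it is the second factor in the definition of domination.\<close>

definition growth :: "('m \<Rightarrow> 'e set) \<Rightarrow> real \<Rightarrow> 'm \<Rightarrow> real" where
  "growth E t x = op_norm M x (fl t x) (Dfl t x) (E x)"

lemma inv_bundleD:
  assumes "inv_bundle E"
  shows "continuous_subbundle M \<Lambda> E" "\<And>x. x \<in> \<Lambda> \<Longrightarrow> subspace (E x)" "\<And>x. x \<in> \<Lambda> \<Longrightarrow> E x \<noteq> {0}"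
    "\<And>x t. x \<in> \<Lambda> \<Longrightarrow> Dfl t x ` E x = E (fl t x)"
  using assms by (simp_all add: inv_bundle_def)

lemma inv_bundle_mem: "inv_bundle E \<Longrightarrow> x \<in> \<Lambda> \<Longrightarrow> v \<in> E x \<Longrightarrow> Dfl t x v \<in> E (fl t x)"
  using inv_bundleD(4) by blast

lemma normalize:
  assumes "v \<noteq> 0"
  shows "nrm x (inverse (nrm x v) *\<^sub>R v) = 1" "nrm x v *\<^sub>R (inverse (nrm x v) *\<^sub>R v) = v"
proof -
  have "nrm x v \<noteq> 0" using tangent_norm_pos[OF assms, of x] by linarith
  then show "nrm x (inverse (nrm x v) *\<^sub>R v) = 1"
    by (simp only: tangent_norm_scaleR abs_inverse abs_of_nonneg[OF tangent_norm_nonneg] left_inverse not_False_eq_True)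
  show "nrm x v *\<^sub>R (inverse (nrm x v) *\<^sub>R v) = v"
    using \<open>nrm x v \<noteq> 0\<close> by (simp only: scaleR_scaleR right_inverse scaleR_one not_False_eq_True)
qed

lemma tangent_norm_0: "nrm x 0 = 0"
  using tangent_norm_scaleR[of x 0 0] by simp

lemma unit_vector:
  assumes E: "inv_bundle E" and x: "x \<in> \<Lambda>"
  obtains v where "v \<in> E x" "nrm x v = 1"
proof -
  obtain v where v: "v \<in> E x" "v \<noteq> 0"
    using inv_bundleD(3)[OF E x] subspace_0[OF inv_bundleD(2)[OF E x]] by blast
  show ?thesis
    by (rule that[OF subspace_scale[OF inv_bundleD(2)[OF E x] v(1)] normalize(1)[OF v(2)]])
qed

lemma bdd_unit:
  assumes x: "x \<in> \<Lambda>"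
  shows "bdd_above ((\<lambda>v. nrm (fl t x) (Dfl t x v)) ` {v\<in>E x. nrm x v = 1})"
proof -
  obtain K where K: "\<And>x s v. x \<in> \<Lambda> \<Longrightarrow> \<bar>s\<bar> \<le> \<bar>t\<bar> \<Longrightarrow> nrm x v = 1 \<Longrightarrow> nrm (fl s x) (Dfl s x v) \<le> K"
    by (rule flow_norm_bounded[of "\<bar>t\<bar>"]) (rule that)
  show ?thesis by (rule bdd_aboveI2[of _ _ K]) (use K[OF x order_refl] in simp)
qed

lemma growth_unit: "x \<in> \<Lambda> \<Longrightarrow> v \<in> E x \<Longrightarrow> nrm x v = 1 \<Longrightarrow> nrm (fl t x) (Dfl t x v) \<le> growth E t x"
  unfolding growth_def op_norm_def by (rule cSUP_upper[OF _ bdd_unit]) simp_all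

lemma growth_le:
  assumes E: "inv_bundle E" and x: "x \<in> \<Lambda>"
    and K: "\<And>v. v \<in> E x \<Longrightarrow> nrm x v = 1 \<Longrightarrow> nrm (fl t x) (Dfl t x v) \<le> K"
  shows "growth E t x \<le> K"
  unfolding growth_def op_norm_def
proof (rule cSUP_least)
  obtain v where "v \<in> E x" "nrm x v = 1" by (rule unit_vector[OF E x])
  then show "{v\<in>E x. nrm x v = 1} \<noteq> {}" by blast
qed (use K in simp)

lemma less_growth:
  assumes E: "inv_bundle E" and x: "x \<in> \<Lambda>" and a: "a < growth E t x"
  obtains v where "v \<in> E x" "nrm x v = 1" "a < nrm (fl t x) (Dfl t x v)"
proof -
  have "\<not> (\<forall>v. v \<in> E x \<longrightarrow> nrm x v = 1 \<longrightarrow> nrm (fl t x) (Dfl t x v) \<le> a)"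
    using growth_le[OF E x, of t a] a by (metis not_less)
  then show ?thesis using that by (metis not_less)
qed

lemma growth_ge:
  assumes E: "inv_bundle E" and x: "x \<in> \<Lambda>" and v: "v \<in> E x"
  shows "nrm (fl t x) (Dfl t x v) \<le> growth E t x * nrm x v"
proof (cases "v = 0")
  case True
  then show ?thesis using linear_0[OF Dfl_linear[OF x]] by (simp add: tangent_norm_0)
next
  case False
  let ?u = "inverse (nrm x v) *\<^sub>R v"
  have u: "?u \<in> E x" by (rule subspace_scale[OF inv_bundleD(2)[OF E x] v])
  have "nrm (fl t x) (Dfl t x v) = nrm (fl t x) (Dfl t x (nrm x v *\<^sub>R ?u))"
    by (simp only: normalize(2)[OF False])
  also have "\<dots> = nrm x v * nrm (fl t x) (Dfl t x ?u)"
    by (simp only: linear_scale[OF Dfl_linear[OF x]] tangent_norm_scaleR abs_of_nonneg[OF tangent_norm_nonneg])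
  also have "\<dots> \<le> nrm x v * growth E t x"
    by (intro mult_left_mono growth_unit x u normalize(1)[OF False] tangent_norm_nonneg)
  finally show ?thesis by (simp only: mult.commute)
qed

lemma growth_inverse:
  assumes E: "inv_bundle E" and x: "x \<in> \<Lambda>" and v: "v \<in> E x"
  shows "nrm x v \<le> growth E (- t) (fl t x) * nrm (fl t x) (Dfl t x v)"
  using growth_ge[OF E fl_mem[OF x] inv_bundle_mem[OF E x v], of "- t" t]
  by (simp only: fl_minus[OF x] Dfl_minus[OF x])

lemma growth_pos:
  assumes E: "inv_bundle E" and x: "x \<in> \<Lambda>"
  shows "0 < growth E t x"
proof -
  obtain v where v: "v \<in> E x" "nrm x v = 1" by (rule unit_vector[OF E x])
  have "nrm (fl t x) (Dfl t x v) \<noteq> 0"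
  proof
    assume "nrm (fl t x) (Dfl t x v) = 0"
    then show False using growth_inverse[OF E x v(1), of t] v(2) by simp
  qed
  then have "0 < nrm (fl t x) (Dfl t x v)" using tangent_norm_nonneg[of "fl t x" "Dfl t x v"] by linarith
  also have "\<dots> \<le> growth E t x" by (rule growth_unit[where E=E, OF x v])
  finally show ?thesis .
qed

lemma growth_add:
  assumes E: "inv_bundle E" and x: "x \<in> \<Lambda>" and st: "0 \<le> s * t"
  shows "growth E (s + t) x \<le> growth E s x * growth E t (fl s x)"
proof (rule growth_le[OF E x])
  fix v assume v: "v \<in> E x" "nrm x v = 1"
  have "nrm (fl (s + t) x) (Dfl (s + t) x v) = nrm (fl t (fl s x)) (Dfl t (fl s x) (Dfl s x v))"
    by (simp only: fl_add[OF x] Dfl_add[OF x st])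
  also have "\<dots> \<le> growth E t (fl s x) * nrm (fl s x) (Dfl s x v)"
    by (rule growth_ge[OF E fl_mem[OF x] inv_bundle_mem[OF E x v(1)]])
  also have "\<dots> \<le> growth E t (fl s x) * growth E s x"
    by (intro mult_left_mono growth_unit[where E=E] x v less_imp_le growth_pos[OF E fl_mem])
  finally show "nrm (fl (s + t) x) (Dfl (s + t) x v) \<le> growth E s x * growth E t (fl s x)"
    by (simp only: mult.commute)
qed

text \<open>Turns an upper bound for the growth in reversed time into a lower bound, which is how
  \<open>ln_growth_bounded\<close> controls the logarithm from below.\<close>

lemma growth_minus: 
  assumes E: "inv_bundle E" and x: "x \<in> \<Lambda>"
  shows "1 \<le> growth E t x * growth E (- t) (fl t x)"
proof -
  obtain v where v: "v \<in> E x" "nrm x v = 1" by (rule unit_vector[OF E x])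
  have "1 \<le> growth E (- t) (fl t x) * nrm (fl t x) (Dfl t x v)"
    using growth_inverse[OF E x v(1), of t] v(2) by simp
  also have "\<dots> \<le> growth E (- t) (fl t x) * growth E t x"
    by (intro mult_left_mono growth_unit[where E=E] x v less_imp_le growth_pos[OF E fl_mem])
  finally show ?thesis by (simp only: mult.commute)
qed

lemma growth_0:
  assumes E: "inv_bundle E" and x: "x \<in> \<Lambda>"
  shows "growth E 0 x = 1"
proof (rule antisym)
  show "growth E 0 x \<le> 1" by (rule growth_le[OF E x]) (simp add: fl_0[OF x] Dfl_0[OF x])
  obtain v where v: "v \<in> E x" "nrm x v = 1" by (rule unit_vector[OF E x])
  show "1 \<le> growth E 0 x"
    using growth_unit[where E=E, OF x v, of 0] v(2) by (simp add: fl_0[OF x] Dfl_0[OF x])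
qed

text \<open>The co-norm is the inverse of the norm of the inverse map, which by
  \<open>Dfl_minus\<close> is DX_{-t} on the fibre over \<open>fl t x\<close>. This is what replaces
  the limsup of log m by the liminf of a subadditive cocycle.\<close>

lemma min_norm_eq:
  assumes E: "inv_bundle E" and x: "x \<in> \<Lambda>"
  shows "min_norm M x (fl t x) (Dfl t x) (E x) = inverse (growth E (- t) (fl t x))"
proof (rule antisym)
  let ?g = "growth E (- t) (fl t x)" and ?m = "min_norm M x (fl t x) (Dfl t x) (E x)"
  let ?U = "{v\<in>E x. nrm x v = 1}"
  have g: "0 < ?g" by (rule growth_pos[OF E fl_mem[OF x]])
  have lower: "inverse ?g \<le> nrm (fl t x) (Dfl t x v)" if "v \<in> ?U" for v
  proof -
    have v: "v \<in> E x" "nrm x v = 1" using that by auto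
    have "inverse ?g * 1 \<le> inverse ?g * (?g * nrm (fl t x) (Dfl t x v))"
      using growth_inverse[OF E x v(1), of t] g unfolding v(2) by (intro mult_left_mono) simp_all
    also have "\<dots> = (inverse ?g * ?g) * nrm (fl t x) (Dfl t x v)" by (simp only: mult.assoc)
    also have "inverse ?g * ?g = 1" using g by simp
    finally show ?thesis by simp
  qed
  obtain v0 where "v0 \<in> E x" "nrm x v0 = 1" by (rule unit_vector[OF E x])
  then have ne: "?U \<noteq> {}" by blast
  show ge: "inverse ?g \<le> ?m"
    unfolding min_norm_def by (rule cINF_greatest[OF ne lower])
  have m: "0 < ?m" using ge g by (simp add: less_le_trans[OF positive_imp_inverse_positive])
  have bdd: "bdd_below ((\<lambda>v. nrm (fl t x) (Dfl t x v)) ` ?U)" by (rule bdd_belowI2[OF lower])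
  have "?g \<le> inverse ?m"
  proof (rule growth_le[OF E fl_mem[OF x]])
    fix w assume w: "w \<in> E (fl t x)" "nrm (fl t x) w = 1"
    \<comment> \<open>Invariance of the bundle as an equality of fibres is used here: every unit
      vector over \<open>fl t x\<close> is the image of some vector over \<open>x\<close>.\<close>
    then obtain v where v: "v \<in> E x" "w = Dfl t x v" using inv_bundleD(4)[OF E x, of t] by blast
    have v0: "v \<noteq> 0"
    proof
      assume "v = 0"
      then have "w = 0" using v(2) linear_0[OF Dfl_linear[OF x]] by simp
      then show False using w(2) tangent_norm_0 by simp
    qed
    let ?u = "inverse (nrm x v) *\<^sub>R v"
    have "?u \<in> ?U" using subspace_scale[OF inv_bundleD(2)[OF E x] v(1)] normalize(1)[OF v0] by simp
    then have "?m \<le> nrm (fl t x) (Dfl t x ?u)" unfolding min_norm_def by (rule cINF_lower[OF bdd])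
    then have "nrm x v * ?m \<le> nrm x v * nrm (fl t x) (Dfl t x ?u)"
      by (rule mult_left_mono[OF _ tangent_norm_nonneg])
    also have "\<dots> = nrm (fl t x) (Dfl t x (nrm x v *\<^sub>R ?u))"
      by (simp only: linear_scale[OF Dfl_linear[OF x]] tangent_norm_scaleR abs_of_nonneg[OF tangent_norm_nonneg])
    also have "\<dots> = 1" using w(2) v(2) by (simp only: normalize(2)[OF v0])
    finally have le: "nrm x v * ?m \<le> 1" .
    have "?m \<noteq> 0" using m by linarith
    then have "nrm x v = (nrm x v * ?m) * inverse ?m" by (simp only: mult.assoc right_inverse mult_1_right not_False_eq_True)
    also have "\<dots> \<le> 1 * inverse ?m"
      by (rule mult_right_mono[OF le]) (rule less_imp_le[OF positive_imp_inverse_positive[OF m]])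
    finally have "nrm x v \<le> inverse ?m" by (simp only: mult_1_left)
    then show "nrm (fl (- t) (fl t x)) (Dfl (- t) (fl t x) w) \<le> inverse ?m"
      unfolding v(2) fl_minus[OF x] Dfl_minus[OF x] .
  qed
  from le_imp_inverse_le[OF this g] show "?m \<le> inverse ?g" by (simp only: inverse_inverse_eq)
qed

text \<open>From below, an almost maximal vector over \<open>x\<close> is approximated by vectors of
  nearby fibres. From above, almost maximal unit vectors over nearby points subconverge to a unit
  vector of the fibre over \<open>x\<close>.\<close>

lemma growth_continuous:
  assumes E: "inv_bundle E"
  shows "continuous_on \<Lambda> (growth E t)"
proof (rule continuous_on_sequentiallyI)
  fix y x assume y: "\<forall>n. y n \<in> \<Lambda>" and x: "x \<in> \<Lambda>" and yx: "y \<longlonglongrightarrow> x"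
  have yk: "y k \<in> \<Lambda>" for k using y by (rule spec)
  show "(\<lambda>n. growth E t (y n)) \<longlonglongrightarrow> growth E t x"
  proof (rule order_tendstoI)
    fix a assume "a < growth E t x"
    then obtain w where w: "w \<in> E x" "nrm x w = 1" "a < nrm (fl t x) (Dfl t x w)"
      by (rule less_growth[OF E x])
    obtain v where v: "\<forall>\<^sub>F k in sequentially. v k \<in> E (y k)" "tb_lim y v x w sequentially"
      by (rule subbundle_approx[OF inv_bundleD(1)[OF E] x yk yx w(1)]) (rule that)
    \<comment> \<open>The approximating vectors have norm 1 only in the limit, so the comparison is
      with \<open>a * nrm (y k) (v k)\<close> rather than with \<open>a\<close>.\<close>
    have n1: "(\<lambda>k. nrm (y k) (v k)) \<longlonglongrightarrow> 1" using tangent_norm_tendsto[OF v(2)] w(2) by simp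
    have "tb_lim (\<lambda>k. fl t (y k)) (\<lambda>k. Dfl t (y k) (v k)) (fl t x) (Dfl t x w) sequentially"
      by (rule tb_lim_flow[OF v(2) _ x tendsto_const]) (intro always_eventually allI yk)
    from tangent_norm_tendsto[OF this] n1
    have "(\<lambda>k. nrm (fl t (y k)) (Dfl t (y k) (v k)) - a * nrm (y k) (v k)) \<longlonglongrightarrow> nrm (fl t x) (Dfl t x w) - a * 1"
      by (intro tendsto_diff tendsto_mult tendsto_const)
    then have "\<forall>\<^sub>F k in sequentially. 0 < nrm (fl t (y k)) (Dfl t (y k) (v k)) - a * nrm (y k) (v k)"
      by (rule order_tendstoD(1)) (use w(3) in simp)
    moreover have "\<forall>\<^sub>F k in sequentially. 0 < nrm (y k) (v k)" by (rule order_tendstoD(1)[OF n1]) simp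
    ultimately show "\<forall>\<^sub>F k in sequentially. a < growth E t (y k)" using v(1)
    proof eventually_elim
      case (elim k)
      have "a * nrm (y k) (v k) < nrm (fl t (y k)) (Dfl t (y k) (v k))" using elim(1) by linarith
      also have "\<dots> \<le> growth E t (y k) * nrm (y k) (v k)" by (rule growth_ge[OF E yk elim(3)])
      finally show ?case by (rule mult_right_less_imp_less) (use elim(2) in linarith)
    qed
  next
    fix a assume a: "growth E t x < a"
    show "\<forall>\<^sub>F k in sequentially. growth E t (y k) < a"
    proof (rule ccontr)
      assume "\<not> ?thesis"
      then obtain r where r: "strict_mono (r :: nat \<Rightarrow> nat)" "\<And>k. \<not> growth E t (y (r k)) < a"
        by (rule infinite_imp_subseq) (rule that)
      \<comment> \<open>A strict gap survives the limit: the limit vector is stretched by at least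
        \<open>c\<close>, which exceeds the growth at \<open>x\<close>.\<close>
      obtain c where c: "growth E t x < c" "c < a" using dense[OF a] by blast
      have "\<forall>k. \<exists>v. v \<in> E (y (r k)) \<and> nrm (y (r k)) v = 1 \<and> c < nrm (fl t (y (r k))) (Dfl t (y (r k)) v)"
      proof
        fix k
        have "c < growth E t (y (r k))" using r(2)[of k] c(2) by linarith
        from less_growth[OF E yk this] show "\<exists>v. v \<in> E (y (r k)) \<and> nrm (y (r k)) v = 1 \<and> c < nrm (fl t (y (r k))) (Dfl t (y (r k)) v)"
          by (metis (no_types, lifting))
      qed
      from choice[OF this] obtain v where v': "\<forall>k. v k \<in> E (y (r k)) \<and> nrm (y (r k)) (v k) = 1 \<and>
          c < nrm (fl t (y (r k))) (Dfl t (y (r k)) (v k))" by (rule exE)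
      have v: "v k \<in> E (y (r k))" "nrm (y (r k)) (v k) = 1" "c < nrm (fl t (y (r k))) (Dfl t (y (r k)) (v k))" for k
        using spec[OF v', of k] by simp_all
      have yr: "(\<lambda>k. y (r k)) \<longlonglongrightarrow> x" by (rule filterlim_subseq_comp[OF r(1) yx])
      obtain q w where q: "strict_mono (q :: nat \<Rightarrow> nat)" and w: "tb_lim (\<lambda>k. y (r (q k))) (\<lambda>k. v (q k)) x w sequentially" "nrm x w = 1"
        by (rule unit_vectors_subconverge[OF yr v(2)]) (rule that)
      have "w \<in> E x"
        by (rule subbundle_closed[OF inv_bundleD(1)[OF E] inv_bundleD(2)[OF E x] x _ _ w(1)]) (use y v in simp_all)
      have "tb_lim (\<lambda>k. fl t (y (r (q k)))) (\<lambda>k. Dfl t (y (r (q k))) (v (q k))) (fl t x) (Dfl t x w) sequentially"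
        by (rule tb_lim_flow[OF w(1) _ x tendsto_const]) (intro always_eventually allI yk)
      from tangent_norm_tendsto[OF this] have "c \<le> nrm (fl t x) (Dfl t x w)"
        by (rule LIMSEQ_le_const) (intro exI[of _ 0] allI impI less_imp_le v(3))
      also have "\<dots> \<le> growth E t x" by (rule growth_unit[where E=E, OF x \<open>w \<in> E x\<close> w(2)])
      finally show False using c(1) by linarith
    qed
  qed
qed

text \<open>Steps of length at most 1 contribute at most \<open>C\<close> each, which gives the
  bound from above; the bound from below is the same one for the reversed time, by
  \<open>growth_minus\<close>.\<close>

lemma ln_growth_bounded:
  assumes E: "inv_bundle E"
  obtains C where "\<And>x t. x \<in> \<Lambda> \<Longrightarrow> \<bar>ln (growth E t x)\<bar> \<le> C * (\<bar>t\<bar> + 1)"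
proof -
  obtain K0 where K0: "\<And>x t v. x \<in> \<Lambda> \<Longrightarrow> \<bar>t\<bar> \<le> 1 \<Longrightarrow> nrm x v = 1 \<Longrightarrow> nrm (fl t x) (Dfl t x v) \<le> K0"
    by (rule flow_norm_bounded[of 1]) (rule that)
  define C where "C = ln (max 1 K0)"
  have C: "0 \<le> C" by (simp add: C_def)
  have short: "ln (growth E t x) \<le> C" if x: "x \<in> \<Lambda>" and t: "\<bar>t\<bar> \<le> 1" for x t
  proof -
    have "growth E t x \<le> max 1 K0"
      by (rule growth_le[OF E x]) (use K0[OF x t] in \<open>simp add: le_max_iff_disj\<close>)
    then show ?thesis unfolding C_def using growth_pos[OF E x] by (subst ln_le_cancel_iff) auto
  qed
  have upper: "ln (growth E t x) \<le> C * (\<bar>t\<bar> + 1)" if x: "x \<in> \<Lambda>" for x t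
  proof -
    define n where "n = nat \<lceil>\<bar>t\<bar>\<rceil>"
    define \<tau> where "\<tau> = t / real n"
    have n: "\<bar>t\<bar> \<le> real n" "real n \<le> \<bar>t\<bar> + 1"
      unfolding n_def by linarith+
    have t: "real n * \<tau> = t" "\<bar>\<tau>\<bar> \<le> 1"
    proof -
      show "real n * \<tau> = t"
      proof (cases "n = 0")
        case True
        then show ?thesis using n(1) by simp
      next
        case False
        then show ?thesis unfolding \<tau>_def by (simp only: times_divide_eq_right nonzero_mult_div_cancel_left of_nat_eq_0_iff not_False_eq_True)
      qed
      have "\<bar>\<tau>\<bar> = \<bar>t\<bar> / real n" by (simp only: \<tau>_def abs_divide abs_of_nat)
      also have "\<dots> \<le> 1" by (rule divide_le_eq_1[THEN iffD2]) (use n(1) in linarith)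
      finally show "\<bar>\<tau>\<bar> \<le> 1" .
    qed
    have "ln (growth E (real j * \<tau>) x) \<le> C * real j" for j
    proof (induction j)
      case 0
      then show ?case using growth_0[OF E x] by simp
    next
      case (Suc j)
      have st: "0 \<le> real j * \<tau> * \<tau>" by (simp add: mult.assoc)
      have pos: "0 < growth E (real j * \<tau>) x" "0 < growth E \<tau> (fl (real j * \<tau>) x)"
        by (rule growth_pos[OF E x], rule growth_pos[OF E fl_mem[OF x]])
      have eq: "real (Suc j) * \<tau> = real j * \<tau> + \<tau>" by (simp add: distrib_right)
      have "ln (growth E (real (Suc j) * \<tau>) x) \<le> ln (growth E (real j * \<tau>) x * growth E \<tau> (fl (real j * \<tau>) x))"
        unfolding eq by (rule ln_le_cancel_iff[THEN iffD2, OF growth_pos[OF E x] mult_pos_pos[OF pos] growth_add[OF E x st]])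
      also have "\<dots> = ln (growth E (real j * \<tau>) x) + ln (growth E \<tau> (fl (real j * \<tau>) x))"
        by (rule ln_mult_pos[OF pos])
      also have "\<dots> \<le> C * real j + C" by (intro add_mono Suc short fl_mem x t)
      finally show ?case by (simp add: distrib_left)
    qed
    from this[of n] have "ln (growth E t x) \<le> C * real n" unfolding t(1) .
    also have "\<dots> \<le> C * (\<bar>t\<bar> + 1)" by (rule mult_left_mono[OF n(2) C])
    finally show ?thesis .
  qed
  have "\<bar>ln (growth E t x)\<bar> \<le> C * (\<bar>t\<bar> + 1)" if x: "x \<in> \<Lambda>" for x t
  proof -
    have "ln 1 \<le> ln (growth E t x * growth E (- t) (fl t x))"
      by (rule ln_le_cancel_iff[THEN iffD2, OF zero_less_one
          mult_pos_pos[OF growth_pos[OF E x] growth_pos[OF E fl_mem[OF x]]] growth_minus[OF E x]])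
    then have "0 \<le> ln (growth E t x) + ln (growth E (- t) (fl t x))"
      by (simp only: ln_one ln_mult_pos[OF growth_pos[OF E x] growth_pos[OF E fl_mem[OF x]]])
    moreover have "ln (growth E (- t) (fl t x)) \<le> C * (\<bar>t\<bar> + 1)"
      using upper[OF fl_mem[OF x], of "- t"] unfolding abs_minus_cancel .
    ultimately show ?thesis using upper[OF x, of t] by linarith
  qed
  then show ?thesis by (rule that)
qed

sublocale compact_flow \<Lambda> fl
  using compact fl_add continuous_fl_time continuous_fl_space
  by unfold_locales simp_all

end

section \<open>Exponents of the two subbundles and domination\<close>

lemma Liminf_bounded_real:
  fixes f :: "real \<Rightarrow> real"
  assumes f: "\<forall>\<^sub>F t in at_top. \<bar>f t\<bar> \<le> K"
  obtains l where "Liminf at_top (\<lambda>t. ereal (f t)) = ereal l" "\<And>e. 0 < e \<Longrightarrow> \<forall>\<^sub>F t in at_top. l - e < f t"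
proof -
  let ?L = "Liminf at_top (\<lambda>t. ereal (f t))"
  have lo: "ereal (- K) \<le> ?L"
    by (rule Liminf_bounded) (use f in \<open>eventually_elim, simp add: abs_le_iff\<close>)
  have "?L \<le> Limsup at_top (\<lambda>t. ereal (f t))" by (rule Liminf_le_Limsup) simp
  also have "\<dots> \<le> ereal K"
    by (rule Limsup_bounded) (use f in \<open>eventually_elim, simp add: abs_le_iff\<close>)
  finally have hi: "?L \<le> ereal K" .
  obtain l where l: "?L = ereal l" using lo hi by (cases ?L) simp_all
  show ?thesis
  proof (rule that[OF l])
    fix e :: real assume "0 < e"
    then have "ereal (l - e) < ?L" by (simp add: l)
    then have "\<forall>\<^sub>F t in at_top. ereal (l - e) < ereal (f t)" by (rule less_LiminfD)
    then show "\<forall>\<^sub>F t in at_top. l - e < f t" by eventually_elim simp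
  qed
qed

context flow_system
begin

abbreviation expo :: "('m \<Rightarrow> 'e set) \<Rightarrow> real \<Rightarrow> 'm \<Rightarrow> real" where
  "expo E t x \<equiv> ln (growth E t x)"

text \<open>For an invariant bundle this is minus the logarithm of the co-norm of DX_t on the fibre
  over \<open>x\<close>. Indexed by the starting point, it is subadditive over the forward flow
  although it measures backward growth.\<close>

abbreviation expo_inv :: "('m \<Rightarrow> 'e set) \<Rightarrow> real \<Rightarrow> 'm \<Rightarrow> real" where
  "expo_inv F t x \<equiv> ln (growth F (- t) (fl t x))"

lemma op_norm_inverse:
  "x \<in> \<Lambda> \<Longrightarrow> op_norm M (fl t x) x (Dfl (- t) (fl t x)) (F (fl t x)) = growth F (- t) (fl t x)"
  by (simp only: growth_def fl_minus)

text \<open>\<open>min_norm_eq\<close> turns log m into minus \<open>expo_inv\<close>, and minus the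
  limsup of the negatives is a liminf.\<close>

lemma exponents_eq:
  assumes F: "inv_bundle F" and x: "x \<in> \<Lambda>"
  shows "Liminf at_top (\<lambda>t. ereal (1 / t * ln (op_norm M x (fl t x) (Dfl t x) (E x)))) -
      Limsup at_top (\<lambda>t. ereal (1 / t * ln (min_norm M x (fl t x) (Dfl t x) (F x)))) =
    Liminf at_top (\<lambda>t. ereal (expo E t x / t)) + Liminf at_top (\<lambda>t. ereal (expo_inv F t x / t))"
proof -
  have 1: "1 / t * ln (op_norm M x (fl t x) (Dfl t x) (E x)) = expo E t x / t" for t
    by (simp add: growth_def)
  have 2: "ereal (1 / t * ln (min_norm M x (fl t x) (Dfl t x) (F x))) = - ereal (expo_inv F t x / t)" for t
    by (simp add: min_norm_eq[OF F x] ln_inverse growth_pos[OF F fl_mem[OF x]])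
  show ?thesis unfolding 1 2 ereal_Limsup_uminus by (simp add: minus_ereal_def)
qed

lemma expo_add:
  assumes E: "inv_bundle E" and x: "x \<in> \<Lambda>" and st: "0 \<le> s" "0 \<le> t"
  shows "expo E (s + t) x \<le> expo E s x + expo E t (fl s x)"
proof -
  have pos: "0 < growth E s x" "0 < growth E t (fl s x)"
    by (rule growth_pos[OF E x], rule growth_pos[OF E fl_mem[OF x]])
  have "expo E (s + t) x \<le> ln (growth E s x * growth E t (fl s x))"
    by (rule ln_le_cancel_iff[THEN iffD2, OF growth_pos[OF E x] mult_pos_pos[OF pos]
        growth_add[OF E x mult_nonneg_nonneg[OF st]]])
  then show ?thesis by (simp only: ln_mult_pos[OF pos])
qed

lemma expo_inv_add:
  assumes E: "inv_bundle E" and x: "x \<in> \<Lambda>" and st: "0 \<le> s" "0 \<le> t"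
  shows "expo_inv E (s + t) x \<le> expo_inv E s x + expo_inv E t (fl s x)"
proof -
  \<comment> \<open>The backward growth is split starting from the end point: first back by
    \<open>t\<close> to \<open>fl s x\<close>, then back by \<open>s\<close> to
    \<open>x\<close>.\<close>
  let ?z = "fl t (fl s x)"
  have z: "?z \<in> \<Lambda>" using x by simp
  have zs: "fl (- t) ?z = fl s x" by (rule fl_minus[OF fl_mem[OF x]])
  have pos: "0 < growth E (- t) ?z" "0 < growth E (- s) (fl s x)"
    by (rule growth_pos[OF E z], rule growth_pos[OF E fl_mem[OF x]])
  have "0 \<le> (- t) * (- s)" using mult_nonneg_nonneg[OF st(2,1)] by (simp only: minus_mult_minus)
  from growth_add[OF E z this]
  have le: "growth E (- t + - s) ?z \<le> growth E (- t) ?z * growth E (- s) (fl s x)" unfolding zs .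
  have "ln (growth E (- t + - s) ?z) \<le> ln (growth E (- t) ?z * growth E (- s) (fl s x))"
    by (rule ln_le_cancel_iff[THEN iffD2, OF growth_pos[OF E z] mult_pos_pos[OF pos] le])
  then have "ln (growth E (- t + - s) ?z) \<le> ln (growth E (- t) ?z) + ln (growth E (- s) (fl s x))"
    by (simp only: ln_mult_pos[OF pos])
  then show ?thesis unfolding fl_add[OF x] minus_add by (simp only: add.commute)
qed

lemma expo_continuous:
  assumes E: "inv_bundle E"
  shows "continuous_on \<Lambda> (expo E t)" "continuous_on \<Lambda> (expo_inv E t)"
proof -
  have ne: "growth E s x \<noteq> 0" if "x \<in> \<Lambda>" for s x using growth_pos[OF E that, of s] by linarith
  show "continuous_on \<Lambda> (expo E t)"
    by (intro continuous_on_ln growth_continuous[OF E] ballI ne)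
  have "continuous_on \<Lambda> (\<lambda>x. growth E (- t) (fl t x))"
    by (rule continuous_on_compose2[OF growth_continuous[OF E] continuous_fl_space]) auto
  then show "continuous_on \<Lambda> (expo_inv E t)"
    by (intro continuous_on_ln ballI ne fl_mem)
qed

lemma expo_bounded:
  assumes E: "inv_bundle E"
  obtains C where "\<And>t x. 0 \<le> t \<Longrightarrow> x \<in> \<Lambda> \<Longrightarrow> \<bar>expo E t x\<bar> \<le> C * (t + 1)"
    "\<And>t x. 0 \<le> t \<Longrightarrow> x \<in> \<Lambda> \<Longrightarrow> \<bar>expo_inv E t x\<bar> \<le> C * (t + 1)"
proof -
  obtain C where C: "\<And>x t. x \<in> \<Lambda> \<Longrightarrow> \<bar>ln (growth E t x)\<bar> \<le> C * (\<bar>t\<bar> + 1)"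
    by (rule ln_growth_bounded[OF E]) (rule that)
  show ?thesis
  proof (rule that)
    fix t x assume "0 \<le> (t::real)" "x \<in> \<Lambda>"
    then show "\<bar>expo E t x\<bar> \<le> C * (t + 1)" "\<bar>expo_inv E t x\<bar> \<le> C * (t + 1)"
      using C[of x t] C[of "fl t x" "- t"] by simp_all
  qed
qed

text \<open>The sum of the two liminfs is at most the liminf of the sum, and domination makes the
  latter at most \<open>- c\<close>. The value \<open>- (c / 2)\<close> leaves room for a strict
  inequality.\<close>

lemma dominated_imp_exponents:
  assumes E: "inv_bundle E" and F: "inv_bundle F" and x: "x \<in> \<Lambda>" and c: "0 < c"
    and dom: "\<And>t. 0 < t \<Longrightarrow> growth E t x * growth F (- t) (fl t x) < K * exp (- c * t)"
  shows "Liminf at_top (\<lambda>t. ereal (expo E t x / t)) + Liminf at_top (\<lambda>t. ereal (expo_inv F t x / t)) < ereal (- (c / 2))"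
proof -
  obtain C1 where C1: "\<And>t x. 0 \<le> t \<Longrightarrow> x \<in> \<Lambda> \<Longrightarrow> \<bar>expo E t x\<bar> \<le> C1 * (t + 1)"
    by (rule expo_bounded[OF E]) (rule that)
  obtain C2 where C2: "\<And>t x. 0 \<le> t \<Longrightarrow> x \<in> \<Lambda> \<Longrightarrow> \<bar>expo_inv F t x\<bar> \<le> C2 * (t + 1)"
    by (rule expo_bounded[OF F]) (rule that)
  \<comment> \<open>Bounded quotients have finite liminfs, so that their extended sum is an ordinary
    sum.\<close>
  have bd: "\<forall>\<^sub>F t in at_top. \<bar>f t / t\<bar> \<le> 2 * C" if f: "\<And>t. 0 \<le> t \<Longrightarrow> \<bar>f t\<bar> \<le> C * (t + 1)" for f :: "real \<Rightarrow> real" and C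
    using eventually_ge_at_top[of 1]
  proof eventually_elim
    case (elim t)
    have "0 \<le> C" using f[of 0] by simp
    then have "C * (t + 1) \<le> C * (2 * t)" using elim by (intro mult_left_mono) simp_all
    with f[of t] elim have "\<bar>f t\<bar> \<le> 2 * C * t" by simp
    moreover have "\<bar>f t / t\<bar> = \<bar>f t\<bar> / t" using elim by (simp only: abs_divide abs_of_nonneg)
    ultimately show ?case using elim by (simp only: pos_divide_le_eq)
  qed
  obtain \<alpha> where \<alpha>: "Liminf at_top (\<lambda>t. ereal (expo E t x / t)) = ereal \<alpha>"
      "\<And>e. 0 < e \<Longrightarrow> \<forall>\<^sub>F t in at_top. \<alpha> - e < expo E t x / t"
    by (rule Liminf_bounded_real[OF bd[OF C1[OF _ x]]]) (assumption, rule that)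
  obtain \<beta> where \<beta>: "Liminf at_top (\<lambda>t. ereal (expo_inv F t x / t)) = ereal \<beta>"
      "\<And>e. 0 < e \<Longrightarrow> \<forall>\<^sub>F t in at_top. \<beta> - e < expo_inv F t x / t"
    by (rule Liminf_bounded_real[OF bd[OF C2[OF _ x]]]) (assumption, rule that)
  \<comment> \<open>Three errors of \<open>c / 8\<close>, one for each liminf and one for
    \<open>ln K / t\<close>, keep \<open>- c + 3 * c / 8\<close> below
    \<open>- (c / 2)\<close>.\<close>
  have e: "0 < c / 8" using c by simp
  have "((\<lambda>t. ln K / t) \<longlongrightarrow> 0) at_top" by (rule tendsto_divide_0[OF tendsto_const filterlim_at_top_imp_at_infinity[OF filterlim_ident]])
  then have "\<forall>\<^sub>F t in at_top. ln K / t < c / 8" using e by (rule order_tendstoD(2))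
  with \<alpha>(2)[OF e] \<beta>(2)[OF e] eventually_gt_at_top[of 0]
  have "\<forall>\<^sub>F t::real in at_top. \<alpha> + \<beta> < - (c / 2)"
  proof eventually_elim
    case (elim t)
    have pos: "0 < growth E t x" "0 < growth F (- t) (fl t x)"
      by (rule growth_pos[OF E x], rule growth_pos[OF F fl_mem[OF x]])
    have less: "growth E t x * growth F (- t) (fl t x) < K * exp (- c * t)" using dom elim by blast
    have "0 < K * exp (- c * t)" by (rule less_trans[OF mult_pos_pos[OF pos] less])
    then have K: "0 < K" by (rule zero_less_mult_pos2) simp
    have "ln (growth E t x * growth F (- t) (fl t x)) < ln (K * exp (- c * t))"
      by (rule ln_less_cancel_iff[THEN iffD2, OF mult_pos_pos[OF pos] _ less]) fact
    then have "expo E t x + expo_inv F t x < ln K + - c * t"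
      by (simp only: ln_mult_pos[OF pos] ln_mult_pos[OF K exp_gt_zero] ln_exp)
    then have "(expo E t x + expo_inv F t x) / t < (ln K + - c * t) / t"
      using elim by (intro divide_strict_right_mono) auto
    also have "(ln K + - c * t) / t = ln K / t + - c"
      unfolding add_divide_distrib using elim by (simp only: nonzero_mult_div_cancel_right less_imp_neq[symmetric] not_False_eq_True)
    finally have "expo E t x / t + expo_inv F t x / t < ln K / t + - c" unfolding add_divide_distrib .
    then show ?case using elim c by linarith
  qed
  then have "\<alpha> + \<beta> < - (c / 2)" by (simp add: eventually_const_iff)
  then show ?thesis unfolding \<alpha>(1) \<beta>(1) by simp
qed

lemma exponents_imp_dominated:
  assumes E: "inv_bundle E" and F: "inv_bundle F" and \<eta>: "\<eta> < 0" and Y: "total_probability_subset M X \<Lambda> Y"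
    and exponent: "\<And>x. x \<in> Y \<Longrightarrow>
      Liminf at_top (\<lambda>t. ereal (expo E t x / t)) + Liminf at_top (\<lambda>t. ereal (expo_inv F t x / t)) < ereal \<eta>"
  shows "\<exists>K>0. \<exists>c>0. \<forall>x\<in>\<Lambda>. \<forall>t>0. growth E t x * growth F (- t) (fl t x) < K * exp (- c * t)"
proof -
  obtain C1 where C1: "\<And>t x. 0 \<le> t \<Longrightarrow> x \<in> \<Lambda> \<Longrightarrow> \<bar>expo E t x\<bar> \<le> C1 * (t + 1)"
    by (rule expo_bounded[OF E]) (rule that)
  obtain C2 where C2: "\<And>t x. 0 \<le> t \<Longrightarrow> x \<in> \<Lambda> \<Longrightarrow> \<bar>expo_inv F t x\<bar> \<le> C2 * (t + 1)"
    by (rule expo_bounded[OF F]) (rule that)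
  define C where "C = max C1 C2"
  have "\<exists>c>0. \<exists>D. \<forall>x\<in>\<Lambda>. \<forall>t\<ge>0. expo E t x + expo_inv F t x \<le> D - c * t"
  proof (rule uniform_decay[where C=C and \<eta>=\<eta> and Y=Y])
    fix t x assume t: "0 \<le> (t::real)" and x: "x \<in> \<Lambda>"
    show "\<bar>expo E t x\<bar> \<le> C * (t + 1)"
      by (rule order_trans[OF C1[OF t x]]) (rule mult_right_mono, use t in \<open>simp_all add: C_def\<close>)
    show "\<bar>expo_inv F t x\<bar> \<le> C * (t + 1)"
      by (rule order_trans[OF C2[OF t x]]) (rule mult_right_mono, use t in \<open>simp_all add: C_def\<close>)
  next
    fix x assume x: "x \<in> \<Lambda>"
    show "expo E 0 x = 0" by (simp only: growth_0[OF E x] ln_one)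
    show "expo_inv F 0 x = 0" by (simp only: minus_zero fl_0[OF x] growth_0[OF F x] ln_one)
  next
    fix \<mu> assume \<mu>: "prob_space \<mu>" "sets \<mu> = sets (restrict_space borel \<Lambda>)"
      "\<And>t. fl t \<in> measurable \<mu> \<mu>" "\<And>t. distr \<mu> \<mu> (fl t) = \<mu>"
    have sp: "space \<mu> = \<Lambda>" using prob_space_nonempty_restrict[OF \<mu>(1,2)] by simp
    \<comment> \<open>Invariance as an equality of push-forwards is restated through preimages, the
      form in which \<open>invariant_probability\<close> asks for it.\<close>
    have "measure \<mu> (fl t -` A \<inter> \<Lambda>) = measure \<mu> A" if "A \<in> sets \<mu>" for t A
      using measure_distr[OF \<mu>(3) that, of t, symmetric] unfolding \<mu>(4) sp .
    then have "invariant_probability M X \<Lambda> \<mu>"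
      unfolding invariant_probability_def by (intro conjI \<mu>(1,2) sp allI ballI)
    then have "measure \<mu> Y = 1"
      by (rule Y[unfolded total_probability_subset_def, THEN conjunct2, THEN spec, THEN mp])
    then show "AE x in \<mu>. x \<in> Y" by (rule prob_space.AE_prob_1[OF \<mu>(1)])
  qed (rule expo_continuous[OF E] expo_continuous[OF F] expo_add[OF E] expo_inv_add[OF F] \<eta> exponent; assumption)+
  then obtain c D where c: "0 < c"
      and D: "\<forall>x\<in>\<Lambda>. \<forall>t\<ge>0. expo E t x + expo_inv F t x \<le> D - c * t"
    by (elim exE conjE) (rule that)
  \<comment> \<open>The added 1 in \<open>exp D + 1\<close> makes the inequality strict.\<close>
  have "growth E t x * growth F (- t) (fl t x) < (exp D + 1) * exp (- c * t)" if x: "x \<in> \<Lambda>" and t: "0 < t" for x t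
  proof -
    have pos: "0 < growth E t x" "0 < growth F (- t) (fl t x)"
      by (rule growth_pos[OF E x], rule growth_pos[OF F fl_mem[OF x]])
    have "growth E t x * growth F (- t) (fl t x) = exp (expo E t x + expo_inv F t x)"
      by (simp only: exp_add exp_ln[OF pos(1)] exp_ln[OF pos(2)])
    also have "\<dots> \<le> exp (D + - c * t)"
      using D[THEN bspec, OF x, THEN spec, THEN mp, OF less_imp_le[OF t]] by simp
    also have "\<dots> = exp D * exp (- c * t)" by (rule exp_add)
    also have "\<dots> < (exp D + 1) * exp (- c * t)" by (rule mult_strict_right_mono) simp_all
    finally show ?thesis .
  qed
  moreover have "0 < exp D + 1" by (intro add_pos_pos exp_gt_zero zero_less_one)
  ultimately show ?thesis using c by (intro exI[of _ "exp D + 1"] exI[of _ c] conjI ballI allI impI)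
qed

end

theorem theorem1p5:
  fixes M :: "('m::{t2_space,second_countable_topology}, 'e::euclidean_space) manifold_data"
    and X :: "'m \<Rightarrow> 'e"
    and \<Lambda> :: "'m set"
    and E F :: "'m \<Rightarrow> 'e set"
  assumes "riemannian_manifold M"
    and "compact (UNIV :: 'm set)"
    and "connected (UNIV :: 'm set)"
    and "DIM('e) \<ge> 3"
    and "C1_vector_field M X"
    and "inwardly_transverse M X"
    and "compact \<Lambda>"
    and "invariant_set M X \<Lambda>"
    and "continuous_invariant_splitting M X \<Lambda> E F"
  shows "dominated_splitting M X \<Lambda> E F \<longleftrightarrow>
    (\<exists>\<eta><0. \<exists>Y. total_probability_subset M X \<Lambda> Y \<and>
      (\<forall>x\<in>Y.
        Liminf at_top (\<lambda>t. ereal (1 / t * ln (op_norm M x (flow M X t x) (Dflow M X t x) (E x)))) -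
        Limsup at_top (\<lambda>t. ereal (1 / t * ln (min_norm M x (flow M X t x) (Dflow M X t x) (F x))))
          < ereal \<eta>))"
proof -
  interpret flow_system M X \<Lambda>
    by unfold_locales (fact assms)+
  have E: "inv_bundle E" and F: "inv_bundle F"
    using assms(9) unfolding continuous_invariant_splitting_def inv_bundle_def by simp_all
  have dom: "dominated_splitting M X \<Lambda> E F \<longleftrightarrow>
      (\<exists>K>0. \<exists>c>0. \<forall>x\<in>\<Lambda>. \<forall>t>0. growth E t x * growth F (- t) (flow M X t x) < K * exp (- c * t))"
    unfolding dominated_splitting_def using assms(9) op_norm_inverse[where F=F]
    by (simp add: growth_def[of E, symmetric])
  show ?thesis
  proof
    assume "dominated_splitting M X \<Lambda> E F"
    then obtain K c where K: "0 < c"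
        "\<forall>x\<in>\<Lambda>. \<forall>t>0. growth E t x * growth F (- t) (flow M X t x) < K * exp (- c * t)"
      unfolding dom by (elim exE conjE) (rule that)
    \<comment> \<open>Domination gives the exponent gap at every point, so \<Lambda> itself serves
      as \<open>Y\<close>.\<close>
    have "total_probability_subset M X \<Lambda> \<Lambda>"
      unfolding total_probability_subset_def invariant_probability_def
      using prob_space.prob_space by fastforce
    moreover have "Liminf at_top (\<lambda>t. ereal (1 / t * ln (op_norm M x (flow M X t x) (Dflow M X t x) (E x)))) -
        Limsup at_top (\<lambda>t. ereal (1 / t * ln (min_norm M x (flow M X t x) (Dflow M X t x) (F x))))
          < ereal (- (c / 2))" if x: "x \<in> \<Lambda>" for x
      unfolding exponents_eq[OF F x] by (rule dominated_imp_exponents[OF E F x K(1), of K]) (rule K(2)[THEN bspec, OF x, THEN spec, THEN mp])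
    moreover have "- (c / 2) < 0" using K(1) by simp
    ultimately show "\<exists>\<eta><0. \<exists>Y. total_probability_subset M X \<Lambda> Y \<and>
      (\<forall>x\<in>Y.
        Liminf at_top (\<lambda>t. ereal (1 / t * ln (op_norm M x (flow M X t x) (Dflow M X t x) (E x)))) -
        Limsup at_top (\<lambda>t. ereal (1 / t * ln (min_norm M x (flow M X t x) (Dflow M X t x) (F x))))
          < ereal \<eta>)"
      by (intro exI[of _ "- (c / 2)"] exI[of _ \<Lambda>] conjI ballI)
  next
    assume "\<exists>\<eta><0. \<exists>Y. total_probability_subset M X \<Lambda> Y \<and>
      (\<forall>x\<in>Y.
        Liminf at_top (\<lambda>t. ereal (1 / t * ln (op_norm M x (flow M X t x) (Dflow M X t x) (E x)))) -
        Limsup at_top (\<lambda>t. ereal (1 / t * ln (min_norm M x (flow M X t x) (Dflow M X t x) (F x))))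
          < ereal \<eta>)"
    then obtain \<eta> Y where \<eta>: "\<eta> < 0" and Y: "total_probability_subset M X \<Lambda> Y"
      and ex: "\<forall>x\<in>Y.
        Liminf at_top (\<lambda>t. ereal (1 / t * ln (op_norm M x (flow M X t x) (Dflow M X t x) (E x)))) -
        Limsup at_top (\<lambda>t. ereal (1 / t * ln (min_norm M x (flow M X t x) (Dflow M X t x) (F x))))
          < ereal \<eta>"
      by (elim exE conjE) (rule that)
    have sub: "Y \<subseteq> \<Lambda>" using Y by (simp add: total_probability_subset_def)
    show "dominated_splitting M X \<Lambda> E F"
      unfolding dom
    proof (rule exponents_imp_dominated[OF E F \<eta> Y])
      fix x assume x: "x \<in> Y"
      have "x \<in> \<Lambda>" by (rule subsetD[OF sub x])
      from bspec[OF ex x] show "Liminf at_top (\<lambda>t. ereal (ln (growth E t x) / t)) +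
          Liminf at_top (\<lambda>t. ereal (ln (growth F (- t) (flow M X t x)) / t)) < ereal \<eta>"
        unfolding exponents_eq[OF F \<open>x \<in> \<Lambda>\<close>] .
    qed
  qed
qed


end
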